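(* Let $d\in\mathbb{N}$, $0<p\le u<\infty$ and $0<q\le\infty$. If $1\le r<\infty$, then there exists a positive constant $c$ such that $$\left(\frac1{|Q|}\int_Q|f(x)|^r\,dx\right)^{\frac1r}\le c\,(1+|Q|)^{-\frac{\min(1,\frac pr)}{u}}\left(\log\left(e+|Q|^{-1}\right)\right)^{\frac1{q'}}\|f|\mathcal{N}^{\frac du}_{u,p,q}(\mathbb{R}^d)\|$$ holds for all dyadic cubes $Q$ and all $f\in\mathcal{N}^{\frac du}_{u,p,q}(\mathbb{R}^d)$. Here $\frac1{q'}=\max\left(1-\frac1q,0\right)$ (with $\frac1\infty=0$), so that $q'=\infty$ if $0<q\le1$.
   Context: Dyadic cubes: $\mathcal{Q}=\{Q_{j,k}=2^{-j}([0,1)^d+k): j\in\mathbb{Z},\ k\in\mathbb{Z}^d\}$; $|\cdot|$ is Lebesgue measure. Morrey space: for $0<p\le u<\infty$, $\mathcal{M}_{u,p}(\mathbb{R}^d)$ is the set of all $f\in L_p^{\mathrm{loc}}(\mathbb{R}^d)$ with $\|f|\mathcal{M}_{u,p}(\mathbb{R}^d)\|=\sup_{Q\in\mathcal{Q}}|Q|^{\frac1u-\frac1p}\left(\int_Q|f(y)|^p\,dy\right)^{1/p}<\infty$. Resolution of unity: $\varphi_0=\varphi\in\mathcal{S}(\mathbb{R}^d)$ with $\operatorname{supp}\varphi\subset\{|x|\le 2\}$ and $\varphi(x)=1$ for $|x|\le1$; $\varphi_j(x)=\varphi(2^{-j}x)-\varphi(2^{-j+1}x)$ for $j\in\mathbb{N}$.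 $\mathcal{F}$ is the Fourier transform on $\mathcal{S}'(\mathbb{R}^d)$. Besov-Morrey space: for $0<p\le u<\infty$, $0<q\le\infty$, $s\in\mathbb{R}$, $\mathcal{N}^s_{u,p,q}(\mathbb{R}^d)$ is the set of all $f\in\mathcal{S}'(\mathbb{R}^d)$ with $\|f|\mathcal{N}^s_{u,p,q}(\mathbb{R}^d)\|=\left(\sum_{j=0}^\infty 2^{jsq}\|\mathcal{F}^{-1}(\varphi_j\mathcal{F}f)|\mathcal{M}_{u,p}(\mathbb{R}^d)\|^q\right)^{1/q}<\infty$ (usual modification if $q=\infty$). Part of the assertion is that each such $f$ is (identified with) a locally integrable function. *)

theory Defs
  imports "HOL-Analysis.Analysis"
begin

text \<open>The space \<open>\<real>\<^sup>d\<close> is the type \<open>real ^ 'd\<close>, with \<open>d = CARD('d) \<ge> 1\<close>.\<close>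

definition partial_deriv :: "'d::finite \<Rightarrow> (real^'d \<Rightarrow> complex) \<Rightarrow> real^'d \<Rightarrow> complex" where
  "partial_deriv i f = (\<lambda>x. frechet_derivative f (at x) (axis i 1))"

text \<open>Multi-indices are given as lists of directions:
  \<open>iter_partial [i\<^sub>1, \<dots>, i\<^sub>n] f\<close> is \<open>\<partial>\<^bsub>i\<^sub>1\<^esub> \<dots> \<partial>\<^bsub>i\<^sub>n\<^esub> f\<close>.\<close>

primrec iter_partial :: "'d::finite list \<Rightarrow> (real^'d \<Rightarrow> complex) \<Rightarrow> real^'d \<Rightarrow> complex" where
  "iter_partial [] f = f"
| "iter_partial (i # \<alpha>) f = partial_deriv i (iter_partial \<alpha> f)"

definition smooth :: "(real^'d::finite \<Rightarrow> complex) \<Rightarrow> bool" where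
  "smooth f \<longleftrightarrow> (\<forall>\<alpha> x. iter_partial \<alpha> f differentiable (at x))"

definition schwartz :: "(real^'d::finite \<Rightarrow> complex) set" where
  "schwartz = {f. smooth f \<and>
     (\<forall>k \<alpha>. bounded (range (\<lambda>x. (1 + norm x) ^ k * norm (iter_partial \<alpha> f x))))}"

definition schwartz_seminorm ::
    "nat \<Rightarrow> 'd::finite list \<Rightarrow> (real^'d \<Rightarrow> complex) \<Rightarrow> real" where
  "schwartz_seminorm k \<alpha> f = (SUP x. (1 + norm x) ^ k * norm (iter_partial \<alpha> f x))"

text \<open>The locally convex topology defined by these seminorms: its subbasis consists of all
  open seminorm balls.  Its underlying set is \<open>schwartz\<close>.\<close>

definition schwartz_topology :: "(real^'d::finite \<Rightarrow> complex) topology" where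
  "schwartz_topology = topology_generated_by
     {{g \<in> schwartz. schwartz_seminorm k \<alpha> (\<lambda>x. g x - f x) < \<epsilon>} | k \<alpha> f \<epsilon>.
        f \<in> schwartz \<and> 0 < \<epsilon>}"

text \<open>Functionals are represented by total functions on \<open>real^'d \<Rightarrow> complex\<close>, of which only
  the values on \<open>schwartz\<close> are meaningful.\<close>

type_synonym 'd functional = "(real^'d \<Rightarrow> complex) \<Rightarrow> complex"

definition tempered :: "'d::finite functional \<Rightarrow> bool" where
  "tempered T \<longleftrightarrow>
     (\<forall>f\<in>schwartz. \<forall>g\<in>schwartz. \<forall>a b. T (\<lambda>x. a * f x + b * g x) = a * T f + b * T g) \<and>
     continuous_map schwartz_topology euclidean T"

definition test_functions :: "(real^'d::finite \<Rightarrow> complex) set" where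
  "test_functions = {\<psi>. smooth \<psi> \<and> compact (closure {x. \<psi> x \<noteq> 0})}"

definition locally_integrable :: "(real^'d::finite \<Rightarrow> complex) \<Rightarrow> bool" where
  "locally_integrable g \<longleftrightarrow> (\<forall>K. compact K \<longrightarrow> set_integrable lebesgue K g)"

text \<open>The identification of a distribution with a locally integrable function.  It is tested on
  compactly supported functions since a product of a locally integrable function and a Schwartz
  function need not be integrable.\<close>

definition represents :: "(real^'d::finite \<Rightarrow> complex) \<Rightarrow> 'd functional \<Rightarrow> bool" where
  "represents g T \<longleftrightarrow>
     locally_integrable g \<and> (\<forall>\<psi>\<in>test_functions. T \<psi> = (LINT x|lebesgue. g x * \<psi> x))"

definition regular :: "'d::finite functional \<Rightarrow> bool" where
  "regular T \<longleftrightarrow> (\<exists>g. represents g T)"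

text \<open>Unique up to equality almost everywhere.\<close>

definition representative :: "'d::finite functional \<Rightarrow> real^'d \<Rightarrow> complex" where
  "representative T = (SOME g. represents g T)"

definition fourier :: "(real^'d::finite \<Rightarrow> complex) \<Rightarrow> real^'d \<Rightarrow> complex" where
  "fourier f = (\<lambda>\<xi>. of_real ((2 * pi) powr (- real CARD('d) / 2)) *
     (LINT x|lebesgue. exp (- \<i> * of_real (x \<bullet> \<xi>)) * f x))"

definition inv_fourier :: "(real^'d::finite \<Rightarrow> complex) \<Rightarrow> real^'d \<Rightarrow> complex" where
  "inv_fourier f = (\<lambda>x. of_real ((2 * pi) powr (- real CARD('d) / 2)) *
     (LINT \<xi>|lebesgue. exp (\<i> * of_real (x \<bullet> \<xi>)) * f \<xi>))"

definition distr_fourier :: "'d::finite functional \<Rightarrow> 'd functional" where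
  "distr_fourier T = (\<lambda>\<psi>. T (fourier \<psi>))"

definition distr_inv_fourier :: "'d::finite functional \<Rightarrow> 'd functional" where
  "distr_inv_fourier T = (\<lambda>\<psi>. T (inv_fourier \<psi>))"

definition distr_mult :: "(real^'d::finite \<Rightarrow> complex) \<Rightarrow> 'd functional \<Rightarrow> 'd functional" where
  "distr_mult \<eta> T = (\<lambda>\<psi>. T (\<lambda>x. \<eta> x * \<psi> x))"

definition dyadic_cube :: "int \<Rightarrow> int^'d::finite \<Rightarrow> (real^'d) set" where
  "dyadic_cube j k =
     (\<lambda>y. (2 powr (- real_of_int j)) *\<^sub>R (y + (\<chi> i. real_of_int (k $ i)))) `
       {y. \<forall>i. 0 \<le> y $ i \<and> y $ i < 1}"

definition dyadic_cubes :: "(real^'d::finite) set set" where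
  "dyadic_cubes = {dyadic_cube j k | j k. True}"

text \<open>Powers of elements of \<open>[0, \<infinity>]\<close>; only used for positive exponents.\<close>

definition epowr :: "ennreal \<Rightarrow> real \<Rightarrow> ennreal" where
  "epowr x a = (if x = \<infinity> then \<infinity> else ennreal (enn2real x powr a))"

text \<open>For measurable \<open>f\<close>, finiteness of \<open>morrey_norm u p f\<close> entails that \<open>f\<close> belongs to
  \<open>L\<^sub>p\<close> locally, so that it is equivalent to membership in the Morrey space.\<close>

definition morrey_norm :: "real \<Rightarrow> real \<Rightarrow> (real^'d::finite \<Rightarrow> complex) \<Rightarrow> ennreal" where
  "morrey_norm u p f =
     (SUP Q\<in>dyadic_cubes. ennreal (measure lebesgue Q powr (1 / u - 1 / p)) *
        epowr (\<integral>\<^sup>+ y\<in>Q. ennreal (norm (f y) powr p) \<partial>lebesgue) (1 / p))"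

definition distr_morrey_norm :: "real \<Rightarrow> real \<Rightarrow> 'd::finite functional \<Rightarrow> ennreal" where
  "distr_morrey_norm u p T = (if regular T then morrey_norm u p (representative T) else \<infinity>)"

definition resolution_generator :: "(real^'d::finite \<Rightarrow> complex) \<Rightarrow> bool" where
  "resolution_generator \<phi> \<longleftrightarrow> \<phi> \<in> schwartz \<and>
     closure {x. \<phi> x \<noteq> 0} \<subseteq> {x. norm x \<le> 2} \<and> (\<forall>x. norm x \<le> 1 \<longrightarrow> \<phi> x = 1)"

definition resolution :: "(real^'d::finite \<Rightarrow> complex) \<Rightarrow> nat \<Rightarrow> real^'d \<Rightarrow> complex" where
  "resolution \<phi> j = (if j = 0 then \<phi>
     else (\<lambda>x. \<phi> ((2 powr (- real j)) *\<^sub>R x) - \<phi> ((2 powr (- real j + 1)) *\<^sub>R x)))"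

definition frequency_block ::
    "(real^'d::finite \<Rightarrow> complex) \<Rightarrow> nat \<Rightarrow> 'd functional \<Rightarrow> 'd functional" where
  "frequency_block \<phi> j f = distr_inv_fourier (distr_mult (resolution \<phi> j) (distr_fourier f))"

definition besov_morrey_norm ::
    "(real^'d::finite \<Rightarrow> complex) \<Rightarrow> real \<Rightarrow> real \<Rightarrow> real \<Rightarrow> ennreal \<Rightarrow> 'd functional \<Rightarrow> ennreal" where
  "besov_morrey_norm \<phi> s u p q f =
     (if q = \<infinity>
      then (SUP j. ennreal (2 powr (real j * s)) * distr_morrey_norm u p (frequency_block \<phi> j f))
      else epowr (\<Sum>j. ennreal (2 powr (real j * s * enn2real q)) *
                    epowr (distr_morrey_norm u p (frequency_block \<phi> j f)) (enn2real q))
             (1 / enn2real q))"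

definition besov_morrey ::
    "(real^'d::finite \<Rightarrow> complex) \<Rightarrow> real \<Rightarrow> real \<Rightarrow> real \<Rightarrow> ennreal \<Rightarrow> 'd functional set" where
  "besov_morrey \<phi> s u p q = {f. tempered f \<and> besov_morrey_norm \<phi> s u p q f < \<infinity>}"

text \<open>The number \<open>1 / q'\<close>; note \<open>1 / \<infinity> = 0\<close> in \<open>ennreal\<close>.\<close>

definition inv_conj_exponent :: "ennreal \<Rightarrow> real" where
  "inv_conj_exponent q = max (1 - enn2real (1 / q)) 0"

end

theory Submission
  imports Defs "HOL-Probability.Probability"
begin

text \<open>The \<open>j\<close>-th block of \<open>f\<close> is the smooth function
  \<open>G\<^sub>j y = f (k\<^sub>j (\<cdot> - y))\<close>, where \<open>k\<^sub>j\<close> is a multiple of the Fourier transform of \<open>\<phi>\<^sub>j\<close>, and it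
  is reproduced by convolution with a dilated Schwartz kernel.  Hence
  \<open>sup |G\<^sub>j| \<le> C b\<^sub>j\<close> with \<open>b\<^sub>j = 2\<^bsup>jd/u\<^esup> \<parallel>G\<^sub>j | M\<^bsub>u,p\<^esub>\<parallel>\<close> (Nikol'skij).  On a cube \<open>Q\<close> of side
  \<open>2\<^bsup>-J\<^esup>\<close>, interpolating between this and the Morrey bound shows that the \<open>r\<close>-th mean of \<open>G\<^sub>j\<close>
  over \<open>Q\<close> is at most \<open>C b\<^sub>j min (1, 2\<^bsup>(J-j)a\<^esup>)\<close> with \<open>a = d min (1, p/r) / u\<close>.  By Minkowski's
  inequality these means can be summed: the \<open>J\<close> blocks with \<open>j < J\<close> cost \<open>J\<^bsup>1/q'\<^esup>\<close>, which is the
  logarithm, and the others form a geometric series.\<close>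

section \<open>Smooth functions, Schwartz functions and test functions\<close>

text \<open>A distribution enters only through linearity and one seminorm inequality, so exchanging
  T with an integral over translates needs an argument of its own; \<open>smear\<close> carries it,
  and both the reproducing formula and the convergence of the block sums to T rest on it. For p < 1
  the Nikol'skij estimate is a self-improvement a \<le> a^(1-p) X, void for a = \<infinity>, while
  block functions are known beforehand only to grow polynomially, at a rate depending on T; a damped
  supremum removes this obstacle without letting that rate enter the constant. The Morrey norm of a
  distribution is taken of a representative picked by \<open>SOME\<close>, and the estimate is
  asserted for every representative, so uniqueness almost everywhere has to be proved for Lebesgue
  measurable functions. That f is a function at all follows from the case r = 1, J = 0 of the same
  block estimates. Hoelder's inequality is replaced by splitting at a level, which costs factors 2,
  and an arbitrarily small \<delta> > 0 keeps the weights in Minkowski's inequality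
  positive.\<close>

lemma partial_deriv_eqI:
  "(f has_derivative D) (at x) \<Longrightarrow> partial_deriv i f x = D (axis i 1)"
  by (simp add: partial_deriv_def frechet_derivative_at[symmetric])

text \<open>Seminorms only see partial derivatives, so derivatives are brought to this gradient
  form. Differentiation under the integral is stated in it too, and
  \<open>partial_deriv_gradient\<close> reads a partial derivative off again.\<close>

lemma has_derivative_partials:
  fixes f :: "real^'d::finite \<Rightarrow> complex"
  assumes "f differentiable (at x)"
  shows "(f has_derivative (\<lambda>h. \<Sum>i\<in>UNIV. of_real (h $ i) * partial_deriv i f x)) (at x)"
proof -
  have d: "(f has_derivative frechet_derivative f (at x)) (at x)"
    using assms frechet_derivative_works by blast
  then interpret bounded_linear "frechet_derivative f (at x)" by (rule has_derivative_bounded_linear)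
  have "frechet_derivative f (at x) h = (\<Sum>i\<in>UNIV. of_real (h $ i) * partial_deriv i f x)" for h
  proof -
    have "frechet_derivative f (at x) h = frechet_derivative f (at x) (\<Sum>i\<in>UNIV. (h $ i) *\<^sub>R axis i 1)"
      using basis_expansion[of h] by (simp add: scalar_mult_eq_scaleR)
    also have "\<dots> = (\<Sum>i\<in>UNIV. of_real (h $ i) * partial_deriv i f x)"
      by (simp add: sum scaleR) (simp add: partial_deriv_def scaleR_conv_of_real)
    finally show ?thesis .
  qed
  then show ?thesis using d by (metis (no_types, lifting) ext)
qed

lemma smoothD: "smooth f \<Longrightarrow> f differentiable (at x)"
  unfolding smooth_def by (metis iter_partial.simps(1))

lemma iter_partial_snoc: "iter_partial \<alpha> (partial_deriv i f) = iter_partial (\<alpha> @ [i]) f"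
  by (induction \<alpha>) auto

lemma smooth_partial_deriv: "smooth f \<Longrightarrow> smooth (partial_deriv i f)"
  by (auto simp: smooth_def iter_partial_snoc)

lemma smooth_iter_partial: "smooth f \<Longrightarrow> smooth (iter_partial \<alpha> f)"
  by (induction \<alpha>) (auto intro: smooth_partial_deriv)

text \<open>A family of differentiable functions that is stable under \<open>partial_deriv\<close>
  contains all iterated derivatives of its members. This avoids formulas for higher
  derivatives.\<close>

lemma smooth_coinduct:
  assumes "f \<in> X" "\<And>g x. g \<in> X \<Longrightarrow> g differentiable (at x)"
    and "\<And>g i. g \<in> X \<Longrightarrow> partial_deriv i g \<in> X"
  shows "smooth f"
proof -
  have "iter_partial \<alpha> f \<in> X" for \<alpha>
    by (induction \<alpha>) (use assms in auto)
  then show ?thesis using assms by (auto simp: smooth_def)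
qed

text \<open>Because the family also contains all derivatives of its members, polynomial decay of the
  members themselves already bounds every Schwartz seminorm.\<close>

lemma schwartz_coinduct:
  assumes "f \<in> X" "\<And>g x. g \<in> X \<Longrightarrow> g differentiable (at x)"
    and "\<And>g i. g \<in> X \<Longrightarrow> partial_deriv i g \<in> X"
    and bd: "\<And>g k. g \<in> X \<Longrightarrow> \<exists>B. \<forall>x. (1 + norm x) ^ k * norm (g x) \<le> B"
  shows "f \<in> schwartz"
proof -
  have X: "iter_partial \<alpha> f \<in> X" for \<alpha>
    by (induction \<alpha>) (use assms in auto)
  have "bounded (range (\<lambda>x. (1 + norm x) ^ k * norm (iter_partial \<alpha> f x)))" for k \<alpha>
    using bd[OF X, of k \<alpha>] by (auto simp: bounded_iff)
  then show ?thesis using smooth_coinduct[OF assms(1-3)] by (auto simp: schwartz_def)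
qed

lemma schwartz_smooth: "f \<in> schwartz \<Longrightarrow> smooth f"
  by (simp add: schwartz_def)

lemma schwartz_iter_partial: "f \<in> schwartz \<Longrightarrow> iter_partial \<alpha> f \<in> schwartz"
proof -
  have "iter_partial \<beta> (iter_partial \<alpha> f) = iter_partial (\<beta> @ \<alpha>) f" for \<beta>
    by (induction \<beta>) auto
  then show "f \<in> schwartz \<Longrightarrow> iter_partial \<alpha> f \<in> schwartz"
    by (auto simp: schwartz_def smooth_iter_partial)
qed

lemma schwartz_partial_deriv: "f \<in> schwartz \<Longrightarrow> partial_deriv i f \<in> schwartz"
  using schwartz_iter_partial[of f "[i]"] by simp

lemma schwartz_decay:
  assumes "f \<in> schwartz"
  obtains B where "B \<ge> 0" "\<And>x. (1 + norm x) ^ k * norm (f x) \<le> B"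
proof -
  have "bounded (range (\<lambda>x. (1 + norm x) ^ k * norm (iter_partial [] f x)))"
    using assms unfolding schwartz_def by blast
  then obtain B where "\<And>x. norm ((1 + norm x) ^ k * norm (f x)) \<le> B"
    by (auto simp: bounded_iff)
  then have *: "(1 + norm x) ^ k * norm (f x) \<le> B" for x by (metis abs_le_D1 real_norm_def)
  have "B \<ge> 0" using *[of 0] by (meson norm_ge_zero order.trans mult_nonneg_nonneg zero_le_power add_nonneg_nonneg zero_le_one)
  then show ?thesis using * that by blast
qed

text \<open>The product rule leads from one product to a sum of products, so no single operation
  gives a family stable under differentiation. Closing under all operations at once does, and one
  appeal to \<open>smooth_coinduct\<close> yields the closure properties of \<open>smooth\<close>
  below.\<close>

inductive smooth_closure :: "(real^'d::finite \<Rightarrow> complex) \<Rightarrow> bool" where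
  smooth: "smooth f \<Longrightarrow> smooth_closure f"
| add: "smooth_closure f \<Longrightarrow> smooth_closure g \<Longrightarrow> smooth_closure (\<lambda>x. f x + g x)"
| mult: "smooth_closure f \<Longrightarrow> smooth_closure g \<Longrightarrow> smooth_closure (\<lambda>x. f x * g x)"
| const: "smooth_closure (\<lambda>x. c)"
| coord: "smooth_closure (\<lambda>x. of_real (x $ i))"
| cnj: "smooth_closure f \<Longrightarrow> smooth_closure (\<lambda>x. cnj (f x))"
| affine: "smooth_closure f \<Longrightarrow> smooth_closure (\<lambda>x. f (a *\<^sub>R x + b))"

lemma partial_deriv_add:
  assumes "f differentiable (at x)" "g differentiable (at x)"
  shows "partial_deriv i (\<lambda>x. f x + g x) x = partial_deriv i f x + partial_deriv i g x"
  using assms unfolding frechet_derivative_works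
  by (subst partial_deriv_eqI[OF has_derivative_add]) (auto simp: partial_deriv_def)

lemma partial_deriv_mult:
  assumes "f differentiable (at x)" "g differentiable (at x)"
  shows "partial_deriv i (\<lambda>x. f x * g x) x = f x * partial_deriv i g x + partial_deriv i f x * g x"
  using assms unfolding frechet_derivative_works
  by (subst partial_deriv_eqI[OF has_derivative_mult]) (auto simp: partial_deriv_def)

lemma partial_deriv_const [simp]: "partial_deriv i (\<lambda>x. c) = (\<lambda>x. 0)"
  by (auto simp: partial_deriv_def)

lemma has_derivative_coord:
  "((\<lambda>x::real^'d::finite. complex_of_real (x $ i)) has_derivative (\<lambda>h. of_real (h $ i))) (at x)"
  by (intro bounded_linear.has_derivative[OF bounded_linear_of_real]
      bounded_linear.has_derivative[OF bounded_linear_vec_nth] has_derivative_ident)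

lemma partial_deriv_coord:
  "partial_deriv j (\<lambda>x::real^'d::finite. complex_of_real (x $ i)) = (\<lambda>x. if i = j then 1 else 0)"
  by (rule ext, subst partial_deriv_eqI[OF has_derivative_coord]) (auto simp: axis_def)

lemma has_derivative_cnj:
  assumes "f differentiable (at x)"
  shows "((\<lambda>x. cnj (f x)) has_derivative (\<lambda>h. cnj (frechet_derivative f (at x) h))) (at x)"
  using assms unfolding frechet_derivative_works by (rule bounded_linear.has_derivative[OF bounded_linear_cnj])

lemma partial_deriv_cnj:
  assumes "f differentiable (at x)"
  shows "partial_deriv i (\<lambda>x. cnj (f x)) x = cnj (partial_deriv i f x)"
  by (subst partial_deriv_eqI[OF has_derivative_cnj[OF assms]]) (simp add: partial_deriv_def)

lemma has_derivative_affine_comp: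
  fixes f :: "real^'d::finite \<Rightarrow> complex"
  assumes "f differentiable (at (a *\<^sub>R x + b))"
  shows "((\<lambda>x. f (a *\<^sub>R x + b)) has_derivative (\<lambda>h. frechet_derivative f (at (a *\<^sub>R x + b)) (a *\<^sub>R h))) (at x)"
proof -
  have "((\<lambda>x. a *\<^sub>R x + b) has_derivative (\<lambda>h. a *\<^sub>R h)) (at x)"
    by (auto intro!: derivative_eq_intros)
  from has_derivative_compose[OF this assms[unfolded frechet_derivative_works]]
  show ?thesis .
qed

lemma partial_deriv_affine:
  fixes f :: "real^'d::finite \<Rightarrow> complex"
  assumes "f differentiable (at (a *\<^sub>R x + b))"
  shows "partial_deriv i (\<lambda>x. f (a *\<^sub>R x + b)) x = of_real a * partial_deriv i f (a *\<^sub>R x + b)"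
proof -
  interpret bounded_linear "frechet_derivative f (at (a *\<^sub>R x + b))"
    using assms unfolding frechet_derivative_works by (rule has_derivative_bounded_linear)
  show ?thesis
    by (subst partial_deriv_eqI[OF has_derivative_affine_comp[OF assms]])
       (simp add: partial_deriv_def scaleR, simp add: scaleR_conv_of_real)
qed

lemma smooth_closure_differentiable:
  "smooth_closure f \<Longrightarrow> f differentiable (at x)"
proof (induction arbitrary: x rule: smooth_closure.induct)
  case (cnj f)
  show ?case using has_derivative_cnj[OF cnj.IH] by (auto simp: differentiable_def)
next
  case (affine f a b)
  show ?case using has_derivative_affine_comp[OF affine.IH] by (auto simp: differentiable_def)
next
  case (coord i)
  show ?case using has_derivative_coord by (auto simp: differentiable_def)
qed (auto intro: smoothD)

lemma smooth_closure_partial_deriv: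
  "smooth_closure f \<Longrightarrow> smooth_closure (partial_deriv i f)"
proof (induction rule: smooth_closure.induct)
  case (smooth f)
  then show ?case by (intro smooth_closure.smooth smooth_partial_deriv)
next
  case (add f g)
  have "partial_deriv i (\<lambda>x. f x + g x) = (\<lambda>x. partial_deriv i f x + partial_deriv i g x)"
    using add.hyps by (auto intro!: partial_deriv_add smooth_closure_differentiable)
  then show ?case using add.IH by (simp add: smooth_closure.add)
next
  case (mult f g)
  have "partial_deriv i (\<lambda>x. f x * g x) = (\<lambda>x. f x * partial_deriv i g x + partial_deriv i f x * g x)"
    using mult.hyps by (auto intro!: partial_deriv_mult smooth_closure_differentiable)
  then show ?case using mult by (simp add: smooth_closure.intros)
next
  case (coord j)
  then show ?case by (simp add: partial_deriv_coord smooth_closure.const)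
next
  case (cnj f)
  have "partial_deriv i (\<lambda>x. cnj (f x)) = (\<lambda>x. cnj (partial_deriv i f x))"
    using cnj.hyps by (auto intro!: partial_deriv_cnj smooth_closure_differentiable)
  then show ?case using cnj.IH by (simp add: smooth_closure.cnj)
next
  case (affine f a b)
  have "partial_deriv i (\<lambda>x. f (a *\<^sub>R x + b)) = (\<lambda>x. of_real a * partial_deriv i f (a *\<^sub>R x + b))"
    using affine.hyps by (auto intro!: partial_deriv_affine smooth_closure_differentiable)
  then show ?case using affine.IH by (simp add: smooth_closure.intros)
qed (auto intro: smooth_closure.const)

lemma smooth_closure_smooth: "smooth_closure f \<Longrightarrow> smooth f"
  by (rule smooth_coinduct[of f "Collect smooth_closure"])
     (auto intro: smooth_closure_differentiable smooth_closure_partial_deriv)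

lemma smooth_add: "smooth f \<Longrightarrow> smooth g \<Longrightarrow> smooth (\<lambda>x. f x + g x)"
  using smooth_closure.add[OF smooth_closure.smooth smooth_closure.smooth] smooth_closure_smooth by blast

lemma smooth_mult: "smooth f \<Longrightarrow> smooth g \<Longrightarrow> smooth (\<lambda>x. f x * g x)"
  using smooth_closure.mult[OF smooth_closure.smooth smooth_closure.smooth] smooth_closure_smooth by blast

lemma smooth_const: "smooth (\<lambda>x. c)"
  using smooth_closure.const smooth_closure_smooth by blast

lemma smooth_coord: "smooth (\<lambda>x. of_real (x $ i))"
  using smooth_closure.coord smooth_closure_smooth by blast

lemma smooth_cnj: "smooth f \<Longrightarrow> smooth (\<lambda>x. cnj (f x))"
  using smooth_closure.cnj[OF smooth_closure.smooth] smooth_closure_smooth by blast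

lemma smooth_affine: "smooth f \<Longrightarrow> smooth (\<lambda>x. f (a *\<^sub>R x + b))"
  using smooth_closure.affine[OF smooth_closure.smooth] smooth_closure_smooth by blast

lemma smooth_continuous: "smooth f \<Longrightarrow> continuous_on S f"
  by (intro differentiable_imp_continuous_on)
     (auto simp: differentiable_on_def intro: smoothD differentiable_at_withinI)

lemma iter_partial_lincomb:
  assumes "smooth f" "smooth g"
  shows "iter_partial \<alpha> (\<lambda>x. a * f x + b * g x) = (\<lambda>x. a * iter_partial \<alpha> f x + b * iter_partial \<alpha> g x)"
proof (induction \<alpha>)
  case (Cons i \<alpha>)
  let ?f = "iter_partial \<alpha> f" and ?g = "iter_partial \<alpha> g"
  have d: "?f differentiable (at x)" "?g differentiable (at x)" for x
    using assms by (auto intro: smoothD smooth_iter_partial)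
  have "((\<lambda>x. a * ?f x + b * ?g x) has_derivative
      (\<lambda>h. a * frechet_derivative ?f (at x) h + b * frechet_derivative ?g (at x) h)) (at x)" for x
    using d[of x] unfolding frechet_derivative_works
    by (intro has_derivative_add has_derivative_mult_right)
  then have "partial_deriv i (\<lambda>x. a * ?f x + b * ?g x) x = a * partial_deriv i ?f x + b * partial_deriv i ?g x" for x
    by (subst partial_deriv_eqI) (auto simp: partial_deriv_def)
  then show ?case using Cons by auto
qed auto

lemma schwartz_lincomb:
  assumes "f \<in> schwartz" "g \<in> schwartz"
  shows "(\<lambda>x. a * f x + b * g x) \<in> schwartz"
proof (rule schwartz_coinduct[of _ "{\<lambda>x. a * f x + b * g x | f g. f \<in> schwartz \<and> g \<in> schwartz}"])
  show "(\<lambda>x. a * f x + b * g x) \<in> {\<lambda>x. a * f x + b * g x | f g. f \<in> schwartz \<and> g \<in> schwartz}"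
    using assms by blast
next
  fix h x assume "h \<in> {\<lambda>x. a * f x + b * g x | f g. f \<in> schwartz \<and> g \<in> schwartz}"
  then show "h differentiable at x"
    by (elim CollectE exE conjE)
       (simp, intro differentiable_add differentiable_mult differentiable_const smoothD schwartz_smooth)
next
  fix h i assume "h \<in> {\<lambda>x. a * f x + b * g x | f g. f \<in> schwartz \<and> g \<in> schwartz}"
  then obtain f g where h: "h = (\<lambda>x. a * f x + b * g x)" "f \<in> schwartz" "g \<in> schwartz" by blast
  have "partial_deriv i h = (\<lambda>x. a * partial_deriv i f x + b * partial_deriv i g x)"
    unfolding h using iter_partial_lincomb[of f g "[i]" a b] h by (simp add: schwartz_smooth)
  then show "partial_deriv i h \<in> {\<lambda>x. a * f x + b * g x | f g. f \<in> schwartz \<and> g \<in> schwartz}"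
    using h schwartz_partial_deriv by blast
next
  fix h k assume "h \<in> {\<lambda>x. a * f x + b * g x | f g. f \<in> schwartz \<and> g \<in> schwartz}"
  then obtain f g where h: "h = (\<lambda>x. a * f x + b * g x)" "f \<in> schwartz" "g \<in> schwartz" by blast
  obtain B where B: "\<And>x. (1 + norm x) ^ k * norm (f x) \<le> B" using schwartz_decay h by metis
  obtain C where C: "\<And>x. (1 + norm x) ^ k * norm (g x) \<le> C" using schwartz_decay h by metis
  have "(1 + norm x) ^ k * norm (h x) \<le> norm a * B + norm b * C" for x
  proof -
    have "(1 + norm x) ^ k * norm (h x) \<le> (1 + norm x) ^ k * (norm a * norm (f x) + norm b * norm (g x))"
      unfolding h by (intro mult_left_mono order.trans[OF norm_triangle_ineq]) (auto simp: norm_mult)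
    also have "\<dots> = norm a * ((1 + norm x) ^ k * norm (f x)) + norm b * ((1 + norm x) ^ k * norm (g x))"
      by (simp add: algebra_simps)
    also have "\<dots> \<le> norm a * B + norm b * C"
      using B C by (intro add_mono mult_left_mono) auto
    finally show ?thesis .
  qed
  then show "\<exists>B. \<forall>x. (1 + norm x) ^ k * norm (h x) \<le> B" by blast
qed

lemma schwartz_zero: "(\<lambda>x. 0) \<in> schwartz"
  by (rule schwartz_coinduct[of _ "{\<lambda>x. 0}"]) auto

text \<open>Peetre's inequality. It transfers a polynomial weight from one point to a translated one
  at the price of a power of the translation; the uniform estimates for translates rest on
  it.\<close>

lemma one_plus_norm_le:
  fixes x y :: "'a::real_normed_vector"
  shows "(1 + norm x) ^ k \<le> (1 + norm (x - y)) ^ k * (1 + norm y) ^ k"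
proof -
  have "norm x \<le> norm (x - y) + norm y" by (metis diff_add_cancel norm_triangle_ineq)
  then have "1 + norm x \<le> (1 + norm (x - y)) * (1 + norm y)"
    by (simp add: algebra_simps) (smt (verit) mult_nonneg_nonneg norm_ge_zero)
  then have "(1 + norm x) ^ k \<le> ((1 + norm (x - y)) * (1 + norm y)) ^ k"
    by (rule power_mono) simp
  then show ?thesis by (simp add: power_mult_distrib)
qed

lemma iter_partial_translate:
  assumes "smooth f"
  shows "iter_partial \<alpha> (\<lambda>x. f (x - v)) = (\<lambda>x. iter_partial \<alpha> f (x - v))"
proof (induction \<alpha>)
  case (Cons i \<alpha>)
  have "partial_deriv i (\<lambda>x. iter_partial \<alpha> f (x - v)) x = partial_deriv i (iter_partial \<alpha> f) (x - v)" for x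
    using partial_deriv_affine[of "iter_partial \<alpha> f" 1 x "- v" i] assms
    by (simp add: smoothD smooth_iter_partial)
  then show ?case using Cons by auto
qed auto

lemma schwartz_translate:
  assumes "f \<in> schwartz"
  shows "(\<lambda>x. f (x - v)) \<in> schwartz"
proof (rule schwartz_coinduct[of _ "(\<lambda>f x. f (x - v)) ` schwartz"])
  fix h x assume "h \<in> (\<lambda>f x. f (x - v)) ` schwartz"
  then obtain f where "h = (\<lambda>x. f (x - v))" "f \<in> schwartz" by (rule imageE)
  then show "h differentiable at x"
    using smoothD[OF smooth_affine[of f 1 "-v"]] by (simp add: schwartz_smooth)
next
  fix h i assume "h \<in> (\<lambda>f x. f (x - v)) ` schwartz"
  then obtain f where h: "h = (\<lambda>x. f (x - v))" "f \<in> schwartz" by (rule imageE)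
  have "partial_deriv i h = (\<lambda>x. partial_deriv i f (x - v))"
    unfolding h using iter_partial_translate[of f "[i]" v] h by (simp add: schwartz_smooth)
  then show "partial_deriv i h \<in> (\<lambda>f x. f (x - v)) ` schwartz"
    using schwartz_partial_deriv[OF h(2), of i] by (rule image_eqI)
next
  fix h k assume "h \<in> (\<lambda>f x. f (x - v)) ` schwartz"
  then obtain f where h: "h = (\<lambda>x. f (x - v))" "f \<in> schwartz" by (rule imageE)
  obtain B where B: "\<And>x. (1 + norm x) ^ k * norm (f x) \<le> B" using schwartz_decay h by metis
  have "(1 + norm x) ^ k * norm (h x) \<le> (1 + norm v) ^ k * B" for x
  proof -
    have "(1 + norm x) ^ k * norm (h x) \<le> ((1 + norm (x - v)) ^ k * (1 + norm v) ^ k) * norm (h x)"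
      by (intro mult_right_mono one_plus_norm_le) auto
    also have "\<dots> = (1 + norm v) ^ k * ((1 + norm (x - v)) ^ k * norm (f (x - v)))"
      by (simp add: h mult_ac)
    also have "\<dots> \<le> (1 + norm v) ^ k * B" by (intro mult_left_mono B) auto
    finally show ?thesis .
  qed
  then show "\<exists>B. \<forall>x. (1 + norm x) ^ k * norm (h x) \<le> B" by blast
qed (rule image_eqI[OF refl assms])

section \<open>Smooth functions of compact support\<close>

lemma test_function_support:
  assumes "\<psi> \<in> test_functions"
  obtains R where "R > 0" "\<And>x. norm x > R \<Longrightarrow> \<psi> x = 0"
proof -
  have "bounded (closure {x. \<psi> x \<noteq> 0})" using assms compact_imp_bounded by (auto simp: test_functions_def)
  then have "bounded {x. \<psi> x \<noteq> 0}" by (rule bounded_subset[OF _ closure_subset])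
  then obtain R where "R > 0" "\<forall>x\<in>{x. \<psi> x \<noteq> 0}. norm x \<le> R" using bounded_pos by blast
  then show ?thesis using that[of R] by force
qed

lemma test_functionI:
  assumes "smooth \<psi>" "\<And>x. norm x > R \<Longrightarrow> \<psi> x = 0"
  shows "\<psi> \<in> test_functions"
proof -
  have "{x. \<psi> x \<noteq> 0} \<subseteq> cball 0 R" using assms(2) by (auto simp: not_less[symmetric])
  then have "bounded {x. \<psi> x \<noteq> 0}" by (rule bounded_subset[rotated]) auto
  then have "compact (closure {x. \<psi> x \<noteq> 0})" using compact_closure by blast
  then show ?thesis using assms by (auto simp: test_functions_def)
qed

lemma test_function_smooth: "\<psi> \<in> test_functions \<Longrightarrow> smooth \<psi>"
  by (auto simp: test_functions_def)

lemma test_function_mult: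
  assumes "smooth f" "\<psi> \<in> test_functions"
  shows "(\<lambda>x. f x * \<psi> x) \<in> test_functions"
proof -
  obtain R where R: "\<And>x. norm x > R \<Longrightarrow> \<psi> x = 0"
    using test_function_support[OF assms(2)] by metis
  show ?thesis
    by (rule test_functionI[OF smooth_mult[OF assms(1) test_function_smooth[OF assms(2)]], of R])
       (simp add: R)
qed

lemma test_function_add:
  assumes "\<psi> \<in> test_functions" "\<eta> \<in> test_functions"
  shows "(\<lambda>x. \<psi> x + \<eta> x) \<in> test_functions"
proof -
  obtain R where R: "\<And>x. norm x > R \<Longrightarrow> \<psi> x = 0"
    using test_function_support[OF assms(1)] by metis
  obtain S where S: "\<And>x. norm x > S \<Longrightarrow> \<eta> x = 0"
    using test_function_support[OF assms(2)] by metis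
  show ?thesis
    by (rule test_functionI[OF smooth_add[OF test_function_smooth[OF assms(1)] test_function_smooth[OF assms(2)]],
        of "max R S"]) (simp add: R S)
qed

lemma test_function_affine:
  assumes "\<psi> \<in> test_functions" "a \<noteq> 0"
  shows "(\<lambda>x. \<psi> (a *\<^sub>R x + b)) \<in> test_functions"
proof -
  obtain R where R: "R > 0" "\<And>x. norm x > R \<Longrightarrow> \<psi> x = 0" using test_function_support[OF assms(1)] by metis
  have "\<psi> (a *\<^sub>R x + b) = 0" if "norm x > (R + norm b) / \<bar>a\<bar>" for x
  proof (rule R)
    have "R + norm b < \<bar>a\<bar> * norm x" using that assms by (simp add: field_simps)
    moreover have "norm (a *\<^sub>R x) \<le> norm (a *\<^sub>R x + b) + norm b"
      by (metis add_diff_cancel_right' norm_triangle_ineq4)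
    ultimately show "R < norm (a *\<^sub>R x + b)" by simp
  qed
  then show ?thesis by (rule test_functionI[OF smooth_affine[OF test_function_smooth[OF assms(1)]]])
qed

text \<open>The region |x| > R is open, so around each of its points \<psi> agrees with 0 and its
  derivative vanishes there.\<close>

lemma test_function_partial_deriv:
  assumes "\<psi> \<in> test_functions"
  shows "partial_deriv i \<psi> \<in> test_functions"
proof -
  obtain R where R: "\<And>x. norm x > R \<Longrightarrow> \<psi> x = 0" using test_function_support[OF assms] by metis
  have "partial_deriv i \<psi> x = 0" if "norm x > R" for x
  proof -
    have "open {x::real^'a. R < norm x}" by (intro open_Collect_less continuous_intros)
    then have "\<forall>\<^sub>F y in nhds x. R < norm y" using that eventually_nhds by blast
    then have ev: "\<forall>\<^sub>F y in nhds x. \<psi> y = 0" by eventually_elim (use R in auto)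
    have "(\<psi> has_derivative (\<lambda>h. 0)) (at x)"
      by (rule has_derivative_transform_eventually[OF has_derivative_const[of 0]])
         (use ev that R in \<open>auto simp: eventually_at_filter elim: eventually_mono\<close>)
    then show ?thesis by (subst partial_deriv_eqI) auto
  qed
  then show ?thesis by (rule test_functionI[OF smooth_partial_deriv[OF test_function_smooth[OF assms]]])
qed

lemma test_function_schwartz: "\<psi> \<in> test_functions \<Longrightarrow> \<psi> \<in> schwartz"
proof (rule schwartz_coinduct[of _ test_functions])
  fix g :: "real^'a::finite \<Rightarrow> complex" and k assume g: "g \<in> test_functions"
  obtain R where R: "\<And>x. norm x > R \<Longrightarrow> g x = 0" using test_function_support[OF g] by metis
  have "continuous_on (cball 0 R) (\<lambda>x. (1 + norm x) ^ k * norm (g x))"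
    by (intro continuous_intros smooth_continuous test_function_smooth g)
  then have "bounded ((\<lambda>x. (1 + norm x) ^ k * norm (g x)) ` cball 0 R)"
    by (intro compact_imp_bounded compact_continuous_image) auto
  then obtain B where "\<forall>y\<in>(\<lambda>x. (1 + norm x) ^ k * norm (g x)) ` cball 0 R. norm y \<le> B"
    using bounded_iff by blast
  then have B: "\<And>x. norm x \<le> R \<Longrightarrow> norm ((1 + norm x) ^ k * norm (g x)) \<le> B" by auto
  have "(1 + norm x) ^ k * norm (g x) \<le> max B 0" for x
    using B[of x] R[of x] by (cases "norm x \<le> R") (auto simp: le_max_iff_disj)
  then show "\<exists>B. \<forall>x. (1 + norm x) ^ k * norm (g x) \<le> B" by blast
qed (auto intro: smoothD test_function_smooth test_function_partial_deriv)

section \<open>Parameter integrals, Fourier transforms and smearing\<close>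

text \<open>By the mean value inequality the bound \<open>B\<close> on the partials controls the
  difference quotients, so dominated convergence applies to the remainder divided by |h|. The
  dominating function is 2 d B: one d B for the increment and one for its linear part.\<close>

lemma has_derivative_integral:
  fixes F :: "real^'d::finite \<Rightarrow> 'b \<Rightarrow> complex"
  assumes int: "\<And>x. integrable M (F x)"
    and der: "\<And>x y. ((\<lambda>x. F x y) has_derivative (\<lambda>h. \<Sum>i\<in>UNIV. of_real (h $ i) * P i x y)) (at x)"
    and meas: "\<And>i. P i x \<in> borel_measurable M"
    and bnd: "\<And>i z y. z \<in> ball x 1 \<Longrightarrow> norm (P i z y) \<le> B y" and B: "integrable M B"
  shows "((\<lambda>x. \<integral>y. F x y \<partial>M) has_derivative (\<lambda>h. \<Sum>i\<in>UNIV. of_real (h $ i) * (\<integral>y. P i x y \<partial>M))) (at x)"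
proof -
  let ?d = "real CARD('d)"
  let ?D = "\<lambda>h y. \<Sum>i\<in>UNIV. of_real (h $ i) * P i x y"
  have intP: "integrable M (P i x)" for i
    by (rule Bochner_Integration.integrable_bound[OF B meas]) (use bnd[of x i] in \<open>auto intro!: AE_I2 order.trans[OF _ abs_ge_self]\<close>)
  have sumbnd: "norm (\<Sum>i\<in>UNIV. of_real (h $ i) * P i z y) \<le> ?d * B y * norm h" if "z \<in> ball x 1" for h z y
  proof -
    have "norm (\<Sum>i\<in>UNIV. of_real (h $ i) * P i z y) \<le> (\<Sum>i\<in>(UNIV::'d set). norm h * B y)"
      by (intro sum_norm_le) (auto simp: norm_mult intro!: mult_mono component_le_norm_cart bnd that)
    then show ?thesis by (simp add: mult_ac)
  qed
  have Fdiff: "norm (F (x + h) y - F x y) \<le> ?d * B y * norm h" if "norm h < 1" for h y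
  proof -
    have "norm (F (x + h) y - F x y) \<le> (?d * B y) * norm ((x + h) - x)"
    proof (rule differentiable_bound[where S="ball x 1" and f="\<lambda>x. F x y"])
      show "((\<lambda>x. F x y) has_derivative (\<lambda>h. \<Sum>i\<in>UNIV. of_real (h $ i) * P i z y)) (at z within ball x 1)" for z
        by (rule has_derivative_at_withinI[OF der])
      show "onorm (\<lambda>h. \<Sum>i\<in>UNIV. of_real (h $ i) * P i z y) \<le> ?d * B y" if "z \<in> ball x 1" for z
        using sumbnd[OF that] by (intro onorm_le) auto
    qed (use that in \<open>auto simp: dist_norm\<close>)
    then show ?thesis by simp
  qed
  let ?R = "\<lambda>h y. F (x + h) y - F x y - ?D h y"
  have lin: "(\<integral>y. F (x + h) y \<partial>M) - (\<integral>y. F x y \<partial>M) - (\<Sum>i\<in>UNIV. of_real (h $ i) * (\<integral>y. P i x y \<partial>M)) = (\<integral>y. ?R h y \<partial>M)" for h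
    by (simp add: int intP)
  show ?thesis unfolding has_derivative_at lin
  proof
    show "bounded_linear (\<lambda>h. \<Sum>i\<in>UNIV. complex_of_real (h $ i) * (\<integral>y. P i x y \<partial>M))"
      by (intro bounded_linear_sum bounded_linear_mult_const bounded_linear_compose[OF bounded_linear_of_real bounded_linear_vec_nth])
    show "(\<lambda>h. norm (\<integral>y. ?R h y \<partial>M) / norm h) \<midarrow>0\<rightarrow> 0"
      unfolding tendsto_at_iff_sequentially
    proof (intro allI impI)
      fix X :: "nat \<Rightarrow> real^'d" assume X: "\<forall>i. X i \<in> UNIV - {0}" "X \<longlonglongrightarrow> 0"
      \<comment> \<open>The mean value estimate is available for increments of norm below 1; a tail
        of the sequence satisfies this, and shifting by \<open>N\<close> does not affect the
        limit.\<close>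
      obtain N where N: "\<And>n. n \<ge> N \<Longrightarrow> norm (X n) < 1"
        using LIMSEQ_D[OF X(2), of 1] by auto
      have "(\<lambda>n. \<integral>y. ?R (X (n + N)) y / of_real (norm (X (n + N))) \<partial>M) \<longlonglongrightarrow> (\<integral>y. 0 \<partial>M)"
      proof (rule integral_dominated_convergence)
        show "integrable M (\<lambda>y. 2 * (?d * B y))" using B by simp
        show "(\<lambda>y. ?R (X (n + N)) y / of_real (norm (X (n + N)))) \<in> borel_measurable M" for n
          using int intP by (intro borel_measurable_integrable) simp
        show "AE y in M. (\<lambda>n. ?R (X (n + N)) y / of_real (norm (X (n + N)))) \<longlonglongrightarrow> 0"
        proof (rule AE_I2)
          fix y
          have "(\<lambda>h. norm (?R h y) / norm h) \<midarrow>0\<rightarrow> 0"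
            using der[of y x] unfolding has_derivative_at by blast
          then have "((\<lambda>h. norm (?R h y) / norm h) \<circ> X) \<longlonglongrightarrow> 0"
            unfolding tendsto_at_iff_sequentially using X by blast
          then have "(\<lambda>n. norm (?R (X n) y / of_real (norm (X n)))) \<longlonglongrightarrow> 0"
            by (simp add: o_def norm_divide)
          then have "(\<lambda>n. ?R (X n) y / of_real (norm (X n))) \<longlonglongrightarrow> 0"
            by (rule tendsto_norm_zero_cancel)
          then show "(\<lambda>n. ?R (X (n + N)) y / of_real (norm (X (n + N)))) \<longlonglongrightarrow> 0"
            by (rule LIMSEQ_ignore_initial_segment)
        qed
        show "AE y in M. norm (?R (X (n + N)) y / of_real (norm (X (n + N)))) \<le> 2 * (?d * B y)" for n
        proof (rule AE_I2)
          fix y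
          let ?h = "X (n + N)"
          have h: "norm ?h > 0" "norm ?h < 1" using X N[of "n + N"] by auto
          have "norm (?R ?h y) \<le> norm (F (x + ?h) y - F x y) + norm (?D ?h y)" by (rule norm_triangle_ineq4)
          also have "\<dots> \<le> ?d * B y * norm ?h + ?d * B y * norm ?h"
            by (intro add_mono Fdiff h sumbnd) auto
          finally show "norm (?R ?h y / of_real (norm ?h)) \<le> 2 * (?d * B y)"
            using h by (simp add: norm_divide divide_le_eq mult_ac)
        qed
      qed simp
      then have "(\<lambda>n. norm (\<integral>y. ?R (X (n + N)) y / of_real (norm (X (n + N))) \<partial>M)) \<longlonglongrightarrow> 0"
        by (intro tendsto_norm_zero) simp
      then have "(\<lambda>n. norm (\<integral>y. ?R (X (n + N)) y \<partial>M) / norm (X (n + N))) \<longlonglongrightarrow> 0"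
        by (simp add: norm_divide)
      then show "((\<lambda>h. norm (\<integral>y. ?R h y \<partial>M) / norm h) \<circ> X) \<longlonglongrightarrow> 0"
        unfolding o_def by (rule LIMSEQ_offset)
    qed
  qed
qed

lemma partial_deriv_gradient:
  assumes "(f has_derivative (\<lambda>h. \<Sum>i\<in>UNIV. of_real (h $ i) * P i)) (at x)"
  shows "partial_deriv i f x = P i"
proof -
  have "partial_deriv i f x = (\<Sum>j\<in>UNIV. of_real (axis i 1 $ j) * P j)"
    using partial_deriv_eqI[OF assms] .
  also have "\<dots> = (\<Sum>j\<in>UNIV. if j = i then P j else 0)" by (intro sum.cong) (auto simp: axis_def)
  finally show ?thesis by simp
qed

lemma integrable_inverse_1_plus_square_real: "integrable lborel (\<lambda>x::real. 1 / (1 + x\<^sup>2))"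
  using integrable_inverse_1_plus_square
  by (simp add: set_integrable_def einterval_def inverse_eq_divide)

text \<open>The exponent 2 d lets the weight split along coordinates: each factor (1 + |x|)^(-2) is
  at most 1 / (1 + x_b^2), and a product of one-dimensional Cauchy kernels is integrable. This is
  the origin of the 2 d in the weights below.\<close>

lemma integrable_inverse_power_norm:
  "integrable lborel (\<lambda>x::real^'d::finite. 1 / (1 + norm x) ^ (2 * CARD('d)))"
  unfolding integrable_iff_bounded
proof
  have le: "1 / (1 + norm x) ^ (2 * CARD('d)) \<le> (\<Prod>b\<in>Basis. 1 / (1 + (x \<bullet> b)\<^sup>2))" for x :: "real^'d"
  proof -
    have "1 / (1 + norm x) ^ (2 * CARD('d)) = (\<Prod>b\<in>(Basis::(real^'d) set). 1 / (1 + norm x)\<^sup>2)"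
      by (simp add: power_one_over power_mult)
    also have "\<dots> \<le> (\<Prod>b\<in>Basis. 1 / (1 + (x \<bullet> b)\<^sup>2))"
    proof (rule prod_mono, safe)
      fix b :: "real^'d" assume "b \<in> Basis"
      then have "\<bar>x \<bullet> b\<bar> \<le> norm x" by (rule Basis_le_norm)
      then have "(x \<bullet> b)\<^sup>2 \<le> (norm x)\<^sup>2" by (metis abs_ge_zero power2_abs power_mono)
      moreover have "1 + (norm x)\<^sup>2 \<le> (1 + norm x)\<^sup>2" by (simp add: power2_sum)
      ultimately have "1 + (x \<bullet> b)\<^sup>2 \<le> (1 + norm x)\<^sup>2" by linarith
      then show "1 / (1 + norm x)\<^sup>2 \<le> 1 / (1 + (x \<bullet> b)\<^sup>2)"
        by (intro divide_left_mono mult_pos_pos zero_less_power) (simp_all add: add_pos_nonneg)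
    qed auto
    finally show ?thesis .
  qed
  have "(\<integral>\<^sup>+(x::real^'d). ennreal (norm (1 / (1 + norm x) ^ (2 * CARD('d)))) \<partial>lborel)
      \<le> (\<integral>\<^sup>+(x::real^'d). (\<Prod>b\<in>Basis. ennreal (1 / (1 + (x \<bullet> b)\<^sup>2))) \<partial>lborel)"
    by (intro nn_integral_mono) (auto simp: prod_ennreal intro!: ennreal_leI le)
  also have "\<dots> = (\<Prod>b\<in>(Basis::(real^'d) set). \<integral>\<^sup>+x. ennreal (1 / (1 + x\<^sup>2)) \<partial>lborel)"
    by (rule nn_integral_lborel_prod) auto
  also have "\<dots> < \<infinity>"
    using integrable_inverse_1_plus_square_real unfolding integrable_iff_bounded
    by (simp add: power_less_top_ennreal)
  finally show "(\<integral>\<^sup>+(x::real^'d). ennreal (norm (1 / (1 + norm x) ^ (2 * CARD('d)))) \<partial>lborel) < \<infinity>" .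
qed measurable

section \<open>Integrability of Schwartz functions and affine changes of variables\<close>

lemma schwartz_continuous: "f \<in> schwartz \<Longrightarrow> continuous_on S f"
  by (rule smooth_continuous[OF schwartz_smooth])

lemma schwartz_measurable [measurable_dest]: "f \<in> schwartz \<Longrightarrow> f \<in> borel_measurable borel"
  by (rule borel_measurable_continuous_onI[OF schwartz_continuous])

lemma schwartz_integrable_weighted:
  fixes f :: "real^'d::finite \<Rightarrow> complex"
  assumes "f \<in> schwartz"
  shows "integrable lborel (\<lambda>x. (1 + norm x) ^ k * norm (f x))"
proof -
  obtain B where B: "B \<ge> 0" "\<And>x. (1 + norm x) ^ (k + 2 * CARD('d)) * norm (f x) \<le> B"
    using schwartz_decay[OF assms] by metis
  show ?thesis
  proof (rule Bochner_Integration.integrable_bound)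
    show "integrable lborel (\<lambda>x::real^'d. B * (1 / (1 + norm x) ^ (2 * CARD('d))))"
      by (intro integrable_mult_right integrable_inverse_power_norm)
    show "(\<lambda>x. (1 + norm x) ^ k * norm (f x)) \<in> borel_measurable lborel"
      using schwartz_measurable[OF assms] by measurable
    show "AE x in lborel. norm ((1 + norm x) ^ k * norm (f x)) \<le> norm (B * (1 / (1 + norm x) ^ (2 * CARD('d))))"
    proof (rule AE_I2)
      fix x :: "real^'d"
      have "1 + norm x > 0" by (simp add: add_pos_nonneg)
      then show "norm ((1 + norm x) ^ k * norm (f x)) \<le> norm (B * (1 / (1 + norm x) ^ (2 * CARD('d))))"
        using B(1) B(2)[of x] by (simp add: pos_le_divide_eq power_add mult_ac abs_mult)
    qed
  qed
qed

lemma schwartz_integrable: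
  assumes "f \<in> schwartz"
  shows "integrable lborel f"
  using schwartz_integrable_weighted[OF assms, of 0] schwartz_measurable[OF assms]
  by (simp add: integrable_iff_bounded)

lemma schwartz_bounded:
  assumes "f \<in> schwartz"
  obtains B where "B \<ge> 0" "\<And>x. norm (f x) \<le> B"
  using schwartz_decay[OF assms, of 0] by auto

lemma integral_lborel_affine:
  fixes f :: "'a::euclidean_space \<Rightarrow> 'b::{banach, second_countable_topology}"
  assumes "f \<in> borel_measurable borel" "c \<noteq> 0"
  shows "(\<integral>x. f x \<partial>lborel) = (\<bar>c\<bar> ^ DIM('a)) *\<^sub>R (\<integral>x. f (t + c *\<^sub>R x) \<partial>lborel)"
  using assms by (subst lborel_affine[OF assms(2), of t]) (simp add: integral_density integral_distr)

lemma nn_integral_lborel_affine: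
  fixes f :: "'a::euclidean_space \<Rightarrow> ennreal"
  assumes "f \<in> borel_measurable borel" "c \<noteq> 0"
  shows "(\<integral>\<^sup>+x. f x \<partial>lborel) = ennreal (\<bar>c\<bar> ^ DIM('a)) * (\<integral>\<^sup>+x. f (t + c *\<^sub>R x) \<partial>lborel)"
  using assms by (subst lborel_affine[OF assms(2), of t]) (simp add: nn_integral_density nn_integral_distr nn_integral_cmult)

lemma integrable_lborel_affine:
  fixes f :: "'a::euclidean_space \<Rightarrow> 'b::{banach, second_countable_topology}"
  assumes "integrable lborel f" "c \<noteq> 0"
  shows "integrable lborel (\<lambda>x. f (t + c *\<^sub>R x))"
proof -
  have [measurable]: "f \<in> borel_measurable borel" using assms(1) by (simp add: integrable_iff_bounded)
  have "(\<integral>\<^sup>+x. norm (f x) \<partial>lborel) < \<infinity>" using assms(1) by (simp add: integrable_iff_bounded)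
  then have "(\<integral>\<^sup>+x. norm (f (t + c *\<^sub>R x)) \<partial>lborel) < \<infinity>"
    using assms(2) by (subst (asm) nn_integral_lborel_affine[of _ c t]) (auto simp: ennreal_mult_less_top)
  then show ?thesis by (simp add: integrable_iff_bounded)
qed

text \<open>The integral of f (y + x) over y does not depend on x, by translation invariance.
  Differentiating it at x = 0 under the integral sign gives the claim without iterated integrals or
  boundary terms.\<close>

lemma integral_partial_deriv_zero:
  fixes f :: "real^'d::finite \<Rightarrow> complex"
  assumes "f \<in> schwartz"
  shows "(\<integral>x. partial_deriv i f x \<partial>lborel) = 0"
proof -
  let ?n = "2 * CARD('d)"
  have "\<exists>B. \<forall>x. (1 + norm x) ^ ?n * norm (partial_deriv j f x) \<le> B" for j
    using schwartz_decay[OF schwartz_partial_deriv[OF assms]] by metis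
  then obtain B where B: "\<And>j x. (1 + norm x) ^ ?n * norm (partial_deriv j f x) \<le> B j" by metis
  define C where "C = Max (range B)"
  have C: "(1 + norm x) ^ ?n * norm (partial_deriv j f x) \<le> C" for j x
    by (rule order.trans[OF B]) (auto simp: C_def)
  have [measurable]: "f \<in> borel_measurable borel" "partial_deriv j f \<in> borel_measurable borel" for j
    using assms by (auto intro: schwartz_measurable schwartz_partial_deriv)
  have "((\<lambda>x. \<integral>y. f (y + x) \<partial>lborel) has_derivative
      (\<lambda>h. \<Sum>i\<in>UNIV. of_real (h $ i) * (\<integral>y. partial_deriv i f (y + 0) \<partial>lborel))) (at 0)"
  proof (rule has_derivative_integral[where B="\<lambda>y. (2 ^ ?n * C) * (1 / (1 + norm y) ^ ?n)"])
    show "integrable lborel (\<lambda>y. f (y + x))" for x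
      using integrable_lborel_affine[OF schwartz_integrable[OF assms], of 1 x] by (simp add: add.commute)
    show "((\<lambda>x. f (y + x)) has_derivative (\<lambda>h. \<Sum>i\<in>UNIV. of_real (h $ i) * partial_deriv i f (y + x))) (at x)" for x y
    proof -
      have "((\<lambda>x. y + x) has_derivative (\<lambda>h. h)) (at x)" by (auto intro!: derivative_eq_intros)
      from has_derivative_compose[OF this has_derivative_partials[OF smoothD[OF schwartz_smooth[OF assms]]]]
      show ?thesis .
    qed
    show "integrable lborel (\<lambda>y::real^'d. (2 ^ ?n * C) * (1 / (1 + norm y) ^ ?n))"
      by (intro integrable_mult_right integrable_inverse_power_norm)
    show "norm (partial_deriv j f (y + z)) \<le> (2 ^ ?n * C) * (1 / (1 + norm y) ^ ?n)" if z: "z \<in> ball 0 1" for j z y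
    proof -
      have p: "0 < (1 + norm y) ^ ?n" by (simp add: add_pos_nonneg)
      \<comment> \<open>Peetre's inequality with a shift of norm below 1, which costs the factor
        2^(2 d).\<close>
      have "(1 + norm y) ^ ?n \<le> (1 + norm (y - (- z))) ^ ?n * (1 + norm (- z)) ^ ?n" by (rule one_plus_norm_le)
      also have "\<dots> \<le> (1 + norm (y + z)) ^ ?n * 2 ^ ?n"
        using z by (intro mult_mono power_mono) auto
      finally have "(1 + norm y) ^ ?n * norm (partial_deriv j f (y + z)) \<le> ((1 + norm (y + z)) ^ ?n * 2 ^ ?n) * norm (partial_deriv j f (y + z))"
        by (rule mult_right_mono) simp
      also have "\<dots> = 2 ^ ?n * ((1 + norm (y + z)) ^ ?n * norm (partial_deriv j f (y + z)))" by (simp add: mult_ac)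
      also have "\<dots> \<le> 2 ^ ?n * C" by (intro mult_left_mono C) auto
      finally show ?thesis using p by (simp add: pos_le_divide_eq mult.commute)
    qed
  qed simp
  moreover have "(\<lambda>x. \<integral>y. f (y + x) \<partial>lborel) = (\<lambda>x. \<integral>y. f y \<partial>lborel)"
    using integral_lborel_affine[of f 1] by (simp add: add.commute)
  ultimately have "partial_deriv i (\<lambda>x::real^'d. \<integral>y. f y \<partial>lborel) 0 = (\<integral>y. partial_deriv i f (y + 0) \<partial>lborel)"
    by (intro partial_deriv_gradient) simp
  then show ?thesis by simp
qed

section \<open>The Fourier transform of test functions\<close>

lemma smooth_exp_inner: "smooth (\<lambda>\<xi>::real^'d::finite. exp (- \<i> * of_real (x \<bullet> \<xi>)))"
  and partial_deriv_exp_inner: "partial_deriv i (\<lambda>\<xi>::real^'d::finite. exp (- \<i> * of_real (x \<bullet> \<xi>)))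
      = (\<lambda>\<xi>. (- \<i> * of_real (x $ i)) * exp (- \<i> * of_real (x \<bullet> \<xi>)))"
proof -
  let ?e = "\<lambda>c. \<lambda>\<xi>::real^'d. c * exp (- \<i> * of_real (x \<bullet> \<xi>))"
  have d: "(?e c has_derivative (\<lambda>h. c * ((- \<i> * of_real (x \<bullet> h)) * exp (- \<i> * of_real (x \<bullet> \<xi>))))) (at \<xi>)" for c \<xi>
  proof -
    have "((\<lambda>\<xi>. - \<i> * of_real (x \<bullet> \<xi>)) has_derivative (\<lambda>h. - \<i> * of_real (x \<bullet> h))) (at \<xi>)"
      by (intro has_derivative_mult_right bounded_linear.has_derivative[OF bounded_linear_of_real]
          bounded_linear.has_derivative[OF bounded_linear_inner_right] has_derivative_ident)
    from has_derivative_compose[OF this DERIV_exp[unfolded has_field_derivative_def]]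
    show ?thesis by (intro has_derivative_mult_right) (simp add: mult.commute)
  qed
  have p: "partial_deriv i (?e c) = ?e (- c * \<i> * of_real (x $ i))" for i c
    by (rule ext, subst partial_deriv_eqI[OF d]) (simp add: inner_axis algebra_simps)
  show "smooth (\<lambda>\<xi>::real^'d::finite. exp (- \<i> * of_real (x \<bullet> \<xi>)))"
  proof (rule smooth_coinduct[where X="range ?e"])
    show "(\<lambda>\<xi>. exp (- \<i> * of_real (x \<bullet> \<xi>))) \<in> range ?e" by (rule range_eqI[of _ _ 1]) simp
    show "g differentiable (at z)" if "g \<in> range ?e" for g z
      using that d by (auto simp: differentiable_def)
    show "partial_deriv i g \<in> range ?e" if "g \<in> range ?e" for g i
    proof -
      from that obtain c where "g = ?e c" by (rule rangeE)
      show ?thesis unfolding \<open>g = ?e c\<close> p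
        by (rule range_eqI[of _ _ "- c * \<i> * of_real (x $ i)"]) (rule refl)
    qed
  qed
  show "partial_deriv i (\<lambda>\<xi>::real^'d::finite. exp (- \<i> * of_real (x \<bullet> \<xi>)))
      = (\<lambda>\<xi>. (- \<i> * of_real (x $ i)) * exp (- \<i> * of_real (x \<bullet> \<xi>)))"
    using p[of i 1] by simp
qed

text \<open>Unnormalised, and an integral over \<open>lborel\<close>: the powers of 2 pi are
  collected once in \<open>conv_kernel\<close>, and Borel integrands suit Fubini.
  \<open>fourier_eq_FT\<close> gives the link with \<open>fourier\<close>.\<close>

definition FT :: "(real^'d::finite \<Rightarrow> complex) \<Rightarrow> real^'d \<Rightarrow> complex" where
  "FT f = (\<lambda>x. \<integral>\<xi>. exp (- \<i> * of_real (x \<bullet> \<xi>)) * f \<xi> \<partial>lborel)"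

lemma norm_exp_inner [simp]: "norm (exp (- (\<i> * complex_of_real t))) = 1"
  by (metis mult_minus_right norm_exp_i_times of_real_minus)

lemma test_function_measurable: "f \<in> test_functions \<Longrightarrow> f \<in> borel_measurable borel"
  by (intro schwartz_measurable test_function_schwartz)

lemma integrable_bounded_mult:
  fixes f g :: "'a \<Rightarrow> complex"
  assumes "integrable M f" "g \<in> borel_measurable M" "\<And>x. norm (g x) \<le> B"
  shows "integrable M (\<lambda>x. g x * f x)"
proof (rule Bochner_Integration.integrable_bound)
  show "integrable M (\<lambda>x. B * norm (f x))" using assms(1) by simp
  show "(\<lambda>x. g x * f x) \<in> borel_measurable M"
    using assms(2) borel_measurable_integrable[OF assms(1)] by (rule borel_measurable_times)
  show "AE x in M. norm (g x * f x) \<le> norm (B * norm (f x))"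
    by (auto simp: norm_mult abs_mult intro!: AE_I2 mult_right_mono order.trans[OF assms(3) abs_ge_self])
qed

lemma integrable_exp_mult:
  "integrable lborel f \<Longrightarrow> integrable lborel (\<lambda>\<xi>::real^'d::finite. exp (- (\<i> * of_real (x \<bullet> \<xi>))) * f \<xi>)"
  by (rule integrable_bounded_mult[where B=1]) auto

lemma FT_has_derivative:
  fixes \<eta> :: "real^'d::finite \<Rightarrow> complex"
  assumes "\<eta> \<in> test_functions"
  shows "(FT \<eta> has_derivative (\<lambda>h. \<Sum>i\<in>UNIV. of_real (h $ i) * FT (\<lambda>\<xi>. (- \<i> * of_real (\<xi> $ i)) * \<eta> \<xi>) x)) (at x)"
  unfolding FT_def
proof (rule has_derivative_integral[where B="\<lambda>\<xi>. (1 + norm \<xi>) ^ 1 * norm (\<eta> \<xi>)"])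
  note [measurable] = test_function_measurable[OF assms]
  show "integrable lborel (\<lambda>\<xi>. exp (- \<i> * of_real (x \<bullet> \<xi>)) * \<eta> \<xi>)" for x
    using assms integrable_exp_mult[OF schwartz_integrable[OF test_function_schwartz]] by simp
  show "integrable lborel (\<lambda>\<xi>. (1 + norm \<xi>) ^ 1 * norm (\<eta> \<xi>))"
    by (intro schwartz_integrable_weighted test_function_schwartz assms)
  show "norm (exp (- \<i> * of_real (z \<bullet> \<xi>)) * ((- \<i> * of_real (\<xi> $ i)) * \<eta> \<xi>)) \<le> (1 + norm \<xi>) ^ 1 * norm (\<eta> \<xi>)" for i z \<xi>
    using component_le_norm_cart[of \<xi> i] by (auto simp: norm_mult intro!: mult_right_mono)
  show "((\<lambda>x. exp (- \<i> * of_real (x \<bullet> \<xi>)) * \<eta> \<xi>) has_derivative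
      (\<lambda>h. \<Sum>i\<in>UNIV. of_real (h $ i) * (exp (- \<i> * of_real (x \<bullet> \<xi>)) * ((- \<i> * of_real (\<xi> $ i)) * \<eta> \<xi>)))) (at x)" for x \<xi>
  proof -
    have "((\<lambda>x. exp (- \<i> * of_real (\<xi> \<bullet> x)) * \<eta> \<xi>) has_derivative
      (\<lambda>h. (\<Sum>i\<in>UNIV. of_real (h $ i) * ((- \<i> * of_real (\<xi> $ i)) * exp (- \<i> * of_real (\<xi> \<bullet> x)))) * \<eta> \<xi>)) (at x)"
      using has_derivative_partials[OF smoothD[OF smooth_exp_inner[of \<xi>]], of x]
      unfolding partial_deriv_exp_inner by (rule has_derivative_mult_left)
    then show ?thesis by (simp add: sum_distrib_right sum_distrib_left inner_commute mult_ac)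
  qed
  show "(\<lambda>\<xi>. exp (- \<i> * of_real (x \<bullet> \<xi>)) * ((- \<i> * of_real (\<xi> $ i)) * \<eta> \<xi>)) \<in> borel_measurable lborel" for i
    by measurable
qed

text \<open>Integration by parts: the character times \<eta> is again a test function, so the
  integral of its partial derivative is 0, and the product rule turns this into the
  identity.\<close>

lemma FT_coord_mult:
  fixes \<eta> :: "real^'d::finite \<Rightarrow> complex"
  assumes "\<eta> \<in> test_functions"
  shows "of_real (x $ i) * FT \<eta> x = FT (\<lambda>\<xi>. - \<i> * partial_deriv i \<eta> \<xi>) x"
proof -
  let ?e = "\<lambda>\<xi>. exp (- \<i> * of_real (x \<bullet> \<xi>))"
  have sm: "smooth \<eta>" "smooth ?e" using test_function_smooth[OF assms] smooth_exp_inner[of x] by auto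
  have i1: "integrable lborel (\<lambda>\<xi>. ?e \<xi> * \<eta> \<xi>)"
    using assms integrable_exp_mult[OF schwartz_integrable[OF test_function_schwartz]] by simp
  have i2: "integrable lborel (\<lambda>\<xi>. ?e \<xi> * partial_deriv i \<eta> \<xi>)"
    using integrable_exp_mult[OF schwartz_integrable[OF test_function_schwartz[OF test_function_partial_deriv[OF assms]]]] by simp
  have "(\<lambda>\<xi>. ?e \<xi> * \<eta> \<xi>) \<in> schwartz"
    by (intro test_function_schwartz test_function_mult assms sm)
  from integral_partial_deriv_zero[OF this, of i]
  have "0 = (\<integral>\<xi>. ?e \<xi> * partial_deriv i \<eta> \<xi> + ((- \<i> * of_real (x $ i)) * ?e \<xi>) * \<eta> \<xi> \<partial>lborel)"
    by (simp add: partial_deriv_mult smoothD[OF sm(1)] smoothD[OF sm(2), simplified] partial_deriv_exp_inner[simplified])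
  also have "\<dots> = (\<integral>\<xi>. ?e \<xi> * partial_deriv i \<eta> \<xi> + (- \<i> * of_real (x $ i)) * (?e \<xi> * \<eta> \<xi>) \<partial>lborel)"
    by (simp add: mult_ac)
  also have "\<dots> = FT (partial_deriv i \<eta>) x + (- \<i> * of_real (x $ i)) * FT \<eta> x"
    unfolding FT_def using i1 i2 by (subst Bochner_Integration.integral_add) auto
  finally have *: "FT (partial_deriv i \<eta>) x = \<i> * (of_real (x $ i) * FT \<eta> x)" by (simp add: algebra_simps)
  have "FT (\<lambda>\<xi>. - \<i> * partial_deriv i \<eta> \<xi>) x = - \<i> * FT (partial_deriv i \<eta>) x"
    unfolding FT_def by (subst integral_mult_right_zero[symmetric]) (simp add: mult_ac)
  then show ?thesis unfolding * by (simp flip: mult.assoc)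
qed

text \<open>One factor 1 + |x| is at most 1 plus the sum of the |x $ i|, and each coordinate is
  traded for a derivative of \<eta>, again a test function. Hence the induction on \<open>k\<close>
  runs over all test functions simultaneously.\<close>

lemma FT_decay:
  fixes \<eta> :: "real^'d::finite \<Rightarrow> complex"
  assumes "\<eta> \<in> test_functions"
  shows "\<exists>B. \<forall>x. (1 + norm x) ^ k * norm (FT \<eta> x) \<le> B"
  using assms
proof (induction k arbitrary: \<eta>)
  case 0
  have "norm (FT \<eta> x) \<le> (\<integral>\<xi>. norm (\<eta> \<xi>) \<partial>lborel)" for x
    unfolding FT_def by (rule order.trans[OF integral_norm_bound]) (simp add: norm_mult)
  then show ?case by auto
next
  case (Suc k)
  let ?\<eta> = "\<lambda>i \<xi>. - \<i> * partial_deriv i \<eta> \<xi>"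
  have "?\<eta> i \<in> test_functions" for i
    by (intro test_function_mult smooth_const test_function_partial_deriv Suc.prems)
  then have "\<exists>B. \<forall>x. (1 + norm x) ^ k * norm (FT (?\<eta> i) x) \<le> B" for i by (rule Suc.IH)
  then obtain B where B: "\<And>i x. (1 + norm x) ^ k * norm (FT (?\<eta> i) x) \<le> B i" by metis
  obtain B0 where B0: "\<And>x. (1 + norm x) ^ k * norm (FT \<eta> x) \<le> B0" using Suc.IH[OF Suc.prems] by blast
  have "(1 + norm x) ^ Suc k * norm (FT \<eta> x) \<le> B0 + (\<Sum>i\<in>UNIV. B i)" for x
  proof -
    have "(1 + norm x) * norm (FT \<eta> x) \<le> (1 + (\<Sum>i\<in>UNIV. \<bar>x $ i\<bar>)) * norm (FT \<eta> x)"
      by (intro mult_right_mono add_left_mono norm_le_l1_cart) auto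
    also have "\<dots> = norm (FT \<eta> x) + (\<Sum>i\<in>UNIV. norm (of_real (x $ i) * FT \<eta> x))"
      by (simp add: algebra_simps sum_distrib_left norm_mult)
    also have "\<dots> = norm (FT \<eta> x) + (\<Sum>i\<in>UNIV. norm (FT (?\<eta> i) x))"
      by (simp only: FT_coord_mult[OF Suc.prems])
    finally have "(1 + norm x) ^ k * ((1 + norm x) * norm (FT \<eta> x))
        \<le> (1 + norm x) ^ k * (norm (FT \<eta> x) + (\<Sum>i\<in>UNIV. norm (FT (?\<eta> i) x)))"
      by (rule mult_left_mono) simp
    also have "\<dots> = (1 + norm x) ^ k * norm (FT \<eta> x) + (\<Sum>i\<in>UNIV. (1 + norm x) ^ k * norm (FT (?\<eta> i) x))"
      by (simp only: distrib_left sum_distrib_left)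
    also have "\<dots> \<le> B0 + (\<Sum>i\<in>UNIV. B i)" by (intro add_mono sum_mono B B0)
    finally show ?thesis by (simp add: mult_ac)
  qed
  then show ?case by blast
qed

text \<open>The transforms of test functions form a family stable under
  \<open>partial_deriv\<close>, since differentiating the transform multiplies \<eta> by a
  coordinate and keeps the support compact.\<close>

lemma FT_schwartz:
  fixes \<eta> :: "real^'d::finite \<Rightarrow> complex"
  assumes "\<eta> \<in> test_functions"
  shows "FT \<eta> \<in> schwartz"
proof (rule schwartz_coinduct[where X="FT ` test_functions"])
  show "FT \<eta> \<in> FT ` test_functions" using assms by blast
  fix g :: "real^'d::finite \<Rightarrow> complex" assume "g \<in> FT ` test_functions"
  then obtain \<eta> where g: "g = FT \<eta>" "\<eta> \<in> test_functions" by blast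
  show "g differentiable (at x)" for x using FT_has_derivative[OF g(2)] g(1) by (auto simp: differentiable_def)
  show "\<exists>B. \<forall>x. (1 + norm x) ^ k * norm (g x) \<le> B" for k using FT_decay[OF g(2)] g(1) by simp
  show "partial_deriv i g \<in> FT ` test_functions" for i
  proof (rule image_eqI)
    show "partial_deriv i g = FT (\<lambda>\<xi>. (- \<i> * of_real (\<xi> $ i)) * \<eta> \<xi>)"
      unfolding g(1) by (rule ext, rule partial_deriv_gradient[OF FT_has_derivative[OF g(2)]])
    show "(\<lambda>\<xi>. (- \<i> * of_real (\<xi> $ i)) * \<eta> \<xi>) \<in> test_functions"
      by (intro test_function_mult g(2) smooth_mult smooth_const smooth_coord)
  qed
qed

text \<open>With \<open>s y = y\<close> this is a convolution, with a simple function \<open>s\<close> a finite combination of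
  translates of \<open>\<kappa>\<close>, and with a small dilation \<open>s\<close> an approximation of \<open>(\<integral>w) \<kappa>\<close>.\<close>

definition smear :: "(real^'d::finite \<Rightarrow> complex) \<Rightarrow> ('b::euclidean_space \<Rightarrow> real^'d) \<Rightarrow> ('b \<Rightarrow> complex) \<Rightarrow> real^'d \<Rightarrow> complex" where
  "smear \<kappa> s w = (\<lambda>x. \<integral>y. \<kappa> (x - s y) * w y \<partial>lborel)"

text \<open>Finite moments of every order match the polynomial growth, of unknown degree, of a
  tempered T on translates.\<close>

definition rapid :: "('b::euclidean_space \<Rightarrow> complex) \<Rightarrow> bool" where
  "rapid w \<longleftrightarrow> w \<in> borel_measurable borel \<and> (\<forall>k. integrable lborel (\<lambda>y. (1 + norm y) ^ k * norm (w y)))"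

lemma rapid_measurable: "rapid w \<Longrightarrow> w \<in> borel_measurable borel"
  by (simp add: rapid_def)

lemma rapid_integrable: "rapid w \<Longrightarrow> integrable lborel w"
  unfolding rapid_def by (auto dest: spec[of _ 0] simp: integrable_iff_bounded)

lemma rapid_weighted: "rapid w \<Longrightarrow> integrable lborel (\<lambda>y. (1 + norm y) ^ k * norm (w y))"
  by (simp add: rapid_def)

lemma schwartz_rapid: "f \<in> schwartz \<Longrightarrow> rapid f"
  by (simp add: rapid_def schwartz_measurable schwartz_integrable_weighted)

lemma smear_integrable:
  assumes "\<kappa> \<in> schwartz" "s \<in> borel_measurable borel" "rapid w"
  shows "integrable lborel (\<lambda>y. \<kappa> (x - s y) * w y)"
proof -
  note [measurable] = schwartz_measurable[OF assms(1)] assms(2)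
  obtain B where "\<And>x. norm (\<kappa> x) \<le> B" using schwartz_bounded[OF assms(1)] by metis
  then show ?thesis by (intro integrable_bounded_mult[of _ _ _ B] rapid_integrable assms) auto
qed

text \<open>All derivatives fall on \<kappa>, so measurability of \<open>s\<close> and integrability
  of \<open>w\<close> are enough on the other side.\<close>

lemma smear_has_derivative:
  assumes \<kappa>: "\<kappa> \<in> schwartz" and s: "s \<in> borel_measurable borel" and w: "rapid w"
  shows "(smear \<kappa> s w has_derivative (\<lambda>h. \<Sum>i\<in>UNIV. of_real (h $ i) * smear (partial_deriv i \<kappa>) s w x)) (at x)"
proof -
  have "\<exists>B. \<forall>x. norm (partial_deriv i \<kappa> x) \<le> B" for i
    using schwartz_bounded[OF schwartz_partial_deriv[OF \<kappa>]] by metis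
  then obtain B where B: "\<And>i x. norm (partial_deriv i \<kappa> x) \<le> B i" by metis
  note [measurable] = s rapid_measurable[OF w] schwartz_measurable[OF \<kappa>] schwartz_measurable[OF schwartz_partial_deriv[OF \<kappa>]]
  show ?thesis unfolding smear_def
  proof (rule has_derivative_integral[where B="\<lambda>y. Max (range B) * norm (w y)"])
    show "integrable lborel (\<lambda>y. \<kappa> (x - s y) * w y)" for x by (rule smear_integrable[OF assms])
    show "((\<lambda>x. \<kappa> (x - s y) * w y) has_derivative (\<lambda>h. \<Sum>i\<in>UNIV. of_real (h $ i) * (partial_deriv i \<kappa> (x - s y) * w y))) (at x)" for x y
    proof -
      have "((\<lambda>x. x - s y) has_derivative (\<lambda>h. h)) (at x)" by (auto intro!: derivative_eq_intros)
      from has_derivative_compose[OF this has_derivative_partials[OF smoothD[OF schwartz_smooth[OF \<kappa>]]]]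
      have "((\<lambda>x. \<kappa> (x - s y) * w y) has_derivative (\<lambda>h. (\<Sum>i\<in>UNIV. of_real (h $ i) * partial_deriv i \<kappa> (x - s y)) * w y)) (at x)"
        by (rule has_derivative_mult_left)
      then show ?thesis by (simp only: sum_distrib_right mult.assoc)
    qed
    show "norm (partial_deriv i \<kappa> (z - s y) * w y) \<le> Max (range B) * norm (w y)" for i z y
      by (auto simp: norm_mult intro!: mult_right_mono order.trans[OF B])
    show "integrable lborel (\<lambda>y. Max (range B) * norm (w y))" using rapid_integrable[OF w] by simp
  qed measurable
qed

text \<open>Peetre's inequality distributes the weight at x over x - s y and s y, and the moments of
  \<open>w\<close> absorb the latter. The 2 in the growth condition is the constant that the
  approximation by simple functions provides.\<close>

lemma smear_schwartz:
  fixes \<kappa> :: "real^'d::finite \<Rightarrow> complex"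
  assumes \<kappa>: "\<kappa> \<in> schwartz" and s: "s \<in> borel_measurable borel" and w: "rapid w"
    and grow: "\<And>y. norm (s y) \<le> 2 * norm y"
  shows "smear \<kappa> s w \<in> schwartz"
proof (rule schwartz_coinduct[where X="(\<lambda>\<kappa>. smear \<kappa> s w) ` schwartz"])
  show "smear \<kappa> s w \<in> (\<lambda>\<kappa>. smear \<kappa> s w) ` schwartz" using \<kappa> by blast
  fix g :: "real^'d \<Rightarrow> complex" assume "g \<in> (\<lambda>\<kappa>. smear \<kappa> s w) ` schwartz"
  then obtain \<kappa> where g: "g = smear \<kappa> s w" "\<kappa> \<in> schwartz" by blast
  show "g differentiable (at x)" for x
    unfolding g(1) differentiable_def using smear_has_derivative[OF g(2) s w] by blast
  show "partial_deriv i g \<in> (\<lambda>\<kappa>. smear \<kappa> s w) ` schwartz" for i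
  proof (rule image_eqI)
    show "partial_deriv i g = smear (partial_deriv i \<kappa>) s w"
      unfolding g(1) by (rule ext, rule partial_deriv_gradient[OF smear_has_derivative[OF g(2) s w]])
  qed (rule schwartz_partial_deriv[OF g(2)])
  show "\<exists>B. \<forall>x. (1 + norm x) ^ k * norm (g x) \<le> B" for k
  proof -
    obtain B where B: "B \<ge> 0" "\<And>x. (1 + norm x) ^ k * norm (\<kappa> x) \<le> B" using schwartz_decay[OF g(2)] by metis
    have "(1 + norm x) ^ k * norm (g x) \<le> (\<integral>y. B * 2 ^ k * ((1 + norm y) ^ k * norm (w y)) \<partial>lborel)" for x
    proof -
      have "(1 + norm x) ^ k * norm (g x) = norm (\<integral>y. of_real ((1 + norm x) ^ k) * (\<kappa> (x - s y) * w y) \<partial>lborel)"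
        by (simp add: g(1) smear_def norm_mult norm_power del: of_real_power)
      also have "\<dots> \<le> (\<integral>y. norm (of_real ((1 + norm x) ^ k) * (\<kappa> (x - s y) * w y)) \<partial>lborel)"
        by (rule integral_norm_bound)
      also have "\<dots> \<le> (\<integral>y. B * 2 ^ k * ((1 + norm y) ^ k * norm (w y)) \<partial>lborel)"
      proof (rule integral_mono)
        show "integrable lborel (\<lambda>y. norm (of_real ((1 + norm x) ^ k) * (\<kappa> (x - s y) * w y)))"
          by (intro integrable_norm integrable_mult_right smear_integrable g(2) s w)
        show "integrable lborel (\<lambda>y. B * 2 ^ k * ((1 + norm y) ^ k * norm (w y)))"
          by (intro integrable_mult_right rapid_weighted w)
        fix y
        have "(1 + norm x) ^ k \<le> (1 + norm (x - s y)) ^ k * (1 + norm (s y)) ^ k" by (rule one_plus_norm_le)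
        also have "\<dots> \<le> (1 + norm (x - s y)) ^ k * (2 * (1 + norm y)) ^ k"
          using grow[of y] by (intro mult_left_mono power_mono) auto
        finally have "(1 + norm x) ^ k * norm (\<kappa> (x - s y)) \<le> (1 + norm (x - s y)) ^ k * (2 * (1 + norm y)) ^ k * norm (\<kappa> (x - s y))"
          by (rule mult_right_mono) simp
        also have "\<dots> = (2 * (1 + norm y)) ^ k * ((1 + norm (x - s y)) ^ k * norm (\<kappa> (x - s y)))" by (simp add: mult_ac)
        also have "\<dots> \<le> (2 * (1 + norm y)) ^ k * B" by (intro mult_left_mono B) auto
        finally have "(1 + norm x) ^ k * norm (\<kappa> (x - s y)) * norm (w y) \<le> (2 * (1 + norm y)) ^ k * B * norm (w y)"
          by (rule mult_right_mono) simp
        then show "norm (of_real ((1 + norm x) ^ k) * (\<kappa> (x - s y) * w y)) \<le> B * 2 ^ k * ((1 + norm y) ^ k * norm (w y))"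
          unfolding power_mult_distrib by (simp add: norm_mult norm_power mult_ac del: of_real_power)
      qed
      finally show ?thesis .
    qed
    then show ?thesis by blast
  qed
qed

lemma iter_partial_smear:
  assumes "\<kappa> \<in> schwartz" "s \<in> borel_measurable borel" "rapid w"
  shows "iter_partial \<alpha> (smear \<kappa> s w) = smear (iter_partial \<alpha> \<kappa>) s w"
proof (induction \<alpha>)
  case (Cons i \<alpha>)
  show ?case
    by (simp add: Cons, rule ext, rule partial_deriv_gradient[OF smear_has_derivative[OF schwartz_iter_partial[OF assms(1)] assms(2,3)]])
qed simp

section \<open>Tempered distributions under smearing\<close>

lemma schwartz_decay_iter:
  assumes "f \<in> schwartz"
  shows "bdd_above (range (\<lambda>x. (1 + norm x) ^ k * norm (iter_partial \<alpha> f x)))"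
  using assms unfolding schwartz_def by (auto intro: bounded_imp_bdd_above)

lemma schwartz_seminorm_upper:
  assumes "f \<in> schwartz"
  shows "(1 + norm x) ^ k * norm (iter_partial \<alpha> f x) \<le> schwartz_seminorm k \<alpha> f"
  unfolding schwartz_seminorm_def by (rule cSUP_upper[OF UNIV_I schwartz_decay_iter[OF assms]])

lemma schwartz_seminorm_least:
  assumes "\<And>x. (1 + norm x) ^ k * norm (iter_partial \<alpha> f x) \<le> M"
  shows "schwartz_seminorm k \<alpha> f \<le> M"
  unfolding schwartz_seminorm_def by (rule cSUP_least) (use assms in auto)

lemma schwartz_diff: "f \<in> schwartz \<Longrightarrow> g \<in> schwartz \<Longrightarrow> (\<lambda>x. f x - g x) \<in> schwartz"
  using schwartz_lincomb[of f g 1 "-1"] by simp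

lemma iter_partial_diff:
  "smooth f \<Longrightarrow> smooth g \<Longrightarrow> iter_partial \<alpha> (\<lambda>x. f x - g x) = (\<lambda>x. iter_partial \<alpha> f x - iter_partial \<alpha> g x)"
  using iter_partial_lincomb[of f g \<alpha> 1 "-1"] by simp

text \<open>Induction over the generation of the topology. A subbasic ball about f that contains 0
  contains the seminorm ball about 0 whose radius is \<epsilon> minus the seminorm of -f; an
  intersection merges the two index sets and takes the smaller radius.\<close>

lemma generated_schwartz_neighbourhood:
  assumes "generate_topology_on {{g \<in> schwartz. schwartz_seminorm k \<alpha> (\<lambda>x. g x - f x) < \<epsilon>} | k \<alpha> f \<epsilon>.
        f \<in> schwartz \<and> 0 < \<epsilon>} U"
    and "(\<lambda>x. 0) \<in> U"
  shows "\<exists>F \<delta>. finite F \<and> \<delta> > 0 \<and> {g \<in> schwartz. \<forall>(k, \<alpha>) \<in> F. schwartz_seminorm k \<alpha> g < \<delta>} \<subseteq> U"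
  using assms
proof (induction rule: generate_topology_on.induct)
  case (Int a b)
  from Int.prems have 0: "(\<lambda>x. 0) \<in> a" "(\<lambda>x. 0) \<in> b" by auto
  from Int.IH(1)[OF 0(1)] obtain F \<delta> where
    F: "finite F" "\<delta> > 0" "{g \<in> schwartz. \<forall>(k, \<alpha>) \<in> F. schwartz_seminorm k \<alpha> g < \<delta>} \<subseteq> a" by (elim exE conjE)
  from Int.IH(2)[OF 0(2)] obtain G \<epsilon> where
    G: "finite G" "\<epsilon> > 0" "{g \<in> schwartz. \<forall>(k, \<alpha>) \<in> G. schwartz_seminorm k \<alpha> g < \<epsilon>} \<subseteq> b" by (elim exE conjE)
  show ?case
  proof (intro exI[of _ "F \<union> G"] exI[of _ "min \<delta> \<epsilon>"] conjI)
    show "{g \<in> schwartz. \<forall>(k, \<alpha>) \<in> F \<union> G. schwartz_seminorm k \<alpha> g < min \<delta> \<epsilon>} \<subseteq> a \<inter> b"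
    proof (intro Int_greatest)
      show "{g \<in> schwartz. \<forall>(k, \<alpha>) \<in> F \<union> G. schwartz_seminorm k \<alpha> g < min \<delta> \<epsilon>} \<subseteq> a"
        by (rule order.trans[OF _ F(3)]) auto
      show "{g \<in> schwartz. \<forall>(k, \<alpha>) \<in> F \<union> G. schwartz_seminorm k \<alpha> g < min \<delta> \<epsilon>} \<subseteq> b"
        by (rule order.trans[OF _ G(3)]) auto
    qed
  qed (use F G in auto)
next
  case (UN K)
  then obtain k where k: "k \<in> K" "(\<lambda>x. 0) \<in> k" by blast
  from UN.IH[OF this] obtain F \<delta> where "finite F" "\<delta> > 0"
    "{g \<in> schwartz. \<forall>(k, \<alpha>) \<in> F. schwartz_seminorm k \<alpha> g < \<delta>} \<subseteq> k" by (elim exE conjE)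
  moreover from k have "k \<subseteq> \<Union>K" by blast
  ultimately show ?case by (intro exI[of _ F] exI[of _ \<delta>] conjI) (auto intro: order.trans)
next
  case (Basis s)
  then obtain k \<alpha> f \<epsilon> where s: "s = {g \<in> schwartz. schwartz_seminorm k \<alpha> (\<lambda>x. g x - f x) < \<epsilon>}"
    and f: "f \<in> schwartz" by blast
  let ?f = "\<lambda>x. 0 - f x"
  have f': "?f \<in> schwartz" by (rule schwartz_diff[OF schwartz_zero f])
  define \<delta> where "\<delta> = \<epsilon> - schwartz_seminorm k \<alpha> ?f"
  have "\<delta> > 0" using Basis.prems by (simp add: s \<delta>_def)
  moreover have "{g \<in> schwartz. \<forall>(k, \<alpha>) \<in> {(k, \<alpha>)}. schwartz_seminorm k \<alpha> g < \<delta>} \<subseteq> s"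
  proof safe
    fix g assume g: "g \<in> schwartz" "\<forall>(k, \<alpha>) \<in> {(k, \<alpha>)}. schwartz_seminorm k \<alpha> g < \<delta>"
    have "schwartz_seminorm k \<alpha> (\<lambda>x. g x - f x) \<le> schwartz_seminorm k \<alpha> g + schwartz_seminorm k \<alpha> ?f"
    proof (rule schwartz_seminorm_least)
      fix x
      have "iter_partial \<alpha> (\<lambda>x. g x - f x) x = iter_partial \<alpha> g x - iter_partial \<alpha> f x"
        using iter_partial_diff[of g f \<alpha>] f g by (simp add: schwartz_smooth)
      moreover have "iter_partial \<alpha> ?f x = - iter_partial \<alpha> f x"
        using iter_partial_lincomb[of f f \<alpha> "-1" 0] f by (simp add: schwartz_smooth)
      ultimately have "norm (iter_partial \<alpha> (\<lambda>x. g x - f x) x) \<le> norm (iter_partial \<alpha> g x) + norm (iter_partial \<alpha> ?f x)"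
        by (simp add: norm_triangle_ineq4)
      then have "(1 + norm x) ^ k * norm (iter_partial \<alpha> (\<lambda>x. g x - f x) x)
          \<le> (1 + norm x) ^ k * (norm (iter_partial \<alpha> g x) + norm (iter_partial \<alpha> ?f x))"
        by (rule mult_left_mono) simp
      also have "\<dots> \<le> schwartz_seminorm k \<alpha> g + schwartz_seminorm k \<alpha> ?f"
        unfolding distrib_left using schwartz_seminorm_upper[OF g(1)] schwartz_seminorm_upper[OF f'] by (rule add_mono)
      finally show "(1 + norm x) ^ k * norm (iter_partial \<alpha> (\<lambda>x. g x - f x) x)
          \<le> schwartz_seminorm k \<alpha> g + schwartz_seminorm k \<alpha> ?f" .
    qed
    then show "g \<in> s" using g unfolding s \<delta>_def by auto
  qed
  moreover have "finite {(k, \<alpha>)}" by simp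
  ultimately show ?case by (intro exI[of _ "{(k, \<alpha>)}"] exI[of _ \<delta>] conjI)
qed auto

lemma tempered_linear:
  "tempered T \<Longrightarrow> f \<in> schwartz \<Longrightarrow> g \<in> schwartz \<Longrightarrow> T (\<lambda>x. a * f x + b * g x) = a * T f + b * T g"
  by (simp add: tempered_def)

lemma tempered_diff:
  "tempered T \<Longrightarrow> f \<in> schwartz \<Longrightarrow> g \<in> schwartz \<Longrightarrow> T (\<lambda>x. f x - g x) = T f - T g"
  using tempered_linear[of T f g 1 "-1"] by simp

lemma tempered_zero: "tempered T \<Longrightarrow> T (\<lambda>x. 0) = 0"
  using tempered_linear[OF _ schwartz_zero schwartz_zero, of T 0 0] by simp

lemma tempered_sum:
  assumes T: "tempered T" and "finite V" "\<And>v. v \<in> V \<Longrightarrow> f v \<in> schwartz"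
  shows "(\<lambda>x. \<Sum>v\<in>V. c v * f v x) \<in> schwartz \<and> T (\<lambda>x. \<Sum>v\<in>V. c v * f v x) = (\<Sum>v\<in>V. c v * T (f v))"
  using assms(2,3)
proof (induction V)
  case empty
  then show ?case using T by (simp add: schwartz_zero tempered_zero)
next
  case (insert v V)
  then have *: "(\<lambda>x. \<Sum>v\<in>V. c v * f v x) \<in> schwartz" "T (\<lambda>x. \<Sum>v\<in>V. c v * f v x) = (\<Sum>v\<in>V. c v * T (f v))" "f v \<in> schwartz"
    by auto
  show ?case using schwartz_lincomb[OF *(3,1), of "c v" 1] tempered_linear[OF T *(3,1), of "c v" 1] *(2) insert.hyps
    by simp
qed

text \<open>Continuity at 0 made quantitative by scaling. All seminorms involved are raised to one
  weight exponent \<open>K\<close>, and the bound is phrased with an arbitrary majorant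
  \<open>M\<close>, so that later estimates need not handle suprema.\<close>

lemma tempered_bound:
  fixes T :: "'d::finite functional"
  assumes T: "tempered T"
  obtains K A C where "finite A" "C \<ge> 0"
    "\<And>g M. g \<in> schwartz \<Longrightarrow> (\<And>\<alpha> x. \<alpha> \<in> A \<Longrightarrow> (1 + norm x) ^ K * norm (iter_partial \<alpha> g x) \<le> M) \<Longrightarrow> 0 \<le> M \<Longrightarrow> norm (T g) \<le> C * M"
proof -
  let ?U = "{g \<in> topspace schwartz_topology. T g \<in> ball 0 1}"
  have "openin schwartz_topology ?U"
    using T by (intro openin_continuous_map_preimage[of _ euclidean]) (auto simp: tempered_def)
  then have "generate_topology_on {{g \<in> schwartz. schwartz_seminorm k \<alpha> (\<lambda>x. g x - f x) < \<epsilon>} | k \<alpha> f \<epsilon>.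
        f \<in> (schwartz :: (real^'d \<Rightarrow> complex) set) \<and> 0 < \<epsilon>} ?U"
    unfolding schwartz_topology_def by (rule openin_topology_generated_by)
  moreover have "(\<lambda>x. 0) \<in> ?U"
  proof -
    have "(\<lambda>x. 0) \<in> topspace (schwartz_topology :: (real^'d \<Rightarrow> complex) topology)"
      unfolding schwartz_topology_def topology_generated_by_topspace
    proof (rule UnionI)
      show "{g \<in> schwartz. schwartz_seminorm 0 [] (\<lambda>x. g x - (\<lambda>x::real^'d. 0) x) < 1} \<in> {{g \<in> schwartz. schwartz_seminorm k \<alpha> (\<lambda>x. g x - f x) < \<epsilon>} | k \<alpha> f \<epsilon>.
        f \<in> schwartz \<and> 0 < \<epsilon>}" using schwartz_zero by (intro CollectI exI conjI refl) auto
      show "(\<lambda>x. 0) \<in> {g \<in> schwartz. schwartz_seminorm 0 [] (\<lambda>x. g x - (\<lambda>x::real^'d. 0) x) < 1}"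
        by (simp add: schwartz_zero schwartz_seminorm_def)
    qed
    then show ?thesis using tempered_zero[OF T] by simp
  qed
  ultimately obtain F \<delta> where F: "finite F" "\<delta> > 0"
    "{g \<in> schwartz. \<forall>(k, \<alpha>) \<in> F. schwartz_seminorm k \<alpha> g < \<delta>} \<subseteq> ?U"
    using generated_schwartz_neighbourhood by blast
  have lt1: "norm (T g) < 1" if "g \<in> schwartz" "\<And>k \<alpha>. (k, \<alpha>) \<in> F \<Longrightarrow> schwartz_seminorm k \<alpha> g < \<delta>" for g
    using F(3) that by auto
  define K where "K = Max (insert 0 (fst ` F))"
  have K: "k \<le> K" if "(k, \<alpha>) \<in> F" for k \<alpha>
    unfolding K_def using F(1) that by (intro Max_ge) force+
  have bound: "norm (T g) \<le> 2 / \<delta> * M"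
    if g: "g \<in> schwartz" and gM: "\<And>\<alpha> x. \<alpha> \<in> snd ` F \<Longrightarrow> (1 + norm x) ^ K * norm (iter_partial \<alpha> g x) \<le> M" and "M > 0" for g M
  proof -
    \<comment> \<open>Scaling by this factor brings the relevant seminorms of g to at most \<delta>
      / 2, strictly inside the neighbourhood.\<close>
    define c where "c = \<delta> / (2 * M)"
    have c: "c > 0" using F(2) \<open>M > 0\<close> by (simp add: c_def)
    let ?g = "\<lambda>x. of_real c * g x + 0 * g x"
    have "norm (T ?g) < 1"
    proof (rule lt1[OF schwartz_lincomb[OF g g]])
      fix k \<alpha> assume k\<alpha>: "(k, \<alpha>) \<in> F"
      have "schwartz_seminorm k \<alpha> ?g \<le> \<delta> / 2"
      proof (rule schwartz_seminorm_least)
        fix x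
        have "(1 + norm x) ^ k * norm (iter_partial \<alpha> ?g x) = c * ((1 + norm x) ^ k * norm (iter_partial \<alpha> g x))"
          unfolding iter_partial_lincomb[OF schwartz_smooth[OF g] schwartz_smooth[OF g]]
          using c by (simp add: norm_mult mult_ac)
        also have "\<dots> \<le> c * ((1 + norm x) ^ K * norm (iter_partial \<alpha> g x))"
          using c K[OF k\<alpha>] by (intro mult_left_mono mult_right_mono power_increasing) auto
        also have "\<dots> \<le> c * M" using c k\<alpha> by (intro mult_left_mono gM) force+
        also have "\<dots> = \<delta> / 2" using \<open>M > 0\<close> by (simp add: c_def)
        finally show "(1 + norm x) ^ k * norm (iter_partial \<alpha> ?g x) \<le> \<delta> / 2" .
      qed
      then show "schwartz_seminorm k \<alpha> ?g < \<delta>" using F(2) by simp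
    qed
    moreover have "T ?g = of_real c * T g"
      using tempered_linear[OF T g g, of "of_real c" 0] by simp
    ultimately have "c * norm (T g) < 1" using c by (simp add: norm_mult)
    then have "norm (T g) < 1 / c" using c by (simp add: field_simps)
    also have "1 / c = 2 / \<delta> * M" using F(2) \<open>M > 0\<close> by (simp add: c_def)
    finally show ?thesis by simp
  qed
  \<comment> \<open>The scaling divides by M; the case M = 0 is reached by enlarging M by a small
    positive amount.\<close>
  have "norm (T g) \<le> 2 / \<delta> * M"
    if g: "g \<in> schwartz" and gM: "\<And>\<alpha> x. \<alpha> \<in> snd ` F \<Longrightarrow> (1 + norm x) ^ K * norm (iter_partial \<alpha> g x) \<le> M" and "M \<ge> 0" for g M
  proof (rule field_le_epsilon)
    fix e :: real assume e: "e > 0"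
    have "norm (T g) \<le> 2 / \<delta> * (M + \<delta> / 2 * e)"
    proof (rule bound[OF g])
      show "0 < M + \<delta> / 2 * e" using \<open>M \<ge> 0\<close> F(2) e by (simp add: add_nonneg_pos)
      show "(1 + norm x) ^ K * norm (iter_partial \<alpha> g x) \<le> M + \<delta> / 2 * e" if "\<alpha> \<in> snd ` F" for \<alpha> x
        by (rule order.trans[OF gM[OF that]]) (use F(2) e in simp)
    qed
    then show "norm (T g) \<le> 2 / \<delta> * M + e" using F(2) by (simp add: field_simps)
  qed
  moreover have "finite (snd ` F)" "0 \<le> 2 / \<delta>" using F by auto
  ultimately show ?thesis using that by blast
qed

text \<open>Mean value inequality on the ball of radius R about x, which contains both x - a and x -
  b. Peetre's inequality compares the weight at x with that at a point z of the ball and produces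
  the power of 1 + R.\<close>

lemma schwartz_translate_diff:
  fixes f :: "real^'d::finite \<Rightarrow> complex"
  assumes f: "f \<in> schwartz"
  obtains C where "C \<ge> 0" "\<And>x a b R. norm a \<le> R \<Longrightarrow> norm b \<le> R \<Longrightarrow>
    (1 + norm x) ^ k * norm (f (x - a) - f (x - b)) \<le> C * norm (a - b) * (1 + R) ^ k"
proof -
  have "\<exists>B. \<forall>x. (1 + norm x) ^ k * norm (partial_deriv i f x) \<le> B" for i
    using schwartz_decay[OF schwartz_partial_deriv[OF f]] by metis
  then obtain B where B: "\<And>i x. (1 + norm x) ^ k * norm (partial_deriv i f x) \<le> B i" by metis
  define C where "C = (\<Sum>i\<in>UNIV. B i)"
  have B0: "B i \<ge> 0" for i
    by (rule order.trans[OF _ B[of 0]]) simp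
  have "(1 + norm x) ^ k * norm (f (x - a) - f (x - b)) \<le> C * norm (a - b) * (1 + R) ^ k"
    if ab: "norm a \<le> R" "norm b \<le> R" for x a b R
  proof -
    have p: "(1 + norm x) ^ k > 0" by (simp add: add_pos_nonneg)
    have R: "R \<ge> 0" using ab norm_ge_zero[of a] by linarith
    have "norm (f (x - a) - f (x - b)) \<le> (C * (1 + R) ^ k / (1 + norm x) ^ k) * norm ((x - a) - (x - b))"
    proof (rule differentiable_bound[where S="cball x R"])
      show "(f has_derivative (\<lambda>h. \<Sum>i\<in>UNIV. of_real (h $ i) * partial_deriv i f z)) (at z within cball x R)" for z
        by (rule has_derivative_at_withinI[OF has_derivative_partials[OF smoothD[OF schwartz_smooth[OF f]]]])
      show "onorm (\<lambda>h. \<Sum>i\<in>UNIV. of_real (h $ i) * partial_deriv i f z) \<le> C * (1 + R) ^ k / (1 + norm x) ^ k"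
        if z: "z \<in> cball x R" for z
      proof (rule onorm_le)
        fix h :: "real^'d"
        have "norm (partial_deriv i f z) \<le> B i * (1 + R) ^ k / (1 + norm x) ^ k" for i
        proof -
          have "(1 + norm x) ^ k \<le> (1 + norm (x - (x - z))) ^ k * (1 + norm (x - z)) ^ k" by (rule one_plus_norm_le)
          also have "\<dots> \<le> (1 + norm z) ^ k * (1 + R) ^ k"
            using z by (intro mult_mono power_mono) (auto simp: dist_norm)
          finally have "(1 + norm x) ^ k * norm (partial_deriv i f z) \<le> (1 + norm z) ^ k * (1 + R) ^ k * norm (partial_deriv i f z)"
            by (rule mult_right_mono) simp
          also have "\<dots> = (1 + R) ^ k * ((1 + norm z) ^ k * norm (partial_deriv i f z))" by (simp add: mult_ac)
          also have "\<dots> \<le> (1 + R) ^ k * B i" using R by (intro mult_left_mono B) auto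
          finally show ?thesis using p by (simp add: pos_le_divide_eq mult_ac)
        qed
        then have "norm (\<Sum>i\<in>UNIV. of_real (h $ i) * partial_deriv i f z) \<le> (\<Sum>i\<in>UNIV. norm h * (B i * (1 + R) ^ k / (1 + norm x) ^ k))"
          by (intro sum_norm_le) (simp only: norm_mult norm_of_real, intro mult_mono component_le_norm_cart, auto)
        also have "\<dots> = C * (1 + R) ^ k / (1 + norm x) ^ k * norm h"
          by (simp add: C_def sum_distrib_left sum_distrib_right sum_divide_distrib mult_ac)
        finally show "norm (\<Sum>i\<in>UNIV. of_real (h $ i) * partial_deriv i f z) \<le> C * (1 + R) ^ k / (1 + norm x) ^ k * norm h" .
      qed
    qed (use ab in \<open>auto simp: dist_norm\<close>)
    then show ?thesis using p by (simp add: field_simps norm_minus_commute)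
  qed
  moreover have "C \<ge> 0" using B0 by (auto simp: C_def intro: sum_nonneg)
  ultimately show ?thesis using that by blast
qed

lemma tempered_translate_growth:
  assumes T: "tempered T" and \<kappa>: "\<kappa> \<in> schwartz"
  obtains C K where "C \<ge> 0" "\<And>y. norm (T (\<lambda>x. \<kappa> (x - y))) \<le> C * (1 + norm y) ^ K"
proof -
  obtain K A C where A: "finite A" "C \<ge> 0"
    and C: "\<And>g M. g \<in> schwartz \<Longrightarrow> (\<And>\<alpha> x. \<alpha> \<in> A \<Longrightarrow> (1 + norm x) ^ K * norm (iter_partial \<alpha> g x) \<le> M) \<Longrightarrow> 0 \<le> M \<Longrightarrow> norm (T g) \<le> C * M"
    using tempered_bound[OF T] by metis
  define S where "S = (\<Sum>\<alpha>\<in>A. schwartz_seminorm K \<alpha> \<kappa>)"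
  have pos: "schwartz_seminorm K \<alpha> \<kappa> \<ge> 0" for \<alpha>
    by (rule order.trans[OF _ schwartz_seminorm_upper[OF \<kappa>, of 0]]) simp
  have S: "schwartz_seminorm K \<alpha> \<kappa> \<le> S" if "\<alpha> \<in> A" for \<alpha>
    unfolding S_def using A(1) that pos by (intro member_le_sum) auto
  have S0: "S \<ge> 0" unfolding S_def using pos by (simp add: sum_nonneg)
  have "norm (T (\<lambda>x. \<kappa> (x - y))) \<le> C * ((1 + norm y) ^ K * S)" for y
  proof (rule C[OF schwartz_translate[OF \<kappa>]])
    fix \<alpha> x assume \<alpha>: "\<alpha> \<in> A"
    have "(1 + norm x) ^ K * norm (iter_partial \<alpha> \<kappa> (x - y)) \<le> (1 + norm (x - y)) ^ K * (1 + norm y) ^ K * norm (iter_partial \<alpha> \<kappa> (x - y))"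
      by (intro mult_right_mono one_plus_norm_le) simp
    also have "\<dots> = (1 + norm y) ^ K * ((1 + norm (x - y)) ^ K * norm (iter_partial \<alpha> \<kappa> (x - y)))" by (simp add: mult_ac)
    also have "\<dots> \<le> (1 + norm y) ^ K * S"
      by (intro mult_left_mono order.trans[OF schwartz_seminorm_upper[OF \<kappa>] S[OF \<alpha>]]) simp
    finally show "(1 + norm x) ^ K * norm (iter_partial \<alpha> (\<lambda>x. \<kappa> (x - y)) x) \<le> (1 + norm y) ^ K * S"
      by (simp add: iter_partial_translate[OF schwartz_smooth[OF \<kappa>]])
  qed (use S0 in simp)
  then have "norm (T (\<lambda>x. \<kappa> (x - y))) \<le> C * S * (1 + norm y) ^ K" for y by (simp add: mult_ac)
  moreover have "C * S \<ge> 0" using A S0 by simp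
  ultimately show ?thesis using that by blast
qed

lemma schwartz_translate_diff_uniform:
  assumes \<kappa>: "\<kappa> \<in> schwartz" and A: "finite A"
  obtains D where "D \<ge> 0" "\<And>\<alpha> x a b R. \<alpha> \<in> A \<Longrightarrow> norm a \<le> R \<Longrightarrow> norm b \<le> R \<Longrightarrow>
    (1 + norm x) ^ k * norm (iter_partial \<alpha> \<kappa> (x - a) - iter_partial \<alpha> \<kappa> (x - b)) \<le> D * norm (a - b) * (1 + R) ^ k"
proof -
  have "\<exists>C\<ge>0. \<forall>x a b R. norm a \<le> R \<longrightarrow> norm b \<le> R \<longrightarrow>
    (1 + norm x) ^ k * norm (iter_partial \<alpha> \<kappa> (x - a) - iter_partial \<alpha> \<kappa> (x - b)) \<le> C * norm (a - b) * (1 + R) ^ k" for \<alpha>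
    using schwartz_translate_diff[OF schwartz_iter_partial[OF \<kappa>]] by metis
  then obtain C where C: "\<And>\<alpha>. C \<alpha> \<ge> 0" "\<And>\<alpha> x a b R. norm a \<le> R \<Longrightarrow> norm b \<le> R \<Longrightarrow>
    (1 + norm x) ^ k * norm (iter_partial \<alpha> \<kappa> (x - a) - iter_partial \<alpha> \<kappa> (x - b)) \<le> C \<alpha> * norm (a - b) * (1 + R) ^ k"
    by metis
  show ?thesis
  proof (rule that[of "\<Sum>\<alpha>\<in>A. C \<alpha>"])
    show "(\<Sum>\<alpha>\<in>A. C \<alpha>) \<ge> 0" using C by (simp add: sum_nonneg)
    fix \<alpha> x and a b :: "real^'a" and R assume *: "\<alpha> \<in> A" "norm a \<le> R" "norm b \<le> R"
    have R: "R \<ge> 0" using * norm_ge_zero[of a] by linarith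
    have "C \<alpha> \<le> (\<Sum>\<alpha>\<in>A. C \<alpha>)" using * A C by (intro member_le_sum) auto
    then have "C \<alpha> * norm (a - b) * (1 + R) ^ k \<le> (\<Sum>\<alpha>\<in>A. C \<alpha>) * norm (a - b) * (1 + R) ^ k"
      using R by (intro mult_right_mono) auto
    then show "(1 + norm x) ^ k * norm (iter_partial \<alpha> \<kappa> (x - a) - iter_partial \<alpha> \<kappa> (x - b)) \<le> (\<Sum>\<alpha>\<in>A. C \<alpha>) * norm (a - b) * (1 + R) ^ k"
      using C(2)[OF *(2,3)] order.trans by blast
  qed
qed

text \<open>In each of the finitely many seminorms that control T, the translates of \<kappa> depend
  on y in a locally Lipschitz way.\<close>

lemma tempered_translate_continuous:
  assumes T: "tempered T" and \<kappa>: "\<kappa> \<in> schwartz"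
  shows "continuous_on UNIV (\<lambda>y. T (\<lambda>x. \<kappa> (x - y)))"
proof -
  obtain K A C where A: "finite A" "C \<ge> 0"
    and C: "\<And>g M. g \<in> schwartz \<Longrightarrow> (\<And>\<alpha> x. \<alpha> \<in> A \<Longrightarrow> (1 + norm x) ^ K * norm (iter_partial \<alpha> g x) \<le> M) \<Longrightarrow> 0 \<le> M \<Longrightarrow> norm (T g) \<le> C * M"
    using tempered_bound[OF T] by metis
  obtain D where D: "D \<ge> 0" "\<And>\<alpha> x a b R. \<alpha> \<in> A \<Longrightarrow> norm a \<le> R \<Longrightarrow> norm b \<le> R \<Longrightarrow>
    (1 + norm x) ^ K * norm (iter_partial \<alpha> \<kappa> (x - a) - iter_partial \<alpha> \<kappa> (x - b)) \<le> D * norm (a - b) * (1 + R) ^ K"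
    using schwartz_translate_diff_uniform[OF \<kappa> A(1)] by metis
  have tr: "(\<lambda>x. \<kappa> (x - y)) \<in> schwartz" for y by (rule schwartz_translate[OF \<kappa>])
  have est: "norm (T (\<lambda>x. \<kappa> (x - y)) - T (\<lambda>x. \<kappa> (x - z))) \<le> C * (D * norm (y - z) * (1 + (norm y + norm z)) ^ K)" for y z
  proof -
    have "norm (T (\<lambda>x. \<kappa> (x - y) - \<kappa> (x - z))) \<le> C * (D * norm (y - z) * (1 + (norm y + norm z)) ^ K)"
    proof (rule C[OF schwartz_diff[OF tr tr]])
      fix \<alpha> x assume "\<alpha> \<in> A"
      then have "(1 + norm x) ^ K * norm (iter_partial \<alpha> \<kappa> (x - y) - iter_partial \<alpha> \<kappa> (x - z)) \<le> D * norm (y - z) * (1 + (norm y + norm z)) ^ K"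
        by (intro D) auto
      then show "(1 + norm x) ^ K * norm (iter_partial \<alpha> (\<lambda>x. \<kappa> (x - y) - \<kappa> (x - z)) x) \<le> D * norm (y - z) * (1 + (norm y + norm z)) ^ K"
        by (simp add: iter_partial_diff schwartz_smooth[OF tr] iter_partial_translate[OF schwartz_smooth[OF \<kappa>]])
    qed (use D in simp)
    then show ?thesis by (simp add: tempered_diff[OF T tr tr])
  qed
  have "isCont (\<lambda>y. T (\<lambda>x. \<kappa> (x - y))) z" for z
    unfolding isCont_def
  proof (rule LIM_zero_cancel, rule tendsto_norm_zero_cancel,
      rule real_tendsto_sandwich[where f="\<lambda>_. 0" and h="\<lambda>y. C * (D * norm (y - z) * (1 + (norm y + norm z)) ^ K)"])
    show "\<forall>\<^sub>F y in at z. norm (T (\<lambda>x. \<kappa> (x - y)) - T (\<lambda>x. \<kappa> (x - z))) \<le> C * (D * norm (y - z) * (1 + (norm y + norm z)) ^ K)"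
      by (intro always_eventually allI est)
    have "((\<lambda>y. C * (D * norm (y - z) * (1 + (norm y + norm z)) ^ K)) \<longlongrightarrow> C * (D * norm (z - z) * (1 + (norm z + norm z)) ^ K)) (at z)"
      by (intro tendsto_intros)
    then show "((\<lambda>y. C * (D * norm (y - z) * (1 + (norm y + norm z)) ^ K)) \<longlongrightarrow> 0) (at z)" by simp
  qed (auto intro: tendsto_const)
  then show ?thesis by (simp add: continuous_on_eq_continuous_at)
qed

text \<open>In all seminorms controlling T, the translates at \<open>s n y\<close> and
  \<open>t y\<close> differ by at most a multiple of |s n y - t y| times a polynomial weight;
  integration against \<open>w\<close> and dominated convergence do the rest. It serves for simple
  approximations of the identity and for dilations shrinking to 0.\<close>

lemma tempered_smear_tendsto:
  fixes w :: "'b::euclidean_space \<Rightarrow> complex"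
  assumes T: "tempered T" and \<kappa>: "\<kappa> \<in> schwartz" and w: "rapid w"
    and s: "\<And>n. s n \<in> borel_measurable borel" "\<And>n y. norm (s n y) \<le> 2 * norm y"
    and t: "t \<in> borel_measurable borel" "\<And>y. norm (t y) \<le> 2 * norm y"
    and lim: "\<And>y. (\<lambda>n. s n y) \<longlonglongrightarrow> t y"
  shows "(\<lambda>n. T (smear \<kappa> (s n) w)) \<longlonglongrightarrow> T (smear \<kappa> t w)"
proof -
  obtain K A C where A: "finite A" "C \<ge> 0"
    and C: "\<And>g M. g \<in> schwartz \<Longrightarrow> (\<And>\<alpha> x. \<alpha> \<in> A \<Longrightarrow> (1 + norm x) ^ K * norm (iter_partial \<alpha> g x) \<le> M) \<Longrightarrow> 0 \<le> M \<Longrightarrow> norm (T g) \<le> C * M"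
    using tempered_bound[OF T] by metis
  obtain D where D: "D \<ge> 0" "\<And>\<alpha> x a b R. \<alpha> \<in> A \<Longrightarrow> norm a \<le> R \<Longrightarrow> norm b \<le> R \<Longrightarrow>
    (1 + norm x) ^ K * norm (iter_partial \<alpha> \<kappa> (x - a) - iter_partial \<alpha> \<kappa> (x - b)) \<le> D * norm (a - b) * (1 + R) ^ K"
    using schwartz_translate_diff_uniform[OF \<kappa> A(1)] by metis
  note [measurable] = s(1) t(1) rapid_measurable[OF w]
  define I where "I n = (\<integral>y. norm (s n y - t y) * (1 + 2 * norm y) ^ K * norm (w y) \<partial>lborel)" for n
  have dom: "norm (s n y - t y) * (1 + 2 * norm y) ^ K * norm (w y) \<le> 4 * 2 ^ K * ((1 + norm y) ^ Suc K * norm (w y))" for n y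
  proof -
    have "norm (s n y - t y) \<le> 4 * (1 + norm y)"
    proof -
      have "norm (s n y - t y) \<le> norm (s n y) + norm (t y)" by (rule norm_triangle_ineq4)
      also have "\<dots> \<le> 2 * norm y + 2 * norm y" by (intro add_mono s t)
      finally show ?thesis by simp
    qed
    moreover have "(1 + 2 * norm y) ^ K \<le> (2 * (1 + norm y)) ^ K" by (intro power_mono) auto
    ultimately have "norm (s n y - t y) * (1 + 2 * norm y) ^ K \<le> (4 * (1 + norm y)) * (2 * (1 + norm y)) ^ K"
      by (intro mult_mono) auto
    then have "norm (s n y - t y) * (1 + 2 * norm y) ^ K * norm (w y) \<le> (4 * (1 + norm y)) * (2 * (1 + norm y)) ^ K * norm (w y)"
      by (rule mult_right_mono) simp
    then show ?thesis unfolding power_mult_distrib power_Suc by (simp only: mult_ac)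
  qed
  have intd: "integrable lborel (\<lambda>y. 4 * 2 ^ K * ((1 + norm y) ^ Suc K * norm (w y)))"
    by (intro integrable_mult_right rapid_weighted w)
  have intI: "integrable lborel (\<lambda>y. norm (s n y - t y) * (1 + 2 * norm y) ^ K * norm (w y))" for n
    by (rule Bochner_Integration.integrable_bound[OF intd], measurable)
       (rule AE_I2, use dom[of n] in \<open>simp add: abs_mult\<close>)
  have "I \<longlonglongrightarrow> (\<integral>(y::'b). 0 \<partial>lborel)" unfolding I_def
  proof (rule integral_dominated_convergence[OF _ _ intd])
    show "AE y in lborel. (\<lambda>n. norm (s n y - t y) * (1 + 2 * norm y) ^ K * norm (w y)) \<longlonglongrightarrow> 0"
    proof (rule AE_I2)
      fix y
      have "(\<lambda>n. norm (s n y - t y)) \<longlonglongrightarrow> 0"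
        by (rule tendsto_norm_zero[OF LIM_zero[OF lim]])
      then show "(\<lambda>n. norm (s n y - t y) * (1 + 2 * norm y) ^ K * norm (w y)) \<longlonglongrightarrow> 0"
        by (intro tendsto_mult_left_zero)
    qed
    show "AE y in lborel. norm (norm (s n y - t y) * (1 + 2 * norm y) ^ K * norm (w y)) \<le> 4 * 2 ^ K * ((1 + norm y) ^ Suc K * norm (w y))" for n
      using dom[of n] by (auto intro!: AE_I2 simp: abs_mult)
  qed measurable
  then have I0: "I \<longlonglongrightarrow> 0" by simp
  have Ipos: "I n \<ge> 0" for n by (auto simp: I_def)
  have sch: "smear \<kappa> (s n) w \<in> schwartz" "smear \<kappa> t w \<in> schwartz" for n
    by (rule smear_schwartz[OF \<kappa> s(1) w s(2)], rule smear_schwartz[OF \<kappa> t(1) w t(2)])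
  have est: "norm (T (smear \<kappa> (s n) w) - T (smear \<kappa> t w)) \<le> C * (D * I n)" for n
  proof -
    have "norm (T (\<lambda>x. smear \<kappa> (s n) w x - smear \<kappa> t w x)) \<le> C * (D * I n)"
    proof (rule C[OF schwartz_diff[OF sch]])
      fix \<alpha> x assume \<alpha>: "\<alpha> \<in> A"
      let ?k = "iter_partial \<alpha> \<kappa>"
      have k: "?k \<in> schwartz" by (rule schwartz_iter_partial[OF \<kappa>])
      note i = smear_integrable[OF k s(1)[of n] w, of x] smear_integrable[OF k t(1) w, of x]
      have "(1 + norm x) ^ K * norm (smear ?k (s n) w x - smear ?k t w x)
          = norm (\<integral>y. of_real ((1 + norm x) ^ K) * (?k (x - s n y) * w y - ?k (x - t y) * w y) \<partial>lborel)"
        unfolding smear_def by (simp add: Bochner_Integration.integral_diff[OF i, symmetric] norm_mult norm_power del: of_real_power)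
      also have "\<dots> \<le> (\<integral>y. norm (of_real ((1 + norm x) ^ K) * (?k (x - s n y) * w y - ?k (x - t y) * w y)) \<partial>lborel)"
        by (rule integral_norm_bound)
      also have "\<dots> \<le> (\<integral>y. D * (norm (s n y - t y) * (1 + 2 * norm y) ^ K * norm (w y)) \<partial>lborel)"
      proof (rule integral_mono)
        show "integrable lborel (\<lambda>y. norm (of_real ((1 + norm x) ^ K) * (?k (x - s n y) * w y - ?k (x - t y) * w y)))"
          using i by (intro integrable_norm integrable_mult_right Bochner_Integration.integrable_diff)
        show "integrable lborel (\<lambda>y. D * (norm (s n y - t y) * (1 + 2 * norm y) ^ K * norm (w y)))"
          by (intro integrable_mult_right intI)
        fix y
        have "(1 + norm x) ^ K * norm (?k (x - s n y) - ?k (x - t y)) * norm (w y) \<le> D * norm (s n y - t y) * (1 + 2 * norm y) ^ K * norm (w y)"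
          by (intro mult_right_mono D \<alpha> s t) simp
        then show "norm (of_real ((1 + norm x) ^ K) * (?k (x - s n y) * w y - ?k (x - t y) * w y)) \<le> D * (norm (s n y - t y) * (1 + 2 * norm y) ^ K * norm (w y))"
          unfolding left_diff_distrib[symmetric]
          by (simp add: norm_mult norm_power mult.assoc del: of_real_power)
      qed
      also have "\<dots> = D * I n" by (simp add: I_def)
      finally show "(1 + norm x) ^ K * norm (iter_partial \<alpha> (\<lambda>x. smear \<kappa> (s n) w x - smear \<kappa> t w x) x) \<le> D * I n"
        by (simp add: iter_partial_diff schwartz_smooth[OF sch(1)] schwartz_smooth[OF sch(2)]
            iter_partial_smear[OF \<kappa> s(1) w] iter_partial_smear[OF \<kappa> t(1) w])
    qed (use D Ipos in simp)
    then show ?thesis by (simp add: tempered_diff[OF T sch])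
  qed
  have "(\<lambda>n. C * (D * I n)) \<longlonglongrightarrow> C * (D * 0)" by (intro tendsto_intros I0)
  then have L: "(\<lambda>n. C * (D * I n)) \<longlonglongrightarrow> 0" by simp
  show ?thesis
    by (rule LIM_zero_cancel, rule Lim_null_comparison[OF always_eventually[OF allI[OF est]] L])
qed

lemma integral_simple_comp:
  fixes \<phi> :: "'a::euclidean_space \<Rightarrow> complex" and s :: "'b::euclidean_space \<Rightarrow> 'a"
  assumes s: "simple_function borel s" and w: "integrable lborel w"
  shows "(\<integral>y. \<phi> (s y) * w y \<partial>lborel) = (\<Sum>v\<in>range s. (\<integral>y. of_bool (s y = v) * w y \<partial>lborel) * \<phi> v)"
proof -
  have fin: "finite (range s)" using simple_functionD(1)[OF s] by simp
  have [measurable]: "s \<in> borel_measurable borel" using s by (rule borel_measurable_simple_function)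
  have [measurable]: "w \<in> borel_measurable borel" using borel_measurable_integrable[OF w] by simp
  have int: "integrable lborel (\<lambda>y. of_bool (s y = v) * w y)" for v
    by (rule integrable_bounded_mult[OF w, of _ 1]) auto
  have "\<phi> (s y) * w y = (\<Sum>v\<in>range s. (of_bool (s y = v) * w y) * \<phi> v)" for y
  proof -
    have "(\<Sum>v\<in>range s. (of_bool (s y = v) * w y) * \<phi> v) = (\<Sum>v\<in>range s. if s y = v then \<phi> v * w y else 0)"
      by (intro sum.cong) auto
    then show ?thesis using fin by (simp add: sum.delta)
  qed
  then have "(\<integral>y. \<phi> (s y) * w y \<partial>lborel) = (\<integral>y. (\<Sum>v\<in>range s. (of_bool (s y = v) * w y) * \<phi> v) \<partial>lborel)" by simp
  also have "\<dots> = (\<Sum>v\<in>range s. (\<integral>y. of_bool (s y = v) * w y \<partial>lborel) * \<phi> v)"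
    using int by (subst Bochner_Integration.integral_sum) auto
  finally show ?thesis .
qed

text \<open>For simple \<open>s\<close> the smear is a finite combination of translates, so
  linearity of T suffices.\<close>

lemma tempered_smear_simple:
  assumes T: "tempered T" and \<kappa>: "\<kappa> \<in> schwartz" and w: "rapid w" and s: "simple_function borel s"
  shows "T (smear \<kappa> s w) = (\<integral>y. T (\<lambda>x. \<kappa> (x - s y)) * w y \<partial>lborel)"
proof -
  have fin: "finite (range s)" using simple_functionD(1)[OF s] by simp
  have "smear \<kappa> s w = (\<lambda>x. \<Sum>v\<in>range s. (\<integral>y. of_bool (s y = v) * w y \<partial>lborel) * \<kappa> (x - v))"
    unfolding smear_def by (rule ext, rule integral_simple_comp[OF s rapid_integrable[OF w]])
  then show ?thesis
    using tempered_sum[OF T fin, of "\<lambda>v x. \<kappa> (x - v)"] schwartz_translate[OF \<kappa>]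
      integral_simple_comp[OF s rapid_integrable[OF w], of "\<lambda>v. T (\<lambda>x. \<kappa> (x - v))"] by simp
qed

text \<open>This stands in for a Schwartz-valued integral. The identity map is a pointwise limit of
  simple functions, T commutes with the integral for each of them, and both sides converge; on the
  right this uses that T on translates is continuous and of polynomial growth.\<close>

lemma tempered_smear_integral:
  assumes T: "tempered T" and \<kappa>: "\<kappa> \<in> schwartz" and w: "rapid w"
  shows "integrable lborel (\<lambda>y. T (\<lambda>x. \<kappa> (x - y)) * w y)"
    and "T (smear \<kappa> (\<lambda>y. y) w) = (\<integral>y. T (\<lambda>x. \<kappa> (x - y)) * w y \<partial>lborel)"
proof -
  define G where "G y = T (\<lambda>x. \<kappa> (x - y))" for y
  have cont: "continuous_on UNIV G" unfolding G_def by (rule tempered_translate_continuous[OF T \<kappa>])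
  obtain C K where C: "C \<ge> 0" "\<And>y. norm (G y) \<le> C * (1 + norm y) ^ K"
    using tempered_translate_growth[OF T \<kappa>] unfolding G_def by metis
  have "\<exists>F. (\<forall>i. simple_function borel (F i)) \<and> (\<forall>x\<in>space (borel :: (real^'a) measure). (\<lambda>i. F i x) \<longlonglongrightarrow> x) \<and>
    (\<forall>i. \<forall>x\<in>space (borel :: (real^'a) measure). dist (F i x) 0 \<le> 2 * dist x 0)"
    by (rule borel_measurable_implies_sequence_metric) simp
  then obtain s :: "nat \<Rightarrow> real^'a \<Rightarrow> real^'a" where s: "\<And>i. simple_function borel (s i)" "\<And>x. (\<lambda>i. s i x) \<longlonglongrightarrow> x"
    "\<And>i x. norm (s i x) \<le> 2 * norm x" by auto
  have [measurable]: "s i \<in> borel_measurable borel" for i using s(1) by (rule borel_measurable_simple_function)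
  have [measurable]: "G \<in> borel_measurable borel" using cont by (rule borel_measurable_continuous_onI)
  note [measurable] = rapid_measurable[OF w]
  have L1: "(\<lambda>n. T (smear \<kappa> (s n) w)) \<longlonglongrightarrow> T (smear \<kappa> (\<lambda>y. y) w)"
    by (rule tempered_smear_tendsto[OF T \<kappa> w]) (use s in auto)
  have dom: "norm (G z * w y) \<le> C * 2 ^ K * ((1 + norm y) ^ K * norm (w y))" if "norm z \<le> 2 * norm y" for z y
  proof -
    have "norm (G z) \<le> C * (2 * (1 + norm y)) ^ K"
      by (rule order.trans[OF C(2)]) (use C(1) that in \<open>auto intro!: mult_left_mono power_mono\<close>)
    then have "norm (G z) * norm (w y) \<le> C * (2 * (1 + norm y)) ^ K * norm (w y)" by (rule mult_right_mono) simp
    then show ?thesis unfolding power_mult_distrib by (simp add: norm_mult mult_ac)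
  qed
  have intd: "integrable lborel (\<lambda>y. C * 2 ^ K * ((1 + norm y) ^ K * norm (w y)))"
    by (intro integrable_mult_right rapid_weighted w)
  have L2: "(\<lambda>n. \<integral>y. G (s n y) * w y \<partial>lborel) \<longlonglongrightarrow> (\<integral>y. G y * w y \<partial>lborel)"
  proof (rule integral_dominated_convergence[OF _ _ intd])
    show "AE y in lborel. (\<lambda>n. G (s n y) * w y) \<longlonglongrightarrow> G y * w y"
      using continuous_on_tendsto_compose[OF cont s(2)] by (intro AE_I2 tendsto_mult tendsto_const) auto
    show "AE y in lborel. norm (G (s n y) * w y) \<le> C * 2 ^ K * ((1 + norm y) ^ K * norm (w y))" for n
      by (intro AE_I2 dom s)
  qed measurable
  show "T (smear \<kappa> (\<lambda>y. y) w) = (\<integral>y. T (\<lambda>x. \<kappa> (x - y)) * w y \<partial>lborel)"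
    using LIMSEQ_unique[OF L1] L2 unfolding tempered_smear_simple[OF T \<kappa> w s(1)] G_def by blast
  show "integrable lborel (\<lambda>y. T (\<lambda>x. \<kappa> (x - y)) * w y)" unfolding G_def[symmetric]
    by (rule Bochner_Integration.integrable_bound[OF intd], measurable)
       (rule AE_I2, rule order.trans[OF dom], auto)
qed

section \<open>Fourier inversion\<close>

text \<open>Boundedness of the kernel makes the double integral absolutely convergent. The kernel is
  a character in the Fourier computations and a rescaled mollifier in the uniqueness proof.\<close>

lemma fubini_bounded_kernel:
  fixes f :: "'a::euclidean_space \<Rightarrow> complex" and g :: "'b::euclidean_space \<Rightarrow> complex"
  assumes f: "integrable lborel f" and g: "integrable lborel g"
    and E: "case_prod E \<in> borel_measurable (borel \<Otimes>\<^sub>M borel)" "\<And>x y. norm (E x y) \<le> 1"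
  shows "(\<integral>x. (\<integral>y. E x y * g y \<partial>lborel) * f x \<partial>lborel) = (\<integral>y. (\<integral>x. E x y * f x \<partial>lborel) * g y \<partial>lborel)"
proof -
  have [measurable]: "f \<in> borel_measurable borel" "g \<in> borel_measurable borel"
    using f g by (auto dest: borel_measurable_integrable)
  note [measurable] = E(1)
  have m: "(\<lambda>(x, y). E x y * g y * f x) \<in> borel_measurable (lborel \<Otimes>\<^sub>M lborel)"
    by measurable
  have gx: "integrable lborel (\<lambda>y. E x y * g y)" for x
    by (rule integrable_bounded_mult[OF g _ E(2)]) measurable
  have fy: "integrable lborel (\<lambda>x. E x y * f x)" for y
    by (rule integrable_bounded_mult[OF f _ E(2)]) measurable
  have int: "integrable (lborel \<Otimes>\<^sub>M lborel) (\<lambda>(x, y). E x y * g y * f x)"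
  proof (rule lborel_pair.Fubini_integrable[OF m])
    show "AE x in lborel. integrable lborel (\<lambda>y. case (x, y) of (x, y) \<Rightarrow> E x y * g y * f x)"
      using gx by auto
    show "integrable lborel (\<lambda>x. \<integral>y. norm (case (x, y) of (x, y) \<Rightarrow> E x y * g y * f x) \<partial>lborel)"
    proof (rule Bochner_Integration.integrable_bound)
      show "integrable lborel (\<lambda>x. (\<integral>y. norm (g y) \<partial>lborel) * norm (f x))"
        using f by simp
      show "(\<lambda>x. \<integral>y. norm (case (x, y) of (x, y) \<Rightarrow> E x y * g y * f x) \<partial>lborel) \<in> borel_measurable lborel"
        using m by measurable
      show "AE x in lborel. norm (\<integral>y. norm (case (x, y) of (x, y) \<Rightarrow> E x y * g y * f x) \<partial>lborel) \<le> norm ((\<integral>y. norm (g y) \<partial>lborel) * norm (f x))"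
      proof (rule AE_I2)
        fix x
        have "(\<integral>y. norm (E x y * g y * f x) \<partial>lborel) \<le> (\<integral>y. norm (g y) * norm (f x) \<partial>lborel)"
        proof (rule integral_mono)
          show "norm (E x y * g y * f x) \<le> norm (g y) * norm (f x)" for y
            using mult_right_mono[OF E(2)[of x y], of "norm (g y)"] by (auto simp: norm_mult intro!: mult_right_mono)
        qed (use gx g in auto)
        then show "norm (\<integral>y. norm (case (x, y) of (x, y) \<Rightarrow> E x y * g y * f x) \<partial>lborel) \<le> norm ((\<integral>y. norm (g y) \<partial>lborel) * norm (f x))"
          by simp
      qed
    qed
  qed
  have "(\<integral>x. (\<integral>y. E x y * g y \<partial>lborel) * f x \<partial>lborel) = (\<integral>x. (\<integral>y. E x y * g y * f x \<partial>lborel) \<partial>lborel)"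
    by simp
  also have "\<dots> = (\<integral>y. (\<integral>x. E x y * g y * f x \<partial>lborel) \<partial>lborel)"
    by (rule lborel_pair.Fubini_integral[OF int, symmetric])
  also have "\<dots> = (\<integral>y. (\<integral>x. (E x y * f x) * g y \<partial>lborel) \<partial>lborel)"
    by (simp add: mult_ac)
  also have "\<dots> = (\<integral>y. (\<integral>x. E x y * f x \<partial>lborel) * g y \<partial>lborel)"
    by simp
  finally show ?thesis .
qed

text \<open>Lebesgue measure on a Euclidean space is the image of the product measure over the
  basis, so an integrand that factors along the coordinates integrates factor by factor.\<close>

lemma integral_lborel_prod:
  fixes h :: "'a::euclidean_space \<Rightarrow> real \<Rightarrow> complex"
  assumes h: "\<And>b. b \<in> Basis \<Longrightarrow> integrable lborel (h b)"
  shows "integrable lborel (\<lambda>x. \<Prod>b\<in>Basis. h b (x \<bullet> b))"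
    and "(\<integral>x. (\<Prod>b\<in>Basis. h b (x \<bullet> b)) \<partial>lborel) = (\<Prod>b\<in>Basis. \<integral>x. h b x \<partial>lborel)"
proof -
  interpret product_sigma_finite "\<lambda>_::'a. lborel :: real measure" by standard
  have m: "(\<lambda>f. \<Sum>b\<in>Basis. f b *\<^sub>R b) \<in> measurable (\<Pi>\<^sub>M b\<in>(Basis :: 'a set). lborel) borel" by measurable
  have hm: "h b \<in> borel_measurable borel" if "b \<in> Basis" for b
    using h[OF that] by (auto dest: borel_measurable_integrable)
  have M: "(\<lambda>x. \<Prod>b\<in>Basis. h b (x \<bullet> b)) \<in> borel_measurable borel"
    using hm by measurable
  have eq: "(\<Prod>b\<in>Basis. h b ((\<Sum>b\<in>Basis. f b *\<^sub>R b) \<bullet> b)) = (\<Prod>b\<in>(Basis::'a set). h b (f b))" for f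
    by (intro prod.cong) auto
  show "integrable lborel (\<lambda>x. \<Prod>b\<in>Basis. h b (x \<bullet> b))"
    unfolding lborel_eq[where 'a='a] integrable_distr_eq[OF m M] eq
    by (rule product_integrable_prod[OF _ h]) auto
  show "(\<integral>x. (\<Prod>b\<in>Basis. h b (x \<bullet> b)) \<partial>lborel) = (\<Prod>b\<in>Basis. \<integral>x. h b x \<partial>lborel)"
    unfolding lborel_eq[where 'a='a] integral_distr[OF m M] eq
    by (subst product_integral_prod) (auto simp: h)
qed

text \<open>Up to the factor sqrt (2 pi) the integral is the characteristic function of the standard
  normal distribution.\<close>

lemma gaussian_real:
  shows "integrable lborel (\<lambda>s::real. exp (\<i> * of_real (t * s)) * of_real (exp (- s\<^sup>2 / 2)))"
    and "(\<integral>s. exp (\<i> * of_real (t * s)) * of_real (exp (- s\<^sup>2 / 2)) \<partial>lborel) = of_real (sqrt (2 * pi) * exp (- t\<^sup>2 / 2))"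
proof -
  have d: "exp (- s\<^sup>2 / 2) = sqrt (2 * pi) * std_normal_density s" for s :: real
    by (simp add: std_normal_density_def)
  have "integrable lborel (\<lambda>s. sqrt (2 * pi) * std_normal_density s)"
    by (intro integrable_mult_right) (use integrable_std_normal_moment[of 0] in simp)
  then have i: "integrable lborel (\<lambda>s::real. of_real (exp (- s\<^sup>2 / 2)) :: complex)"
    unfolding d by (rule integrable_of_real)
  show "integrable lborel (\<lambda>s::real. exp (\<i> * of_real (t * s)) * of_real (exp (- s\<^sup>2 / 2)) :: complex)"
    by (rule integrable_bounded_mult[OF i, of _ 1]) (auto simp: norm_exp_i_times)
  have "char std_normal_distribution t = (\<integral>s. std_normal_density s *\<^sub>R exp (\<i> * of_real (t * s)) \<partial>lborel)"
    unfolding char_def by (subst integral_density) (auto simp: normal_density_nonneg)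
  then have *: "(\<integral>s. std_normal_density s *\<^sub>R exp (\<i> * of_real (t * s)) \<partial>lborel) = of_real (exp (- t\<^sup>2 / 2))"
    by (simp add: char_std_normal_distribution)
  have "(\<integral>s. exp (\<i> * of_real (t * s)) * of_real (exp (- s\<^sup>2 / 2)) \<partial>lborel)
      = (\<integral>s. of_real (sqrt (2 * pi)) * (std_normal_density s *\<^sub>R exp (\<i> * of_real (t * s))) \<partial>lborel)"
    unfolding d by (simp add: scaleR_conv_of_real mult_ac)
  also have "\<dots> = of_real (sqrt (2 * pi)) * of_real (exp (- t\<^sup>2 / 2))" unfolding integral_mult_right_zero * ..
  finally show "(\<integral>s. exp (\<i> * of_real (t * s)) * of_real (exp (- s\<^sup>2 / 2)) \<partial>lborel) = of_real (sqrt (2 * pi) * exp (- t\<^sup>2 / 2))"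
    by simp
qed

lemma norm_vec_sq_Basis: "(norm x)\<^sup>2 = (\<Sum>b\<in>Basis. (x \<bullet> b)\<^sup>2)"
  by (subst power2_norm_eq_inner, subst euclidean_inner) (simp add: power2_eq_square)

lemma gaussian_integral:
  fixes x :: "real^'d::finite"
  shows "integrable lborel (\<lambda>\<xi>. exp (\<i> * of_real (x \<bullet> \<xi>)) * of_real (exp (- (norm \<xi>)\<^sup>2 / 2)))"
    and "(\<integral>\<xi>. exp (\<i> * of_real (x \<bullet> \<xi>)) * of_real (exp (- (norm \<xi>)\<^sup>2 / 2)) \<partial>lborel)
      = of_real (sqrt (2 * pi) ^ CARD('d) * exp (- (norm x)\<^sup>2 / 2))"
proof -
  let ?h = "\<lambda>b s. exp (\<i> * of_real ((x \<bullet> b) * s)) * of_real (exp (- s\<^sup>2 / 2)) :: complex"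
  have eq: "exp (\<i> * of_real (x \<bullet> \<xi>)) * of_real (exp (- (norm \<xi>)\<^sup>2 / 2)) = (\<Prod>b\<in>Basis. ?h b (\<xi> \<bullet> b))" for \<xi> :: "real^'d"
    unfolding prod.distrib of_real_prod[symmetric] exp_sum[OF finite_Basis, symmetric] norm_vec_sq_Basis euclidean_inner[of x \<xi>]
    by (simp add: sum_distrib_left sum_negf sum_divide_distrib)
  show "integrable lborel (\<lambda>\<xi>. exp (\<i> * of_real (x \<bullet> \<xi>)) * of_real (exp (- (norm \<xi>)\<^sup>2 / 2)))"
    unfolding eq by (rule integral_lborel_prod(1)[OF gaussian_real(1)])
  have "(\<integral>\<xi>. exp (\<i> * of_real (x \<bullet> \<xi>)) * of_real (exp (- (norm \<xi>)\<^sup>2 / 2)) \<partial>lborel) = (\<Prod>b\<in>(Basis::(real^'d) set). \<integral>s. ?h b s \<partial>lborel)"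
    unfolding eq by (rule integral_lborel_prod(2)[OF gaussian_real(1)])
  also have "\<dots> = (\<Prod>b\<in>(Basis::(real^'d) set). of_real (sqrt (2 * pi) * exp (- (x \<bullet> b)\<^sup>2 / 2)))"
    unfolding gaussian_real(2) ..
  also have "\<dots> = of_real (sqrt (2 * pi) ^ CARD('d) * exp (- (norm x)\<^sup>2 / 2))"
    unfolding of_real_prod[symmetric] prod.distrib exp_sum[OF finite_Basis, symmetric] norm_vec_sq_Basis
    by (simp add: sum_negf sum_divide_distrib)
  finally show "(\<integral>\<xi>. exp (\<i> * of_real (x \<bullet> \<xi>)) * of_real (exp (- (norm \<xi>)\<^sup>2 / 2)) \<partial>lborel)
      = of_real (sqrt (2 * pi) ^ CARD('d) * exp (- (norm x)\<^sup>2 / 2))" .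
qed

lemma gaussian_integral_scaled:
  fixes x :: "real^'d::finite"
  assumes "\<epsilon> > 0"
  shows "integrable lborel (\<lambda>\<xi>. exp (\<i> * of_real (x \<bullet> \<xi>)) * of_real (exp (- (norm (\<epsilon> *\<^sub>R \<xi>))\<^sup>2 / 2)))"
    and "(\<integral>\<xi>. exp (\<i> * of_real (x \<bullet> \<xi>)) * of_real (exp (- (norm (\<epsilon> *\<^sub>R \<xi>))\<^sup>2 / 2)) \<partial>lborel)
      = of_real ((sqrt (2 * pi) / \<epsilon>) ^ CARD('d) * exp (- (norm (x /\<^sub>R \<epsilon>))\<^sup>2 / 2))"
proof -
  let ?F = "\<lambda>\<xi>. exp (\<i> * of_real ((x /\<^sub>R \<epsilon>) \<bullet> \<xi>)) * of_real (exp (- (norm \<xi>)\<^sup>2 / 2)) :: complex"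
  have eq: "?F (0 + \<epsilon> *\<^sub>R \<xi>) = exp (\<i> * of_real (x \<bullet> \<xi>)) * of_real (exp (- (norm (\<epsilon> *\<^sub>R \<xi>))\<^sup>2 / 2))" for \<xi>
  proof -
    have "(x /\<^sub>R \<epsilon>) \<bullet> (0 + \<epsilon> *\<^sub>R \<xi>) = x \<bullet> \<xi>" using assms by simp
    then show ?thesis by (simp only: add_0)
  qed
  show "integrable lborel (\<lambda>\<xi>. exp (\<i> * of_real (x \<bullet> \<xi>)) * of_real (exp (- (norm (\<epsilon> *\<^sub>R \<xi>))\<^sup>2 / 2)))"
    using integrable_lborel_affine[OF gaussian_integral(1), of \<epsilon> "x /\<^sub>R \<epsilon>" 0] assms unfolding eq by simp
  have "(\<integral>\<xi>. ?F \<xi> \<partial>lborel) = (\<bar>\<epsilon>\<bar> ^ DIM(real^'d)) *\<^sub>R (\<integral>\<xi>. ?F (0 + \<epsilon> *\<^sub>R \<xi>) \<partial>lborel)"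
    using assms by (intro integral_lborel_affine) auto
  then show "(\<integral>\<xi>. exp (\<i> * of_real (x \<bullet> \<xi>)) * of_real (exp (- (norm (\<epsilon> *\<^sub>R \<xi>))\<^sup>2 / 2)) \<partial>lborel)
      = of_real ((sqrt (2 * pi) / \<epsilon>) ^ CARD('d) * exp (- (norm (x /\<^sub>R \<epsilon>))\<^sup>2 / 2))"
    using assms unfolding eq gaussian_integral(2) by (simp add: scaleR_conv_of_real power_divide field_simps)
qed

lemma exp_i_tendsto_gauss:
  assumes "e \<longlonglongrightarrow> (0::real)"
  shows "(\<lambda>n. complex_of_real (exp (- (norm (e n *\<^sub>R \<xi>))\<^sup>2 / 2))) \<longlonglongrightarrow> 1"
proof -
  have "(\<lambda>n. complex_of_real (exp (- (norm (e n *\<^sub>R \<xi>))\<^sup>2 / 2))) \<longlonglongrightarrow> of_real (exp (- (norm (0 *\<^sub>R \<xi>))\<^sup>2 / 2))"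
    by (intro tendsto_intros assms) auto
  then show ?thesis by simp
qed

lemma exp_inner_diff:
  "exp (- (\<i> * complex_of_real (\<xi> \<bullet> y))) * exp (\<i> * complex_of_real (x \<bullet> \<xi>)) = exp (\<i> * of_real ((x - y) \<bullet> \<xi>))"
  unfolding exp_add[symmetric] by (simp add: inner_diff_left inner_commute algebra_simps)

text \<open>The Gaussian factor makes the double integral absolutely convergent.\<close>

lemma FT_inversion:
  fixes \<eta> :: "real^'d::finite \<Rightarrow> complex"
  assumes \<eta>: "\<eta> \<in> test_functions"
  shows "(\<integral>\<xi>. exp (\<i> * of_real (x \<bullet> \<xi>)) * FT \<eta> \<xi> \<partial>lborel) = of_real ((2 * pi) ^ CARD('d)) * \<eta> x"
proof -
  let ?d = "CARD('d)"
  define e where "e n = inverse (real (Suc n))" for n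
  have e: "e n > 0" "e \<longlonglongrightarrow> 0" for n
    unfolding e_def using LIMSEQ_inverse_real_of_nat by auto
  let ?g = "\<lambda>n \<xi>. complex_of_real (exp (- (norm (e n *\<^sub>R \<xi>))\<^sup>2 / 2))"
  have F: "FT \<eta> \<in> schwartz" by (rule FT_schwartz[OF \<eta>])
  have \<eta>s: "\<eta> \<in> schwartz" by (rule test_function_schwartz[OF \<eta>])
  have [measurable]: "FT \<eta> \<in> borel_measurable borel" "\<eta> \<in> borel_measurable borel"
    using F \<eta>s by (auto intro: schwartz_measurable)
  obtain B where B: "\<And>x. norm (\<eta> x) \<le> B" using schwartz_bounded[OF \<eta>s] by metis
  have L1: "(\<lambda>n. \<integral>\<xi>. exp (\<i> * of_real (x \<bullet> \<xi>)) * ?g n \<xi> * FT \<eta> \<xi> \<partial>lborel) \<longlonglongrightarrow> (\<integral>\<xi>. exp (\<i> * of_real (x \<bullet> \<xi>)) * FT \<eta> \<xi> \<partial>lborel)"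
  proof (rule integral_dominated_convergence)
    show "integrable lborel (\<lambda>\<xi>. norm (FT \<eta> \<xi>))" using schwartz_integrable[OF F] by simp
    show "AE \<xi> in lborel. (\<lambda>n. exp (\<i> * of_real (x \<bullet> \<xi>)) * ?g n \<xi> * FT \<eta> \<xi>) \<longlonglongrightarrow> exp (\<i> * of_real (x \<bullet> \<xi>)) * FT \<eta> \<xi>"
    proof (rule AE_I2)
      fix \<xi>
      have "(\<lambda>n. exp (\<i> * of_real (x \<bullet> \<xi>)) * ?g n \<xi> * FT \<eta> \<xi>) \<longlonglongrightarrow> exp (\<i> * of_real (x \<bullet> \<xi>)) * 1 * FT \<eta> \<xi>"
        by (intro tendsto_mult tendsto_const exp_i_tendsto_gauss e)
      then show "(\<lambda>n. exp (\<i> * of_real (x \<bullet> \<xi>)) * ?g n \<xi> * FT \<eta> \<xi>) \<longlonglongrightarrow> exp (\<i> * of_real (x \<bullet> \<xi>)) * FT \<eta> \<xi>" by simp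
    qed
    show "AE \<xi> in lborel. norm (exp (\<i> * of_real (x \<bullet> \<xi>)) * ?g n \<xi> * FT \<eta> \<xi>) \<le> norm (FT \<eta> \<xi>)" for n
      by (rule AE_I2) (simp add: norm_mult mult_left_le_one_le)
  qed measurable
  have swap: "(\<integral>\<xi>. exp (\<i> * of_real (x \<bullet> \<xi>)) * ?g n \<xi> * FT \<eta> \<xi> \<partial>lborel)
      = of_real (sqrt (2 * pi) ^ ?d) * (\<integral>z. of_real (exp (- (norm z)\<^sup>2 / 2)) * \<eta> (x + (- e n) *\<^sub>R z) \<partial>lborel)" for n
  proof -
    have gi: "integrable lborel (\<lambda>\<xi>. exp (\<i> * of_real (x \<bullet> \<xi>)) * ?g n \<xi>)"
      by (rule gaussian_integral_scaled(1)[OF e(1)])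
    have "(\<integral>\<xi>. exp (\<i> * of_real (x \<bullet> \<xi>)) * ?g n \<xi> * FT \<eta> \<xi> \<partial>lborel)
        = (\<integral>\<xi>. (\<integral>y. exp (- (\<i> * of_real (\<xi> \<bullet> y))) * \<eta> y \<partial>lborel) * (exp (\<i> * of_real (x \<bullet> \<xi>)) * ?g n \<xi>) \<partial>lborel)"
      by (simp add: FT_def mult_ac)
    also have "\<dots> = (\<integral>y. (\<integral>\<xi>. exp (- (\<i> * of_real (\<xi> \<bullet> y))) * (exp (\<i> * of_real (x \<bullet> \<xi>)) * ?g n \<xi>) \<partial>lborel) * \<eta> y \<partial>lborel)"
      by (rule fubini_bounded_kernel[OF gi schwartz_integrable[OF \<eta>s]]) auto
    also have "\<dots> = (\<integral>y. of_real ((sqrt (2 * pi) / e n) ^ ?d * exp (- (norm ((x - y) /\<^sub>R e n))\<^sup>2 / 2)) * \<eta> y \<partial>lborel)"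
    proof -
      have "(\<integral>\<xi>. exp (- (\<i> * of_real (\<xi> \<bullet> y))) * (exp (\<i> * of_real (x \<bullet> \<xi>)) * ?g n \<xi>) \<partial>lborel)
          = (\<integral>\<xi>. exp (\<i> * of_real ((x - y) \<bullet> \<xi>)) * ?g n \<xi> \<partial>lborel)" for y
        unfolding mult.assoc[symmetric] exp_inner_diff ..
      then show ?thesis unfolding gaussian_integral_scaled(2)[OF e(1)] by simp
    qed
    \<comment> \<open>Substitution y = x - e_n z: the Jacobian cancels e_n^(-d), and e_n survives
      only in the argument of \<eta>, where it tends to 0.\<close>
    also have "\<dots> = (\<bar>- e n\<bar> ^ DIM(real^'d)) *\<^sub>R (\<integral>z. of_real ((sqrt (2 * pi) / e n) ^ ?d * exp (- (norm ((x - (x + (- e n) *\<^sub>R z)) /\<^sub>R e n))\<^sup>2 / 2)) * \<eta> (x + (- e n) *\<^sub>R z) \<partial>lborel)"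
      using e(1)[of n] by (intro integral_lborel_affine) auto
    also have "\<dots> = (\<bar>e n\<bar> ^ ?d) *\<^sub>R (\<integral>z. of_real ((sqrt (2 * pi) / e n) ^ ?d) * (of_real (exp (- (norm z)\<^sup>2 / 2)) * \<eta> (x + (- e n) *\<^sub>R z)) \<partial>lborel)"
      using e(1)[of n] by (simp add: mult_ac)
    also have "\<dots> = of_real (sqrt (2 * pi) ^ ?d) * (\<integral>z. of_real (exp (- (norm z)\<^sup>2 / 2)) * \<eta> (x + (- e n) *\<^sub>R z) \<partial>lborel)"
      using e(1)[of n] unfolding integral_mult_right_zero
      by (simp add: scaleR_conv_of_real power_divide)
    finally show ?thesis .
  qed
  have g0: "integrable lborel (\<lambda>\<xi>::real^'d. complex_of_real (exp (- (norm \<xi>)\<^sup>2 / 2)))"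
    "(\<integral>(\<xi>::real^'d). complex_of_real (exp (- (norm \<xi>)\<^sup>2 / 2)) \<partial>lborel) = of_real (sqrt (2 * pi) ^ ?d)"
    using gaussian_integral[of "0::real^'d"] by simp_all
  have "(\<lambda>n. \<integral>z. of_real (exp (- (norm z)\<^sup>2 / 2)) * \<eta> (x + (- e n) *\<^sub>R z) \<partial>lborel) \<longlonglongrightarrow> (\<integral>z. of_real (exp (- (norm (z::real^'d))\<^sup>2 / 2)) * \<eta> x \<partial>lborel)"
  proof (rule integral_dominated_convergence)
    show "integrable lborel (\<lambda>z::real^'d. B * norm (complex_of_real (exp (- (norm z)\<^sup>2 / 2))))"
      using g0(1) by (intro integrable_mult_right integrable_norm)
    show "AE z in lborel. (\<lambda>n. of_real (exp (- (norm z)\<^sup>2 / 2)) * \<eta> (x + (- e n) *\<^sub>R z)) \<longlonglongrightarrow> of_real (exp (- (norm z)\<^sup>2 / 2)) * \<eta> x"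
    proof (rule AE_I2)
      fix z
      have "(\<lambda>n. x + (- e n) *\<^sub>R z) \<longlonglongrightarrow> x + (- 0) *\<^sub>R z" by (intro tendsto_intros e)
      then have "(\<lambda>n. \<eta> (x + (- e n) *\<^sub>R z)) \<longlonglongrightarrow> \<eta> x"
        using continuous_on_tendsto_compose[OF schwartz_continuous[OF \<eta>s, of UNIV]] by simp
      then show "(\<lambda>n. of_real (exp (- (norm z)\<^sup>2 / 2)) * \<eta> (x + (- e n) *\<^sub>R z)) \<longlonglongrightarrow> of_real (exp (- (norm z)\<^sup>2 / 2)) * \<eta> x"
        by (intro tendsto_mult tendsto_const)
    qed
    show "AE z in lborel. norm (of_real (exp (- (norm z)\<^sup>2 / 2)) * \<eta> (x + (- e n) *\<^sub>R z)) \<le> B * norm (complex_of_real (exp (- (norm z)\<^sup>2 / 2)))" for n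
      using B by (intro AE_I2) (simp add: norm_mult mult.commute mult_left_mono)
  qed measurable
  then have "(\<lambda>n. \<integral>z. of_real (exp (- (norm z)\<^sup>2 / 2)) * \<eta> (x + (- e n) *\<^sub>R z) \<partial>lborel) \<longlonglongrightarrow> of_real (sqrt (2 * pi) ^ ?d) * \<eta> x"
    unfolding integral_mult_left_zero g0(2) .
  \<comment> \<open>One factor sqrt (2 pi)^d comes from transforming the Gaussian, the other from
    its total mass.\<close>
  then have "(\<lambda>n. \<integral>\<xi>. exp (\<i> * of_real (x \<bullet> \<xi>)) * ?g n \<xi> * FT \<eta> \<xi> \<partial>lborel) \<longlonglongrightarrow> of_real (sqrt (2 * pi) ^ ?d) * (of_real (sqrt (2 * pi) ^ ?d) * \<eta> x)"
    unfolding swap by (intro tendsto_mult tendsto_const)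
  from LIMSEQ_unique[OF L1 this]
  have "(\<integral>\<xi>. exp (\<i> * of_real (x \<bullet> \<xi>)) * FT \<eta> \<xi> \<partial>lborel) = of_real (sqrt (2 * pi) ^ ?d * sqrt (2 * pi) ^ ?d) * \<eta> x"
    by simp
  also have "sqrt (2 * pi) ^ ?d * sqrt (2 * pi) ^ ?d = (2 * pi) ^ ?d"
    by (subst power_mult_distrib[symmetric]) simp
  finally show ?thesis .
qed

text \<open>The convolution theorem. With \<open>w\<close> a Schwartz function on which the
  distribution is tested it computes the frequency blocks; with \<open>w\<close> a kernel of known
  inverse transform it gives the reproducing formula.\<close>

lemma FT_smear:
  fixes \<eta> :: "real^'d::finite \<Rightarrow> complex"
  assumes \<eta>: "\<eta> \<in> test_functions" and w: "integrable lborel w"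
  shows "smear (FT \<eta>) (\<lambda>y. y) w = FT (\<lambda>\<xi>. \<eta> \<xi> * (\<integral>y. exp (\<i> * of_real (\<xi> \<bullet> y)) * w y \<partial>lborel))"
proof
  fix x
  have ei: "exp (- (\<i> * of_real ((x - y) \<bullet> \<xi>))) = exp (\<i> * of_real (\<xi> \<bullet> y)) * exp (- (\<i> * of_real (x \<bullet> \<xi>)))" for y \<xi> :: "real^'d"
    unfolding exp_add[symmetric] by (simp add: inner_diff_left inner_commute algebra_simps)
  have i: "integrable lborel (\<lambda>\<xi>. exp (- (\<i> * of_real (x \<bullet> \<xi>))) * \<eta> \<xi>)"
    by (rule integrable_exp_mult[OF schwartz_integrable[OF test_function_schwartz[OF \<eta>]]])
  have "smear (FT \<eta>) (\<lambda>y. y) w x = (\<integral>y. (\<integral>\<xi>. exp (\<i> * of_real (\<xi> \<bullet> y)) * (exp (- (\<i> * of_real (x \<bullet> \<xi>))) * \<eta> \<xi>) \<partial>lborel) * w y \<partial>lborel)"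
    by (simp add: smear_def FT_def ei mult.assoc)
  also have "\<dots> = (\<integral>\<xi>. (\<integral>y. exp (\<i> * of_real (\<xi> \<bullet> y)) * w y \<partial>lborel) * (exp (- (\<i> * of_real (x \<bullet> \<xi>))) * \<eta> \<xi>) \<partial>lborel)"
    by (rule fubini_bounded_kernel[OF w i]) (auto simp: norm_exp_i_times)
  finally show "smear (FT \<eta>) (\<lambda>y. y) w x = FT (\<lambda>\<xi>. \<eta> \<xi> * (\<integral>y. exp (\<i> * of_real (\<xi> \<bullet> y)) * w y \<partial>lborel)) x"
    by (simp add: FT_def mult_ac)
qed

section \<open>Frequency blocks as functions\<close>

text \<open>These cutoffs are the partial sums of the resolution of unity
  (\<open>sum_resolution\<close>).\<close>

definition dil :: "(real^'d::finite \<Rightarrow> complex) \<Rightarrow> nat \<Rightarrow> real^'d \<Rightarrow> complex" where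
  "dil \<phi> N = (\<lambda>x. \<phi> ((2 powr (- real N)) *\<^sub>R x))"

text \<open>Convolution kernel of the multiplier \<eta>, normalised so that its inverse transform
  without prefactor is \<eta>. The forward transform occurs because the kernel acts on the test
  function side, where arguments are reflected.\<close>

definition conv_kernel :: "(real^'d::finite \<Rightarrow> complex) \<Rightarrow> real^'d \<Rightarrow> complex" where
  "conv_kernel \<eta> = (\<lambda>x. of_real (1 / (2 * pi) ^ CARD('d)) * FT \<eta> x)"

text \<open>The classical convolution formula for the inverse transform of \<phi>_j F T at the point
  y, with T acting in the variable x.\<close>

definition block_fun :: "(real^'d::finite \<Rightarrow> complex) \<Rightarrow> nat \<Rightarrow> 'd functional \<Rightarrow> real^'d \<Rightarrow> complex" where
  "block_fun \<phi> j T = (\<lambda>y. T (\<lambda>x. conv_kernel (resolution \<phi> j) (x - y)))"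

lemma generator_test_function:
  fixes \<phi> :: "real^'d::finite \<Rightarrow> complex"
  assumes "resolution_generator \<phi>"
  shows "\<phi> \<in> test_functions"
proof (rule test_functionI[of _ 2])
  show "smooth \<phi>" using assms by (simp add: resolution_generator_def schwartz_smooth)
  fix x :: "real^'d" assume "2 < norm x"
  then have "x \<notin> closure {x. \<phi> x \<noteq> 0}" using assms by (auto simp: resolution_generator_def)
  then show "\<phi> x = 0" using closure_subset[of "{x. \<phi> x \<noteq> 0}"] by blast
qed

lemma generator_zero: "resolution_generator \<phi> \<Longrightarrow> 2 < norm x \<Longrightarrow> \<phi> x = 0"
  using closure_subset[of "{x. \<phi> x \<noteq> 0}"] by (fastforce simp: resolution_generator_def)

lemma generator_one: "resolution_generator \<phi> \<Longrightarrow> norm x \<le> 1 \<Longrightarrow> \<phi> x = 1"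
  by (simp add: resolution_generator_def)

lemma dil_test_function: "\<phi> \<in> test_functions \<Longrightarrow> dil \<phi> N \<in> test_functions"
  unfolding dil_def using test_function_affine[of \<phi> "2 powr (- real N)" 0] by simp

lemma resolution_0: "resolution \<phi> 0 = dil \<phi> 0"
  by (auto simp: resolution_def dil_def)

lemma resolution_Suc: "resolution \<phi> (Suc j) = (\<lambda>x. dil \<phi> (Suc j) x - dil \<phi> j x)"
  by (auto simp: resolution_def dil_def)

lemma resolution_test_function:
  assumes "\<phi> \<in> test_functions"
  shows "resolution \<phi> j \<in> test_functions"
proof (cases j)
  case 0
  then show ?thesis using dil_test_function[OF assms] by (simp add: resolution_0)
next
  case (Suc n)
  have "(\<lambda>x. dil \<phi> (Suc n) x + (- 1) * dil \<phi> n x) \<in> test_functions"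
    by (intro test_function_add test_function_mult smooth_const dil_test_function assms)
  then show ?thesis by (simp add: Suc resolution_Suc)
qed

lemma sum_resolution: "(\<Sum>j\<le>N. resolution \<phi> j x) = dil \<phi> N x"
  by (induction N) (auto simp: resolution_0 resolution_Suc)

lemma two_powr_minus: "2 powr (- real n) = 1 / 2 ^ n"
  by (simp add: powr_minus powr_realpow divide_inverse)

text \<open>For |x| \<le> 2^(j+1) the cutoff is 1, and beyond that radius the j-th piece of the
  resolution vanishes. \<open>Suc j\<close> is the smallest index for which the generator's radii 1
  and 2 guarantee this.\<close>

lemma resolution_mult_dil:
  assumes "resolution_generator \<phi>"
  shows "resolution \<phi> j x * dil \<phi> (Suc j) x = resolution \<phi> j x"
proof (cases "norm x \<le> 2 ^ Suc j")
  case True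
  then have "norm ((2 powr (- real (Suc j))) *\<^sub>R x) \<le> 1"
    unfolding two_powr_minus by simp
  then show ?thesis using generator_one[OF assms] by (simp add: dil_def)
next
  case False
  have z: "dil \<phi> i x = 0" if "i \<le> j" for i
  proof -
    have "(2::real) ^ Suc i \<le> 2 ^ Suc j" using that by (intro power_increasing) auto
    also have "\<dots> < norm x" using False by simp
    finally have "2 * 2 ^ i < norm x" by simp
    then have "2 < norm ((2 powr (- real i)) *\<^sub>R x)"
      unfolding two_powr_minus by (simp add: field_simps)
    then show ?thesis using generator_zero[OF assms] by (simp add: dil_def)
  qed
  show ?thesis
    using z by (cases j) (auto simp: resolution_0 resolution_Suc)
qed

lemma schwartz_cmult: "f \<in> schwartz \<Longrightarrow> (\<lambda>x. c * f x) \<in> schwartz"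
  using schwartz_lincomb[of f f c 0] by simp

lemma conv_kernel_schwartz: "\<eta> \<in> test_functions \<Longrightarrow> conv_kernel \<eta> \<in> schwartz"
  unfolding conv_kernel_def by (intro schwartz_cmult FT_schwartz)

lemma conv_kernel_inversion:
  fixes \<eta> :: "real^'d::finite \<Rightarrow> complex"
  assumes "\<eta> \<in> test_functions"
  shows "(\<integral>y. exp (\<i> * of_real (x \<bullet> y)) * conv_kernel \<eta> y \<partial>lborel) = \<eta> x"
proof -
  have "(\<integral>y. exp (\<i> * of_real (x \<bullet> y)) * conv_kernel \<eta> y \<partial>lborel)
      = (\<integral>y. of_real (1 / (2 * pi) ^ CARD('d)) * (exp (\<i> * of_real (x \<bullet> y)) * FT \<eta> y) \<partial>lborel)"
    by (simp add: conv_kernel_def mult_ac)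
  also have "\<dots> = of_real (1 / (2 * pi) ^ CARD('d)) * (of_real ((2 * pi) ^ CARD('d)) * \<eta> x)"
    unfolding integral_mult_right_zero FT_inversion[OF assms] ..
  finally show ?thesis by simp
qed

lemma conv_kernel_integral:
  fixes \<eta> :: "real^'d::finite \<Rightarrow> complex"
  assumes "\<eta> \<in> test_functions"
  shows "(\<integral>y. conv_kernel \<eta> y \<partial>lborel) = \<eta> 0"
  using conv_kernel_inversion[OF assms, of 0] by simp

lemma smear_conv_kernel:
  "smear (conv_kernel \<eta>) s w = (\<lambda>x::real^'d::finite. of_real (1 / (2 * pi) ^ CARD('d)) * smear (FT \<eta>) s w x)"
  unfolding smear_def conv_kernel_def by (simp only: mult.assoc integral_mult_right_zero)

text \<open>On the frequency side this is \<open>resolution_mult_dil\<close>.\<close>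

lemma conv_kernel_reproducing:
  fixes \<phi> :: "real^'d::finite \<Rightarrow> complex"
  assumes "resolution_generator \<phi>"
  shows "smear (conv_kernel (resolution \<phi> j)) (\<lambda>y. y) (conv_kernel (dil \<phi> (Suc j))) = conv_kernel (resolution \<phi> j)"
proof -
  note t = generator_test_function[OF assms]
  have "smear (FT (resolution \<phi> j)) (\<lambda>y. y) (conv_kernel (dil \<phi> (Suc j))) = FT (resolution \<phi> j)"
    unfolding FT_smear[OF resolution_test_function[OF t] schwartz_integrable[OF conv_kernel_schwartz[OF dil_test_function[OF t]]]]
      conv_kernel_inversion[OF dil_test_function[OF t]] resolution_mult_dil[OF assms] ..
  then show ?thesis
    unfolding smear_conv_kernel by (simp only: conv_kernel_def[of "resolution \<phi> j"])
qed

text \<open>The kernels of all cutoffs are rescalings of a single Schwartz function, which makes the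
  constant in Nikol'skij's inequality independent of j.\<close>

lemma conv_kernel_dil:
  fixes \<phi> :: "real^'d::finite \<Rightarrow> complex"
  assumes "\<phi> \<in> test_functions"
  shows "conv_kernel (dil \<phi> N) x = of_real ((2 ^ N) ^ CARD('d)) * conv_kernel \<phi> (2 ^ N *\<^sub>R x)"
proof -
  have [measurable]: "\<phi> \<in> borel_measurable borel" by (rule test_function_measurable[OF assms])
  have p: "2 powr (- real N) = 1 / 2 ^ N" by (simp add: powr_minus powr_realpow field_simps)
  have "FT (dil \<phi> N) x = (\<integral>\<xi>. exp (- \<i> * of_real (x \<bullet> \<xi>)) * \<phi> ((1 / 2 ^ N) *\<^sub>R \<xi>) \<partial>lborel)"
    by (simp add: FT_def dil_def p)
  also have "\<dots> = (\<bar>2 ^ N\<bar> ^ DIM(real^'d)) *\<^sub>R (\<integral>\<xi>. exp (- \<i> * of_real (x \<bullet> (0 + 2 ^ N *\<^sub>R \<xi>))) * \<phi> ((1 / 2 ^ N) *\<^sub>R (0 + 2 ^ N *\<^sub>R \<xi>)) \<partial>lborel)"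
    by (rule integral_lborel_affine) auto
  also have "\<dots> = of_real ((2 ^ N) ^ CARD('d)) * FT \<phi> (2 ^ N *\<^sub>R x)"
    by (simp add: FT_def scaleR_conv_of_real[where 'a=complex])
  finally show ?thesis by (simp add: conv_kernel_def)
qed

lemma sum_conv_kernel_resolution:
  fixes \<phi> :: "real^'d::finite \<Rightarrow> complex"
  assumes "\<phi> \<in> test_functions"
  shows "(\<Sum>j\<le>N. conv_kernel (resolution \<phi> j) x) = conv_kernel (dil \<phi> N) x"
proof -
  have "(\<Sum>j\<le>N. FT (resolution \<phi> j) x) = (\<integral>\<xi>. (\<Sum>j\<le>N. exp (- \<i> * of_real (x \<bullet> \<xi>)) * resolution \<phi> j \<xi>) \<partial>lborel)"
    unfolding FT_def
    using integrable_exp_mult[OF schwartz_integrable[OF test_function_schwartz[OF resolution_test_function[OF assms]]]]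
    by (subst Bochner_Integration.integral_sum) auto
  also have "\<dots> = FT (dil \<phi> N) x"
    by (simp add: FT_def sum_resolution[symmetric] sum_distrib_left)
  finally show ?thesis unfolding conv_kernel_def sum_distrib_left[symmetric] by (simp only:)
qed

lemma fourier_eq_FT:
  fixes f :: "real^'d::finite \<Rightarrow> complex"
  assumes [measurable]: "f \<in> borel_measurable borel"
  shows "fourier f x = of_real ((2 * pi) powr (- real CARD('d) / 2)) * FT f x"
  unfolding fourier_def FT_def by (subst integral_completion) (auto simp: inner_commute)

lemma frequency_block_eq:
  fixes \<phi> :: "real^'d::finite \<Rightarrow> complex"
  assumes "\<phi> \<in> test_functions" "\<psi> \<in> schwartz"
  shows "frequency_block \<phi> j T \<psi> = T (smear (conv_kernel (resolution \<phi> j)) (\<lambda>y. y) \<psi>)"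
proof -
  let ?a = "complex_of_real ((2 * pi) powr (- real CARD('d) / 2))"
  let ?I = "\<lambda>\<xi>. \<integral>y. exp (\<i> * of_real (\<xi> \<bullet> y)) * \<psi> y \<partial>lborel"
  note res = resolution_test_function[OF assms(1), of j]
  note [measurable] = schwartz_measurable[OF assms(2)] test_function_measurable[OF res]
  have inv: "inv_fourier \<psi> \<xi> = ?a * ?I \<xi>" for \<xi>
    unfolding inv_fourier_def by (subst integral_completion) auto
  \<comment> \<open>The symmetric normalisations of the two transforms multiply to the factor
    contained in \<open>conv_kernel\<close>.\<close>
  have aa: "?a * ?a = of_real (1 / (2 * pi) ^ CARD('d))"
  proof -
    have "(2 * pi) powr (- real CARD('d) / 2) * (2 * pi) powr (- real CARD('d) / 2) = (2 * pi) powr (- real CARD('d))"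
      unfolding powr_add[symmetric] by (rule arg_cong) simp
    also have "\<dots> = 1 / (2 * pi) ^ CARD('d)"
      unfolding powr_minus by (subst powr_realpow) (auto simp: divide_inverse)
    finally show ?thesis unfolding of_real_mult[symmetric] by (rule arg_cong)
  qed
  have "fourier (\<lambda>x. resolution \<phi> j x * inv_fourier \<psi> x) x = smear (conv_kernel (resolution \<phi> j)) (\<lambda>y. y) \<psi> x" for x
  proof -
    have "fourier (\<lambda>x. resolution \<phi> j x * inv_fourier \<psi> x) x = ?a * FT (\<lambda>x. resolution \<phi> j x * inv_fourier \<psi> x) x"
      by (rule fourier_eq_FT) (unfold inv, measurable)
    also have "\<dots> = ?a * (\<integral>\<xi>. ?a * (exp (- \<i> * of_real (x \<bullet> \<xi>)) * (resolution \<phi> j \<xi> * ?I \<xi>)) \<partial>lborel)"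
      unfolding FT_def inv by (simp add: mult_ac)
    also have "\<dots> = (?a * ?a) * FT (\<lambda>\<xi>. resolution \<phi> j \<xi> * ?I \<xi>) x"
      unfolding integral_mult_right_zero FT_def by (simp add: mult_ac)
    also have "\<dots> = smear (conv_kernel (resolution \<phi> j)) (\<lambda>y. y) \<psi> x"
      unfolding aa smear_conv_kernel FT_smear[OF res schwartz_integrable[OF assms(2)]] ..
    finally show ?thesis .
  qed
  then have "fourier (\<lambda>x. resolution \<phi> j x * inv_fourier \<psi> x) = smear (conv_kernel (resolution \<phi> j)) (\<lambda>y. y) \<psi>"
    by (rule ext)
  then show ?thesis
    by (simp add: frequency_block_def distr_inv_fourier_def distr_mult_def distr_fourier_def)
qed

lemma block_fun_integral:
  assumes "resolution_generator \<phi>" "tempered T" "\<psi> \<in> test_functions"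
  shows "frequency_block \<phi> j T \<psi> = (\<integral>y. block_fun \<phi> j T y * \<psi> y \<partial>lborel)"
proof -
  note t = generator_test_function[OF assms(1)] test_function_schwartz[OF assms(3)]
  show ?thesis
    unfolding frequency_block_eq[OF t] block_fun_def
    by (rule tempered_smear_integral(2)[OF assms(2) conv_kernel_schwartz[OF resolution_test_function[OF t(1)]] schwartz_rapid[OF t(2)]])
qed

lemma block_fun_continuous:
  assumes "resolution_generator \<phi>" "tempered T"
  shows "continuous_on UNIV (block_fun \<phi> j T)"
  unfolding block_fun_def
  by (intro tempered_translate_continuous[OF assms(2)] conv_kernel_schwartz resolution_test_function generator_test_function assms)

lemma block_fun_growth:
  assumes "resolution_generator \<phi>" "tempered T"
  obtains C K where "C \<ge> 0" "\<And>y. norm (block_fun \<phi> j T y) \<le> C * (1 + norm y) ^ K"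
  using tempered_translate_growth[OF assms(2) conv_kernel_schwartz[OF resolution_test_function[OF generator_test_function[OF assms(1)]]]]
  unfolding block_fun_def by metis

text \<open>The kernel translated by y is itself a smear by \<open>conv_kernel_reproducing\<close>,
  and T moves under the integral. The smearing kernel is written as a rescaled
  \<open>conv_kernel \<phi>\<close> so that one decay constant serves all j.\<close>

lemma block_fun_reproducing:
  fixes \<phi> :: "real^'d::finite \<Rightarrow> complex"
  assumes "resolution_generator \<phi>" "tempered T"
  shows "block_fun \<phi> j T y = (\<integral>z. block_fun \<phi> j T (y + z) * (of_real ((2 ^ Suc j) ^ CARD('d)) * conv_kernel \<phi> (2 ^ Suc j *\<^sub>R z)) \<partial>lborel)"
proof -
  note t = generator_test_function[OF assms(1)]
  let ?k = "conv_kernel (resolution \<phi> j)" and ?w = "conv_kernel (dil \<phi> (Suc j))"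
  have k: "?k \<in> schwartz" by (intro conv_kernel_schwartz resolution_test_function t)
  have w: "?w \<in> schwartz" by (intro conv_kernel_schwartz dil_test_function t)
  have "(\<lambda>x. ?k (x - y)) = smear (\<lambda>x. ?k (x - y)) (\<lambda>z. z) ?w"
  proof
    fix x
    have "?k (x - y) = smear ?k (\<lambda>z. z) ?w (x - y)" unfolding conv_kernel_reproducing[OF assms(1)] ..
    then show "?k (x - y) = smear (\<lambda>x. ?k (x - y)) (\<lambda>z. z) ?w x"
      by (simp add: smear_def algebra_simps)
  qed
  then have "block_fun \<phi> j T y = T (smear (\<lambda>x. ?k (x - y)) (\<lambda>z. z) ?w)" by (simp add: block_fun_def)
  also have "\<dots> = (\<integral>z. T (\<lambda>x. ?k (x - z - y)) * ?w z \<partial>lborel)"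
    by (rule tempered_smear_integral(2)[OF assms(2) schwartz_translate[OF k] schwartz_rapid[OF w]])
  also have "\<dots> = (\<integral>z. block_fun \<phi> j T (y + z) * ?w z \<partial>lborel)"
    by (simp add: block_fun_def algebra_simps)
  finally show ?thesis unfolding conv_kernel_dil[OF t] .
qed

text \<open>The kernels of the blocks up to N add up to that of the cutoff
  \<open>dil \<phi> N\<close>, an approximate identity. Applied to \<psi> it is a smear of \<psi>
  itself along the dilations z / 2^N, which shrink to 0.\<close>

lemma block_sum_tendsto:
  fixes \<phi> :: "real^'d::finite \<Rightarrow> complex"
  assumes "resolution_generator \<phi>" "tempered T" "\<psi> \<in> test_functions"
  shows "(\<lambda>N. \<Sum>j\<le>N. \<integral>y. block_fun \<phi> j T y * \<psi> y \<partial>lborel) \<longlonglongrightarrow> T \<psi>"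
proof -
  note t = generator_test_function[OF assms(1)]
  note \<psi> = test_function_schwartz[OF assms(3)]
  have k: "conv_kernel (resolution \<phi> j) \<in> schwartz" for j by (intro conv_kernel_schwartz resolution_test_function t)
  have K: "conv_kernel \<phi> \<in> schwartz" by (intro conv_kernel_schwartz t)
  note [measurable] = schwartz_measurable[OF \<psi>] schwartz_measurable[OF K]
  have sm: "smear (conv_kernel (resolution \<phi> j)) (\<lambda>y. y) \<psi> \<in> schwartz" for j
    by (rule smear_schwartz[OF k _ schwartz_rapid[OF \<psi>]]) auto
  have "(\<Sum>j\<le>N. \<integral>y. block_fun \<phi> j T y * \<psi> y \<partial>lborel) = T (smear \<psi> (\<lambda>z. (1 / 2 ^ N) *\<^sub>R z) (conv_kernel \<phi>))" for N
  proof -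
    have "(\<Sum>j\<le>N. \<integral>y. block_fun \<phi> j T y * \<psi> y \<partial>lborel) = (\<Sum>j\<le>N. 1 * T (smear (conv_kernel (resolution \<phi> j)) (\<lambda>y. y) \<psi>))"
      by (simp add: block_fun_integral[OF assms, symmetric] frequency_block_eq[OF t \<psi>])
    also have "\<dots> = T (\<lambda>x. \<Sum>j\<le>N. 1 * smear (conv_kernel (resolution \<phi> j)) (\<lambda>y. y) \<psi> x)"
      by (rule tempered_sum[OF assms(2), THEN conjunct2, symmetric]) (auto intro: sm)
    also have "(\<lambda>x. \<Sum>j\<le>N. 1 * smear (conv_kernel (resolution \<phi> j)) (\<lambda>y. y) \<psi> x) = smear \<psi> (\<lambda>z. (1 / 2 ^ N) *\<^sub>R z) (conv_kernel \<phi>)"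
    proof
      fix x
      have "(\<Sum>j\<le>N. 1 * smear (conv_kernel (resolution \<phi> j)) (\<lambda>y. y) \<psi> x) = (\<integral>y. (\<Sum>j\<le>N. conv_kernel (resolution \<phi> j) (x - y) * \<psi> y) \<partial>lborel)"
        unfolding smear_def using smear_integrable[OF k _ schwartz_rapid[OF \<psi>], of "\<lambda>y. y"]
        by (subst Bochner_Integration.integral_sum) auto
      also have "\<dots> = (\<integral>y. of_real ((2 ^ N) ^ CARD('d)) * (conv_kernel \<phi> (2 ^ N *\<^sub>R (x - y)) * \<psi> y) \<partial>lborel)"
        unfolding sum_distrib_right[symmetric] sum_conv_kernel_resolution[OF t] conv_kernel_dil[OF t] by (simp only: mult.assoc)
      also have "\<dots> = of_real ((2 ^ N) ^ CARD('d)) * (\<integral>y. conv_kernel \<phi> (2 ^ N *\<^sub>R (x - y)) * \<psi> y \<partial>lborel)"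
        by (rule integral_mult_right_zero)
      \<comment> \<open>The substitution y = x - z / 2^N moves the dilation from the kernel into the
        argument of \<psi>, so that kernel and weight no longer depend on N.\<close>
      also have "(\<integral>y. conv_kernel \<phi> (2 ^ N *\<^sub>R (x - y)) * \<psi> y \<partial>lborel)
          = (\<bar>- (1 / 2 ^ N)\<bar> ^ DIM(real^'d)) *\<^sub>R (\<integral>z. conv_kernel \<phi> (2 ^ N *\<^sub>R (x - (x + (- (1 / 2 ^ N)) *\<^sub>R z))) * \<psi> (x + (- (1 / 2 ^ N)) *\<^sub>R z) \<partial>lborel)"
        by (rule integral_lborel_affine) auto
      also have "of_real ((2 ^ N) ^ CARD('d)) * \<dots> = smear \<psi> (\<lambda>z. (1 / 2 ^ N) *\<^sub>R z) (conv_kernel \<phi>) x"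
        by (simp add: smear_def scaleR_conv_of_real[where 'a=complex] power_one_over mult.commute)
      finally show "(\<Sum>j\<le>N. 1 * smear (conv_kernel (resolution \<phi> j)) (\<lambda>y. y) \<psi> x) = smear \<psi> (\<lambda>z. (1 / 2 ^ N) *\<^sub>R z) (conv_kernel \<phi>) x" .
    qed
    finally show ?thesis .
  qed
  moreover have "(\<lambda>N. T (smear \<psi> (\<lambda>z. (1 / 2 ^ N) *\<^sub>R z) (conv_kernel \<phi>))) \<longlonglongrightarrow> T (smear \<psi> (\<lambda>z. 0) (conv_kernel \<phi>))"
  proof (rule tempered_smear_tendsto[OF assms(2) \<psi> schwartz_rapid[OF K]])
    show "norm ((1 / 2 ^ N) *\<^sub>R z) \<le> 2 * norm z" for N and z :: "real^'d"
    proof -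
      have "1 / 2 ^ N \<le> (2::real)" by (rule order.trans[of _ 1]) simp_all
      then have "1 / 2 ^ N * norm z \<le> 2 * norm z" by (rule mult_right_mono) simp
      then show ?thesis by simp
    qed
    show "(\<lambda>N. (1 / 2 ^ N) *\<^sub>R z) \<longlonglongrightarrow> 0" for z :: "real^'d"
    proof -
      have "(\<lambda>N. (1 / 2) ^ N *\<^sub>R z) \<longlonglongrightarrow> 0 *\<^sub>R z"
        by (intro tendsto_scaleR tendsto_const LIMSEQ_realpow_zero) auto
      then show ?thesis by (simp add: power_one_over)
    qed
  qed auto
  \<comment> \<open>Without a shift the smear is \<psi> times the integral of the kernel, and that
    integral is \<phi> 0 = 1.\<close>
  moreover have "smear \<psi> (\<lambda>z. 0) (conv_kernel \<phi>) = \<psi>"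
    by (auto simp: smear_def conv_kernel_integral[OF t] generator_one[OF assms(1)])
  ultimately show ?thesis by simp
qed

section \<open>Uniqueness of the representing function\<close>

text \<open>Representatives are Lebesgue measurable, whereas Fubini and affine substitution are
  carried out for Borel functions; modification on a null set bridges this.\<close>

lemma borel_measurable_lebesgue_ex_borel:
  fixes g :: "'a::euclidean_space \<Rightarrow> complex"
  assumes "g \<in> borel_measurable lebesgue"
  obtains g' where "g' \<in> borel_measurable borel" "AE x in lborel. g x = g' x"
proof -
  have "(\<lambda>x. Re (g x)) \<in> borel_measurable lebesgue" "(\<lambda>x. Im (g x)) \<in> borel_measurable lebesgue"
    using assms by measurable
  then obtain u v where u: "u \<in> borel_measurable lborel" "AE x in lborel. Re (g x) = u x"
    and v: "v \<in> borel_measurable lborel" "AE x in lborel. Im (g x) = v x"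
    using completion_ex_borel_measurable_real by metis
  have "AE x in lborel. g x = Complex (u x) (v x)"
    using u(2) v(2) by eventually_elim (simp add: complex_eq_iff)
  moreover have "(\<lambda>x. Complex (u x) (v x)) \<in> borel_measurable borel"
    using u(1) v(1) by (simp add: Complex_eq)
  ultimately show ?thesis using that by blast
qed

lemma locally_integrable_measurable:
  fixes g :: "real^'d::finite \<Rightarrow> complex"
  assumes "locally_integrable g"
  shows "g \<in> borel_measurable lebesgue"
proof (rule borel_measurable_LIMSEQ_metric)
  show "(\<lambda>x. indicat_real (cball 0 (real n)) x *\<^sub>R g x) \<in> borel_measurable lebesgue" for n
    using assms unfolding locally_integrable_def set_integrable_def
    by (intro borel_measurable_integrable) auto
  show "(\<lambda>n. indicat_real (cball 0 (real n)) x *\<^sub>R g x) \<longlonglongrightarrow> g x" for x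
  proof (rule tendsto_eventually)
    obtain N where "norm x \<le> real N" using real_arch_simple by blast
    then show "\<forall>\<^sub>F n in sequentially. indicat_real (cball 0 (real n)) x *\<^sub>R g x = g x"
      by (intro eventually_sequentiallyI[of N]) (auto simp: indicator_def)
  qed
qed

lemma locally_integrable_cong_AE:
  fixes g g' :: "real^'d::finite \<Rightarrow> complex"
  assumes "g' \<in> borel_measurable borel" "AE x in lborel. g x = g' x" "locally_integrable g"
  shows "compact K \<Longrightarrow> set_integrable lborel K g'"
proof -
  assume K: "compact K"
  have K': "K \<in> sets borel" using K by (intro borel_closed compact_imp_closed)
  have m: "(\<lambda>x. indicat_real K x *\<^sub>R g' x) \<in> borel_measurable lborel"
    using assms(1) K' by (intro borel_measurable_scaleR borel_measurable_indicator) auto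
  have "set_integrable lebesgue K g" using assms(3) K by (simp add: locally_integrable_def)
  then have "integrable lebesgue (\<lambda>x. indicat_real K x *\<^sub>R g' x)"
    unfolding set_integrable_def
  proof (rule integrable_cong_AE_imp)
    show "(\<lambda>x. indicat_real K x *\<^sub>R g' x) \<in> borel_measurable lebesgue"
      using m by (rule measurable_completion)
    show "AE x in lebesgue. indicat_real K x *\<^sub>R g x = indicat_real K x *\<^sub>R g' x"
      using AE_completion[OF assms(2)] by eventually_elim simp
  qed
  then show "set_integrable lborel K g'"
    unfolding set_integrable_def integrable_completion[OF m] .
qed

lemma integral_test_lebesgue_eq:
  fixes g g' :: "real^'d::finite \<Rightarrow> complex"
  assumes "g' \<in> borel_measurable borel" "AE x in lborel. g x = g' x" "g \<in> borel_measurable lebesgue"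
    and [measurable]: "\<psi> \<in> borel_measurable borel"
  shows "(LINT x|lebesgue. g x * \<psi> x) = (\<integral>x. g' x * \<psi> x \<partial>lborel)"
proof -
  note [measurable] = assms(1)
  have p: "\<psi> \<in> borel_measurable lebesgue" by (intro measurable_completion) measurable
  have m: "(\<lambda>x. g' x * \<psi> x) \<in> borel_measurable lborel" by measurable
  have "(LINT x|lebesgue. g x * \<psi> x) = (LINT x|lebesgue. g' x * \<psi> x)"
  proof (rule integral_cong_AE)
    show "AE x in lebesgue. g x * \<psi> x = g' x * \<psi> x"
      using AE_completion[OF assms(2)] by eventually_elim simp
    show "(\<lambda>x. g x * \<psi> x) \<in> borel_measurable lebesgue" using assms(3) p by (rule borel_measurable_times)
    show "(\<lambda>x. g' x * \<psi> x) \<in> borel_measurable lebesgue" using m by (rule measurable_completion)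
  qed
  then show ?thesis using integral_completion[OF m] by simp
qed

text \<open>Averages of h over small translates, weighted by \<rho>, are by Fubini superpositions of
  test functions, so g integrates to 0 against them. As the scale shrinks they converge, at points
  of continuity, to h times the integral of \<rho>. Allowing h to be discontinuous on a null set
  admits indicators of boxes.\<close>

lemma mollified_integral_zero:
  fixes g \<rho> :: "real^'d::finite \<Rightarrow> complex"
  assumes gm: "g \<in> borel_measurable borel" and gi: "\<And>K. compact K \<Longrightarrow> set_integrable lborel K g"
    and zero: "\<And>\<psi>. \<psi> \<in> test_functions \<Longrightarrow> (\<integral>x. g x * \<psi> x \<partial>lborel) = 0"
    and \<rho>: "\<rho> \<in> test_functions"
    and h: "h \<in> borel_measurable borel" "\<And>x. norm (h x) \<le> 1" "\<And>x. norm x > R \<Longrightarrow> h x = 0"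
    and cont: "AE x in lborel. isCont h x"
  shows "(\<integral>x. g x * h x \<partial>lborel) * (\<integral>z. \<rho> z \<partial>lborel) = 0"
proof -
  obtain M where M: "M > 0" "\<And>x. norm x > M \<Longrightarrow> \<rho> x = 0" using test_function_support[OF \<rho>] by metis
  obtain B where B: "\<And>x. norm (\<rho> x) \<le> B" using schwartz_bounded[OF test_function_schwartz[OF \<rho>]] by metis
  note [measurable] = gm h(1) test_function_measurable[OF \<rho>]
  \<comment> \<open>The scales \<open>c n\<close> are at most 1, so copies of \<rho> centred at
    points of norm at most R vanish outside this ball, and truncating g to it changes
    nothing.\<close>
  define R' where "R' = \<bar>R\<bar> + M"
  define G where "G x = indicat_real (cball 0 R') x *\<^sub>R g x" for x
  have G: "integrable lborel G" using gi[of "cball 0 R'"] by (simp add: set_integrable_def G_def[abs_def])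
  have [measurable]: "G \<in> borel_measurable borel" using borel_measurable_integrable[OF G] by simp
  have hint: "integrable lborel h"
  proof (rule Bochner_Integration.integrable_bound)
    show "integrable lborel (\<lambda>x. indicat_real (cball 0 \<bar>R\<bar>) x)"
      by (rule integrable_real_indicator) (use emeasure_bounded_finite[of "cball 0 \<bar>R\<bar>"] in auto)
    show "AE x in lborel. norm (h x) \<le> norm (indicat_real (cball 0 \<bar>R\<bar>) x)"
      using h(2,3) by (intro AE_I2) (auto simp: indicator_def)
  qed measurable
  define c where "c n = inverse (real (Suc n))" for n
  have c: "c n > 0" "c n \<le> 1" "c \<longlonglongrightarrow> 0" for n
    unfolding c_def using LIMSEQ_inverse_real_of_nat by (auto simp: inverse_le_1_iff)
  have z: "(\<integral>x. (\<integral>z. \<rho> z * h (x + c n *\<^sub>R z) \<partial>lborel) * G x \<partial>lborel) = 0" for n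
  proof -
    let ?e = "1 / c n"
    have sub: "(\<integral>z. \<rho> z * h (x + c n *\<^sub>R z) \<partial>lborel) = of_real (\<bar>?e\<bar> ^ CARD('d)) * (\<integral>y. \<rho> (?e *\<^sub>R (y - x)) * h y \<partial>lborel)" for x
    proof -
      have "(\<integral>z. \<rho> z * h (x + c n *\<^sub>R z) \<partial>lborel) = (\<bar>?e\<bar> ^ DIM(real^'d)) *\<^sub>R (\<integral>y. \<rho> ((- ?e) *\<^sub>R x + ?e *\<^sub>R y) * h (x + c n *\<^sub>R ((- ?e) *\<^sub>R x + ?e *\<^sub>R y)) \<partial>lborel)"
        using c(1)[of n] by (intro integral_lborel_affine) auto
      also have "(\<lambda>y. \<rho> ((- ?e) *\<^sub>R x + ?e *\<^sub>R y) * h (x + c n *\<^sub>R ((- ?e) *\<^sub>R x + ?e *\<^sub>R y))) = (\<lambda>y. \<rho> (?e *\<^sub>R (y - x)) * h y)"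
        using c(1)[of n] by (simp add: scaleR_add_right scaleR_diff_right)
      finally show ?thesis by (simp add: scaleR_conv_of_real[where 'a=complex])
    qed
    have inner: "(\<integral>x. \<rho> (?e *\<^sub>R (y - x)) * G x \<partial>lborel) * h y = 0" for y
    proof (cases "norm y > R")
      case False
      have "\<rho> (?e *\<^sub>R (y - x)) * G x = g x * \<rho> ((- ?e) *\<^sub>R x + ?e *\<^sub>R y)" for x
      proof (cases "norm x \<le> R'")
        case False
        then have "norm x > \<bar>R\<bar> + M" by (simp add: R'_def)
        moreover have "norm x \<le> norm y + norm (y - x)" by (metis norm_minus_commute norm_triangle_sub)
        ultimately have "norm (y - x) > M" using \<open>\<not> norm y > R\<close> by linarith
        moreover have "norm (y - x) \<le> norm (?e *\<^sub>R (y - x))"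
          using c(1,2)[of n] by (simp add: mult_left_le_one_le le_divide_eq mult_left_le)
        ultimately have "\<rho> (?e *\<^sub>R (y - x)) = 0" by (intro M(2)) linarith
        then show ?thesis by (simp add: scaleR_diff_right)
      qed (simp add: G_def scaleR_diff_right)
      moreover have "(\<lambda>x. \<rho> ((- ?e) *\<^sub>R x + ?e *\<^sub>R y)) \<in> test_functions"
        using c(1)[of n] by (intro test_function_affine \<rho>) simp
      ultimately show ?thesis using zero by simp
    qed (use h(3) in simp)
    \<comment> \<open>Division by |B| + 1 brings the kernel below 1, as
      \<open>fubini_bounded_kernel\<close> demands.\<close>
    have "(\<integral>x. (\<integral>y. (\<rho> (?e *\<^sub>R (y - x)) / of_real (\<bar>B\<bar> + 1)) * h y \<partial>lborel) * G x \<partial>lborel)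
        = (\<integral>y. (\<integral>x. (\<rho> (?e *\<^sub>R (y - x)) / of_real (\<bar>B\<bar> + 1)) * G x \<partial>lborel) * h y \<partial>lborel)"
    proof (rule fubini_bounded_kernel[OF G hint])
      show "norm (\<rho> (?e *\<^sub>R (y - x)) / of_real (\<bar>B\<bar> + 1)) \<le> 1" for x y
      proof -
        have "0 < \<bar>B\<bar> + 1" "norm (\<rho> (?e *\<^sub>R (y - x))) \<le> \<bar>B\<bar> + 1"
          using B[of "?e *\<^sub>R (y - x)"] by linarith+
        then show ?thesis by (simp add: norm_divide del: of_real_add)
      qed
    qed measurable
    also have "\<dots> = (\<integral>y. ((\<integral>x. \<rho> (?e *\<^sub>R (y - x)) * G x \<partial>lborel) * h y) / of_real (\<bar>B\<bar> + 1) \<partial>lborel)"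
      by (simp add: field_simps)
    also have "\<dots> = 0" unfolding inner by simp
    finally have "(\<integral>x. (\<integral>y. \<rho> (?e *\<^sub>R (y - x)) * h y \<partial>lborel) * G x \<partial>lborel) / of_real (\<bar>B\<bar> + 1) = 0"
      by (simp add: field_simps)
    moreover have "complex_of_real (\<bar>B\<bar> + 1) \<noteq> 0" unfolding of_real_eq_0_iff by linarith
    ultimately have "(\<integral>x. (\<integral>y. \<rho> (?e *\<^sub>R (y - x)) * h y \<partial>lborel) * G x \<partial>lborel) = 0" by (simp del: of_real_add)
    then show ?thesis unfolding sub mult.assoc integral_mult_right_zero by simp
  qed
  define D where "D = (\<integral>z. norm (\<rho> z) \<partial>lborel)"
  have \<rho>i: "integrable lborel \<rho>" by (rule schwartz_integrable[OF test_function_schwartz[OF \<rho>]])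
  have bd: "norm (\<integral>z. \<rho> z * h (x + c n *\<^sub>R z) \<partial>lborel) \<le> D" for x n
  proof -
    have "norm (\<integral>z. \<rho> z * h (x + c n *\<^sub>R z) \<partial>lborel) \<le> (\<integral>z. norm (\<rho> z * h (x + c n *\<^sub>R z)) \<partial>lborel)"
      by (rule integral_norm_bound)
    also have "\<dots> \<le> D" unfolding D_def
    proof (rule integral_mono)
      show "integrable lborel (\<lambda>z. norm (\<rho> z * h (x + c n *\<^sub>R z)))"
        using integrable_bounded_mult[OF \<rho>i, of "\<lambda>z. h (x + c n *\<^sub>R z)" 1] h(2)
        by (intro integrable_norm) (simp add: mult.commute)
      show "norm (\<rho> z * h (x + c n *\<^sub>R z)) \<le> norm (\<rho> z)" for z
        using mult_left_mono[OF h(2)[of "x + c n *\<^sub>R z"], of "norm (\<rho> z)"] by (simp add: norm_mult)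
    qed (use \<rho>i in simp)
    finally show ?thesis .
  qed
  have "(\<lambda>n. \<integral>x. (\<integral>z. \<rho> z * h (x + c n *\<^sub>R z) \<partial>lborel) * G x \<partial>lborel) \<longlonglongrightarrow> (\<integral>x. (\<integral>z. \<rho> z * h x \<partial>lborel) * G x \<partial>lborel)"
  proof (rule integral_dominated_convergence)
    show "integrable lborel (\<lambda>x. D * norm (G x))" using G by simp
    show "AE x in lborel. norm ((\<integral>z. \<rho> z * h (x + c n *\<^sub>R z) \<partial>lborel) * G x) \<le> D * norm (G x)" for n
      by (intro AE_I2) (simp add: norm_mult mult_right_mono bd)
    show "AE x in lborel. (\<lambda>n. (\<integral>z. \<rho> z * h (x + c n *\<^sub>R z) \<partial>lborel) * G x) \<longlonglongrightarrow> (\<integral>z. \<rho> z * h x \<partial>lborel) * G x"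
      using cont
    proof eventually_elim
      case (elim x)
      have "(\<lambda>n. \<integral>z. \<rho> z * h (x + c n *\<^sub>R z) \<partial>lborel) \<longlonglongrightarrow> (\<integral>z. \<rho> z * h x \<partial>lborel)"
      proof (rule integral_dominated_convergence)
        show "integrable lborel (\<lambda>z. norm (\<rho> z))" using \<rho>i by simp
        show "AE z in lborel. norm (\<rho> z * h (x + c n *\<^sub>R z)) \<le> norm (\<rho> z)" for n
          using mult_left_mono[OF h(2)] by (intro AE_I2) (force simp: norm_mult)
        show "AE z in lborel. (\<lambda>n. \<rho> z * h (x + c n *\<^sub>R z)) \<longlonglongrightarrow> \<rho> z * h x"
        proof (intro AE_I2 tendsto_mult tendsto_const)
          fix z
          have "(\<lambda>n. x + c n *\<^sub>R z) \<longlonglongrightarrow> x + 0 *\<^sub>R z" by (intro tendsto_intros c)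
          then show "(\<lambda>n. h (x + c n *\<^sub>R z)) \<longlonglongrightarrow> h x" using isCont_tendsto_compose[OF elim] by simp
        qed
      qed measurable
      then show ?case by (intro tendsto_mult tendsto_const)
    qed
  qed measurable
  then have "(\<integral>x. (\<integral>z. \<rho> z * h x \<partial>lborel) * G x \<partial>lborel) = 0"
    unfolding z using LIMSEQ_unique tendsto_const by blast
  moreover have eq: "(\<integral>z. \<rho> z * h x \<partial>lborel) * G x = (g x * h x) * (\<integral>z. \<rho> z \<partial>lborel)" for x
  proof (cases "norm x \<le> R'")
    case False
    then have "norm x > R" using M(1) by (auto simp: R'_def)
    then show ?thesis using h(3) by simp
  qed (simp add: G_def)
  ultimately show ?thesis unfolding eq integral_mult_left_zero by simp
qed

text \<open>Boxes have negligible frontier, so the integral of g over each of them vanishes. Boxes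
  are an intersection-stable generator of the Borel sets, which extends this to all Borel sets, and
  a density with vanishing integrals is 0 almost everywhere.\<close>

lemma AE_zero_of_test_functions:
  fixes g \<rho> :: "real^'d::finite \<Rightarrow> complex"
  assumes gm: "g \<in> borel_measurable borel" and gi: "\<And>K. compact K \<Longrightarrow> set_integrable lborel K g"
    and zero: "\<And>\<psi>. \<psi> \<in> test_functions \<Longrightarrow> (\<integral>x. g x * \<psi> x \<partial>lborel) = 0"
    and \<rho>: "\<rho> \<in> test_functions" "(\<integral>z. \<rho> z \<partial>lborel) \<noteq> 0"
  shows "AE x in lborel. g x = 0"
proof -
  note [measurable] = gm
  have box: "(\<integral>x. indicat_real (box a b) x *\<^sub>R g x \<partial>lborel) = 0" for a b :: "real^'d"
  proof -
    obtain R where R: "\<And>x. x \<in> box a b \<Longrightarrow> norm x \<le> R" using bounded_box[of a b] by (auto simp: bounded_iff)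
    let ?h = "\<lambda>x. complex_of_real (indicat_real (box a b) x)"
    have "(\<integral>x. g x * ?h x \<partial>lborel) * (\<integral>z. \<rho> z \<partial>lborel) = 0"
    proof (rule mollified_integral_zero[OF gm gi zero \<rho>(1)])
      show "?h x = 0" if "norm x > R" for x using R[of x] that by (auto simp: indicator_def)
      have "negligible (frontier (box a b))" by (rule negligible_convex_frontier) (rule convex_box)
      then have "frontier (box a b) \<in> null_sets lborel"
        by (simp add: null_sets_completion_iff negligible_iff_null_sets)
      then have "AE x in lborel. x \<notin> frontier (box a b)" by (rule AE_not_in)
      then show "AE x in lborel. isCont ?h x"
        by eventually_elim (intro continuous_of_real, simp add: isCont_indicator)
    qed auto
    then show ?thesis using \<rho>(2) by (simp add: scaleR_conv_of_real mult.commute)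
  qed
  \<comment> \<open>As g is only locally integrable, the argument runs on each box of an exhausting
    sequence.\<close>
  have "AE x in lborel. x \<in> box (- (real n *\<^sub>R One)) (real n *\<^sub>R One) \<longrightarrow> g x = 0" for n
  proof -
    let ?B = "box (- (real n *\<^sub>R One)) (real n *\<^sub>R One) :: (real^'d) set"
    define G where "G x = indicat_real ?B x *\<^sub>R g x" for x
    have "set_integrable lborel ?B g"
      by (rule set_integrable_subset[OF gi[OF compact_cbox]]) (auto intro: box_subset_cbox[THEN subsetD])
    then have G: "integrable lborel G" by (simp add: set_integrable_def G_def[abs_def])
    have "(LINT x:A|lborel. G x) = 0" if "A \<in> sets lborel" for A
    proof -
      have mem: "A \<in> sigma_sets UNIV (range (\<lambda>(a, b). box a b :: (real^'d) set))"
        using that by (simp add: borel_eq_box)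
      have stable: "Int_stable (range (\<lambda>(a, b). box a b :: (real^'d) set))"
        by (auto simp: Int_stable_def box_Int_box)
      have sub: "range (\<lambda>(a, b). box a b :: (real^'d) set) \<subseteq> Pow UNIV" by simp
      from stable sub mem show ?thesis
      proof (induction A rule: sigma_sets_induct_disjoint)
        case (basic A)
        then obtain a b :: "real^'d" where A: "A = box a b" by auto
        have "indicat_real A x *\<^sub>R G x = indicat_real (A \<inter> ?B) x *\<^sub>R g x" for x
          by (simp add: G_def indicator_inter_arith)
        then show ?case unfolding set_lebesgue_integral_def A box_Int_box box by (simp add: box box_Int_box A)
      next
        case empty
        show ?case by (simp add: set_lebesgue_integral_def)
      next
        case (compl A)
        then have A: "A \<in> sets borel" by (simp add: borel_eq_box)
        have "indicat_real (UNIV - A) x *\<^sub>R G x = G x - indicat_real A x *\<^sub>R G x" for x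
          by (auto simp: indicator_def)
        moreover have "integrable lborel (\<lambda>x. indicat_real A x *\<^sub>R G x)"
          using A G by (intro integrable_mult_indicator) auto
        moreover have "(\<integral>x. G x \<partial>lborel) = 0" unfolding G_def by (rule box)
        ultimately show ?case using G compl(2) by (simp add: set_lebesgue_integral_def)
      next
        case (union A)
        then have A: "A i \<in> sets lborel" for i by (auto simp: borel_eq_box)
        have "(LINT x:(\<Union>i. A i)|lborel. G x) = (\<Sum>i. LINT x:A i|lborel. G x)"
        proof (rule lebesgue_integral_countable_add[OF A])
          show "A i \<inter> A j = {}" if "i \<noteq> j" for i j using union(1) that by (auto simp: disjoint_family_on_def)
          show "set_integrable lborel (\<Union>i. A i) G"
            unfolding set_integrable_def using A G by (intro integrable_mult_indicator) auto
        qed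
        then show ?case using union(3) by simp
      qed
    qed
    then have "AE x in lborel. G x = 0" by (rule sigma_finite_measure.density_zero[OF sigma_finite_lborel G])
    then show ?thesis by eventually_elim (auto simp: G_def)
  qed
  then have "AE x in lborel. \<forall>n. x \<in> box (- (real n *\<^sub>R One)) (real n *\<^sub>R One) \<longrightarrow> g x = 0"
    unfolding AE_all_countable by (rule allI)
  then show ?thesis
  proof eventually_elim
    case (elim x)
    have "x \<in> (\<Union>i. box (- (real i *\<^sub>R One)) (real i *\<^sub>R One))" unfolding UN_box_eq_UNIV by simp
    then show ?case using elim by blast
  qed
qed

text \<open>The integral of a complex-valued \<phi> may vanish, but |\<phi>|^2 is a test function
  too, nonnegative and positive on a nonempty open set.\<close>

lemma ex_test_function_integral_nonzero:
  fixes \<phi> :: "real^'d::finite \<Rightarrow> complex"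
  assumes "\<phi> \<in> test_functions" "\<phi> 0 = 1"
  shows "\<exists>\<rho> :: real^'d \<Rightarrow> complex. \<rho> \<in> test_functions \<and> (\<integral>z. \<rho> z \<partial>lborel) \<noteq> 0"
proof (intro exI conjI)
  let ?\<rho> = "\<lambda>x. cnj (\<phi> x) * \<phi> x"
  show \<rho>: "?\<rho> \<in> test_functions" by (intro test_function_mult smooth_cnj test_function_smooth assms)
  have eq: "?\<rho> x = of_real ((norm (\<phi> x))\<^sup>2)" for x by (simp only: complex_norm_square mult.commute)
  have int: "integrable lborel (\<lambda>x. (norm (\<phi> x))\<^sup>2)"
    using integrable_Re[OF schwartz_integrable[OF test_function_schwartz[OF \<rho>]]] unfolding eq by simp
  show "(\<integral>z. ?\<rho> z \<partial>lborel) \<noteq> 0"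
  proof
    assume "(\<integral>z. ?\<rho> z \<partial>lborel) = 0"
    then have "(\<integral>z. (norm (\<phi> z))\<^sup>2 \<partial>lborel) = 0" unfolding eq by (simp del: of_real_power)
    then have "AE x in lborel. (norm (\<phi> x))\<^sup>2 = 0"
      using integral_nonneg_eq_0_iff_AE[OF int] by simp
    then have ae: "AE x in lborel. x \<notin> {x. \<phi> x \<noteq> 0}" by eventually_elim simp
    have o: "open {x. \<phi> x \<noteq> 0}"
      using smooth_continuous[OF test_function_smooth[OF assms(1)], of UNIV] by (intro open_Collect_neq continuous_on_const)
    have "{x. \<phi> x \<noteq> 0} \<in> null_sets lborel"
      using ae o by (subst AE_iff_null_sets) auto
    then have "negligible {x. \<phi> x \<noteq> 0}"
      by (simp add: negligible_iff_null_sets null_sets_completionI)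
    then have "{x. \<phi> x \<noteq> 0} = {}" using open_not_negligible[OF o] by blast
    then show False using assms(2) by auto
  qed
qed

section \<open>Dyadic cubes\<close>

lemma measurable_vec_nth [measurable]: "(\<lambda>x::real^'d::finite. x $ i) \<in> borel_measurable borel"
  by (intro borel_measurable_continuous_onI continuous_intros)

text \<open>Floors make measurability immediate and turn membership in a common cube into a
  measurable relation between two points, as the averaging argument below requires.\<close>

lemma mem_dyadic_cube_iff:
  fixes x :: "real^'d::finite"
  shows "x \<in> dyadic_cube j k \<longleftrightarrow> (\<forall>i. \<lfloor>2 powr real_of_int j * x $ i\<rfloor> = k $ i)"
proof -
  have p: "2 powr real_of_int j * 2 powr (- real_of_int j) = 1" by (simp flip: powr_add)
  have "x \<in> dyadic_cube j k \<longleftrightarrow> (\<exists>y. (\<forall>i. 0 \<le> y $ i \<and> y $ i < 1) \<and> x = 2 powr (- real_of_int j) *\<^sub>R (y + (\<chi> i. real_of_int (k $ i))))"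
    by (auto simp: dyadic_cube_def)
  also have "\<dots> \<longleftrightarrow> (\<forall>i. 0 \<le> 2 powr real_of_int j * x $ i - k $ i \<and> 2 powr real_of_int j * x $ i - k $ i < 1)"
  proof (intro iffI)
    assume "\<exists>y. (\<forall>i. 0 \<le> y $ i \<and> y $ i < 1) \<and> x = 2 powr (- real_of_int j) *\<^sub>R (y + (\<chi> i. real_of_int (k $ i)))"
    then obtain y where y: "\<forall>i. 0 \<le> y $ i \<and> y $ i < 1" "x = 2 powr (- real_of_int j) *\<^sub>R (y + (\<chi> i. real_of_int (k $ i)))" by blast
    have "2 powr real_of_int j * x $ i = (2 powr real_of_int j * 2 powr (- real_of_int j)) * (y $ i + k $ i)" for i
      unfolding y(2) by simp
    then show "\<forall>i. 0 \<le> 2 powr real_of_int j * x $ i - k $ i \<and> 2 powr real_of_int j * x $ i - k $ i < 1"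
      using y(1) unfolding p by simp
  next
    assume *: "\<forall>i. 0 \<le> 2 powr real_of_int j * x $ i - k $ i \<and> 2 powr real_of_int j * x $ i - k $ i < 1"
    let ?y = "\<chi> i. 2 powr real_of_int j * x $ i - k $ i"
    have "x = 2 powr (- real_of_int j) *\<^sub>R (?y + (\<chi> i. real_of_int (k $ i)))"
    proof -
      have "2 powr (- real_of_int j) * (2 powr real_of_int j * x $ i) = x $ i" for i
        unfolding mult.assoc[symmetric] mult.commute[of "2 powr (- real_of_int j)"] p by simp
      then show ?thesis by (simp add: vec_eq_iff)
    qed
    with * show "\<exists>y. (\<forall>i. 0 \<le> y $ i \<and> y $ i < 1) \<and> x = 2 powr (- real_of_int j) *\<^sub>R (y + (\<chi> i. real_of_int (k $ i)))"
      by (intro exI[of _ ?y]) auto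
  qed
  also have "\<dots> \<longleftrightarrow> (\<forall>i. \<lfloor>2 powr real_of_int j * x $ i\<rfloor> = k $ i)"
    by (intro iff_allI) (auto simp: floor_eq_iff; linarith)
  finally show ?thesis .
qed

lemma dyadic_cube_borel [measurable]: "dyadic_cube j (k::int^'d::finite) \<in> sets borel"
proof -
  have "dyadic_cube j k = {x \<in> space borel. \<forall>i. \<lfloor>2 powr real_of_int j * x $ i\<rfloor> = k $ i}"
    by (auto simp: mem_dyadic_cube_iff)
  also have "\<dots> \<in> sets borel" by measurable
  finally show ?thesis .
qed

text \<open>The half-open cube is caught between an open and a closed box of equal volume.\<close>

lemma emeasure_dyadic_cube:
  "emeasure lborel (dyadic_cube j (k::int^'d::finite)) = ennreal (2 powr (- real_of_int j * real CARD('d)))"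
proof -
  let ?e = "2 powr (- real_of_int j)"
  let ?a = "?e *\<^sub>R (\<chi> i. real_of_int (k $ i)) :: real^'d"
  let ?b = "?a + ?e *\<^sub>R (\<chi> i. 1)"
  have e: "?e > 0" by simp
  have p: "?e * 2 powr real_of_int j = 1" by (simp flip: powr_add)
  have one: "(\<chi> i. 1) \<bullet> b = (1::real)" if "b \<in> Basis" for b :: "real^'d"
    using that by (auto simp: Basis_vec_def inner_axis)
  have prod: "(\<Prod>b\<in>Basis. (?b - ?a) \<bullet> b) = 2 powr (- real_of_int j * real CARD('d))"
    using one by (simp add: powr_realpow[symmetric] powr_powr)
  have le: "?a \<bullet> b \<le> ?b \<bullet> b" if "b \<in> Basis" for b using one[OF that] by (simp add: inner_add_left)
  have mem: "?a $ i \<le> x $ i \<longleftrightarrow> k $ i \<le> 2 powr real_of_int j * x $ i" "x $ i < ?b $ i \<longleftrightarrow> 2 powr real_of_int j * x $ i < k $ i + 1"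
    "?a $ i < x $ i \<longleftrightarrow> k $ i < 2 powr real_of_int j * x $ i" "x $ i \<le> ?b $ i \<longleftrightarrow> 2 powr real_of_int j * x $ i \<le> k $ i + 1" for x i
    by (simp_all add: powr_minus field_simps)
  have "box ?a ?b \<subseteq> dyadic_cube j k"
    unfolding subset_iff mem_box_cart mem_dyadic_cube_iff floor_eq_iff mem by (auto intro: less_imp_le)
  then have "emeasure lborel (box ?a ?b) \<le> emeasure lborel (dyadic_cube j k)" by (intro emeasure_mono) auto
  moreover have "dyadic_cube j k \<subseteq> cbox ?a ?b"
    unfolding subset_iff mem_box_cart mem_dyadic_cube_iff floor_eq_iff mem by (auto intro: less_imp_le)
  then have "emeasure lborel (dyadic_cube j k) \<le> emeasure lborel (cbox ?a ?b)" by (intro emeasure_mono) auto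
  ultimately show ?thesis using le prod by (simp add: emeasure_lborel_box_eq emeasure_lborel_cbox_eq del: vec_lambda_beta)
qed

lemma measure_dyadic_cube:
  "measure lebesgue (dyadic_cube j (k::int^'d::finite)) = 2 powr (- real_of_int j * real CARD('d))"
  by (simp add: measure_def emeasure_dyadic_cube)

lemma dyadic_cube_diam:
  fixes x y :: "real^'d::finite"
  assumes "x \<in> dyadic_cube j k" "y \<in> dyadic_cube j k"
  shows "2 powr real_of_int j * norm (x - y) \<le> real CARD('d)"
proof -
  have "\<bar>2 powr real_of_int j * x $ i - 2 powr real_of_int j * y $ i\<bar> \<le> 1" for i
    using assms unfolding mem_dyadic_cube_iff floor_eq_iff by (smt (verit, ccfv_SIG))
  then have *: "2 powr real_of_int j * \<bar>(x - y) $ i\<bar> \<le> 1" for i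
    by (simp add: abs_mult right_diff_distrib[symmetric])
  have "2 powr real_of_int j * norm (x - y) \<le> 2 powr real_of_int j * (\<Sum>i\<in>UNIV. \<bar>(x - y) $ i\<bar>)"
    by (intro mult_left_mono norm_le_l1_cart) simp
  also have "\<dots> \<le> (\<Sum>i\<in>(UNIV::'d set). 1)" unfolding sum_distrib_left by (intro sum_mono *)
  finally show ?thesis by simp
qed

text \<open>The first factor bounds the ratio of the weight at two points of one cube, by
  \<open>dyadic_cube_diam\<close>; the second is the total mass of the weight at scale 1.\<close>

definition weight_const :: "'d::finite itself \<Rightarrow> real" where
  "weight_const _ = (1 + real CARD('d)) ^ (2 * CARD('d)) *
     (\<integral>(x::real^'d). 1 / (1 + norm x) ^ (2 * CARD('d)) \<partial>lborel)"

lemma weight_const_nonneg: "weight_const TYPE('d::finite) \<ge> 0"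
  unfolding weight_const_def by (intro mult_nonneg_nonneg integral_nonneg_AE AE_I2) simp_all

text \<open>Averaging over the cube containing \<open>x\<close> replaces a lattice sum: the weight is comparable to
  its average over any cube of the given size.\<close>

lemma dyadic_weight_bound:
  fixes y :: "real^'d::finite"
  assumes h: "h \<in> borel_measurable borel"
    and B: "\<And>k. (\<integral>\<^sup>+x. h x * indicator (dyadic_cube j k) x \<partial>lborel) \<le> B"
  shows "(\<integral>\<^sup>+x. h x * ennreal (1 / (1 + 2 powr real_of_int j * norm (x - y)) ^ (2 * CARD('d))) \<partial>lborel)
    \<le> ennreal (weight_const TYPE('d)) * B"
proof -
  let ?n = "2 * CARD('d)" and ?A = "weight_const TYPE('d)"
  define I where "I = (\<integral>(x::real^'d). 1 / (1 + norm x) ^ ?n \<partial>lborel)"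
  have A: "?A = (1 + real CARD('d)) ^ ?n * I" by (simp add: weight_const_def I_def)
  have I0: "I \<ge> 0" unfolding I_def by (intro integral_nonneg_AE AE_I2) simp
  have I: "(\<integral>\<^sup>+(x::real^'d). ennreal (1 / (1 + norm x) ^ ?n) \<partial>lborel) = ennreal I"
    unfolding I_def by (rule nn_integral_eq_integral[OF integrable_inverse_power_norm]) simp
  note [measurable] = h
  let ?s = "2 powr real_of_int j"
  define W where "W x = 1 / (1 + ?s * norm (x - y)) ^ ?n" for x
  define same where "same x x' \<longleftrightarrow> (\<forall>i. \<lfloor>?s * x $ i\<rfloor> = \<lfloor>?s * x' $ i\<rfloor>)" for x x' :: "real^'d"
  define vol where "vol = 2 powr (- real_of_int j * real CARD('d))"
  have vol: "vol > 0" by (simp add: vol_def)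
  have same1: "same x x' \<longleftrightarrow> x' \<in> dyadic_cube j (\<chi> i. \<lfloor>?s * x $ i\<rfloor>)" for x x'
    by (auto simp: same_def mem_dyadic_cube_iff)
  have same2: "same x x' \<longleftrightarrow> x \<in> dyadic_cube j (\<chi> i. \<lfloor>?s * x' $ i\<rfloor>)" for x x'
    by (auto simp: same_def mem_dyadic_cube_iff)
  have [measurable]: "W \<in> borel_measurable borel" unfolding W_def by measurable
  have [measurable]: "Measurable.pred (borel \<Otimes>\<^sub>M borel) (\<lambda>z. same (fst z) (snd z))"
    unfolding same_def by measurable
  have [measurable]: "Measurable.pred (borel \<Otimes>\<^sub>M borel) (\<lambda>z. same (snd z) (fst z))"
    unfolding same_def by measurable
  have [measurable]: "Measurable.pred borel (same x)" for x
    unfolding same_def by measurable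
  have W0: "W x \<ge> 0" for x by (simp add: W_def)
  have Wle: "W x \<le> (1 + real CARD('d)) ^ ?n * W x'" if "same x x'" for x x'
  proof -
    have "?s * norm (x - x') \<le> real CARD('d)"
      by (rule dyadic_cube_diam[of _ _ "\<chi> i. \<lfloor>?s * x $ i\<rfloor>"]) (use that in \<open>auto simp: same_def mem_dyadic_cube_iff\<close>)
    moreover have "norm (x' - y) \<le> norm (x - y) + norm (x - x')"
      by (metis norm_minus_commute norm_triangle_sub add.commute diff_add_cancel diff_diff_eq2 norm_triangle_ineq)
    then have "?s * norm (x' - y) \<le> ?s * norm (x - y) + ?s * norm (x - x')"
      by (simp flip: distrib_left)
    ultimately have "1 + ?s * norm (x' - y) \<le> 1 + ?s * norm (x - y) + real CARD('d)" by linarith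
    also have "\<dots> \<le> (1 + real CARD('d)) * (1 + ?s * norm (x - y))"
      by (simp add: algebra_simps)
    finally have "(1 + ?s * norm (x' - y)) ^ ?n \<le> ((1 + real CARD('d)) * (1 + ?s * norm (x - y))) ^ ?n"
      by (rule power_mono) simp
    moreover have "0 < (1 + ?s * norm (x' - y)) ^ ?n" "0 < (1 + ?s * norm (x - y)) ^ ?n"
      by (simp_all add: add_pos_nonneg)
    ultimately show ?thesis unfolding W_def power_mult_distrib by (simp add: field_simps)
  qed
  \<comment> \<open>The factor 1 is written as an average over x' in the cube of x. Once the weight
    is moved to x' and the order of integration exchanged, the inner integral is the one bounded by
    \<open>B\<close>.\<close>
  have "(\<integral>\<^sup>+x. h x * ennreal (W x) \<partial>lborel) = (\<integral>\<^sup>+x. ennreal (1 / vol) * (\<integral>\<^sup>+x'. h x * ennreal (W x) * of_bool (same x x') \<partial>lborel) \<partial>lborel)"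
  proof (rule nn_integral_cong)
    fix x
    have "(\<integral>\<^sup>+x'. h x * ennreal (W x) * of_bool (same x x') \<partial>lborel) = (\<integral>\<^sup>+x'. h x * ennreal (W x) * indicator (dyadic_cube j (\<chi> i. \<lfloor>?s * x $ i\<rfloor>)) x' \<partial>lborel)"
      by (intro nn_integral_cong) (auto simp: same1 indicator_def)
    also have "\<dots> = h x * ennreal (W x) * ennreal vol"
      by (subst nn_integral_cmult_indicator) (auto simp: emeasure_dyadic_cube vol_def)
    finally have "ennreal (1 / vol) * (\<integral>\<^sup>+x'. h x * ennreal (W x) * of_bool (same x x') \<partial>lborel) = (h x * ennreal (W x)) * (ennreal (1 / vol) * ennreal vol)"
      by (simp add: mult_ac)
    also have "ennreal (1 / vol) * ennreal vol = 1" using vol by (simp flip: ennreal_mult)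
    finally show "h x * ennreal (W x) = ennreal (1 / vol) * (\<integral>\<^sup>+x'. h x * ennreal (W x) * of_bool (same x x') \<partial>lborel)" by simp
  qed
  also have "\<dots> \<le> (\<integral>\<^sup>+x. ennreal (1 / vol) * (\<integral>\<^sup>+x'. ennreal ((1 + real CARD('d)) ^ ?n) * (h x * ennreal (W x') * of_bool (same x x')) \<partial>lborel) \<partial>lborel)"
  proof (intro nn_integral_mono mult_left_mono)
    fix x x'
    show "h x * ennreal (W x) * of_bool (same x x') \<le> ennreal ((1 + real CARD('d)) ^ ?n) * (h x * ennreal (W x') * of_bool (same x x'))"
    proof (cases "same x x'")
      case True
      have "h x * ennreal (W x) \<le> h x * ennreal ((1 + real CARD('d)) ^ ?n * W x')"
        by (intro mult_left_mono ennreal_leI Wle True) simp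
      then show ?thesis using True W0 by (simp add: ennreal_mult mult_ac)
    qed simp
  qed auto
  also have "\<dots> = ennreal (1 / vol) * (ennreal ((1 + real CARD('d)) ^ ?n) * (\<integral>\<^sup>+x. (\<integral>\<^sup>+x'. h x * ennreal (W x') * of_bool (same x x') \<partial>lborel) \<partial>lborel))"
  proof -
    have "(\<integral>\<^sup>+x'. ennreal ((1 + real CARD('d)) ^ ?n) * (h x * ennreal (W x') * of_bool (same x x')) \<partial>lborel)
        = ennreal ((1 + real CARD('d)) ^ ?n) * (\<integral>\<^sup>+x'. h x * ennreal (W x') * of_bool (same x x') \<partial>lborel)" for x
      by (rule nn_integral_cmult) measurable
    then show ?thesis
      by (simp only:) (subst nn_integral_cmult, measurable, subst nn_integral_cmult, measurable)
  qed
  also have "(\<integral>\<^sup>+x. (\<integral>\<^sup>+x'. h x * ennreal (W x') * of_bool (same x x') \<partial>lborel) \<partial>lborel) = (\<integral>\<^sup>+x'. (\<integral>\<^sup>+x. h x * ennreal (W x') * of_bool (same x x') \<partial>lborel) \<partial>lborel)"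
    by (rule lborel_pair.Fubini') measurable
  also have "\<dots> \<le> (\<integral>\<^sup>+x'. ennreal (W x') * B \<partial>lborel)"
  proof (rule nn_integral_mono)
    fix x'
    have "(\<integral>\<^sup>+x. h x * ennreal (W x') * of_bool (same x x') \<partial>lborel) = (\<integral>\<^sup>+x. ennreal (W x') * (h x * indicator (dyadic_cube j (\<chi> i. \<lfloor>?s * x' $ i\<rfloor>)) x) \<partial>lborel)"
      by (intro nn_integral_cong) (auto simp: same2 indicator_def mult.commute)
    also have "\<dots> = ennreal (W x') * (\<integral>\<^sup>+x. h x * indicator (dyadic_cube j (\<chi> i. \<lfloor>?s * x' $ i\<rfloor>)) x \<partial>lborel)"
      by (rule nn_integral_cmult) measurable
    also have "\<dots> \<le> ennreal (W x') * B" by (intro mult_left_mono B) simp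
    finally show "(\<integral>\<^sup>+x. h x * ennreal (W x') * of_bool (same x x') \<partial>lborel) \<le> ennreal (W x') * B" .
  qed
  also have "\<dots> = (\<integral>\<^sup>+x'. ennreal (W x') \<partial>lborel) * B" by (rule nn_integral_multc) measurable
  \<comment> \<open>The weight at scale 2^(-j) has mass \<open>vol\<close> times \<open>I\<close>,
    which cancels the 1 / \<open>vol\<close> of the averaging; so the constant is independent of
    j.\<close>
  also have "(\<integral>\<^sup>+x'. ennreal (W x') \<partial>lborel) = ennreal (vol * I)"
  proof -
    let ?c = "2 powr (- real_of_int j)"
    have "(\<integral>\<^sup>+x'. ennreal (W x') \<partial>lborel) = ennreal (\<bar>?c\<bar> ^ DIM(real^'d)) * (\<integral>\<^sup>+x'. ennreal (W (y + ?c *\<^sub>R x')) \<partial>lborel)"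
      by (rule nn_integral_lborel_affine) auto
    also have "(\<lambda>x'. ennreal (W (y + ?c *\<^sub>R x'))) = (\<lambda>x'. ennreal (1 / (1 + norm x') ^ ?n))"
    proof -
      have sc: "?s * (?c * t) = t" for t :: real
        unfolding mult.assoc[symmetric] powr_add[symmetric] by simp
      show ?thesis by (simp add: W_def sc)
    qed
    also have "\<bar>?c\<bar> ^ DIM(real^'d) = vol" by (simp add: vol_def powr_realpow[symmetric] powr_powr)
    finally show ?thesis unfolding I using vol I0 by (simp add: ennreal_mult)
  qed
  also have "ennreal (1 / vol) * (ennreal ((1 + real CARD('d)) ^ ?n) * (ennreal (vol * I) * B)) = ennreal ?A * B"
  proof -
    have "1 / vol * ((1 + real CARD('d)) ^ ?n * (vol * I)) = ?A" using vol by (simp add: A)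
    then have "ennreal (1 / vol) * (ennreal ((1 + real CARD('d)) ^ ?n) * ennreal (vol * I)) = ennreal ?A"
      using vol I0 by (simp flip: ennreal_mult)
    then show ?thesis by (simp add: mult.assoc[symmetric])
  qed
  finally have "(\<integral>\<^sup>+x. h x * ennreal (W x) \<partial>lborel) \<le> ennreal ?A * B"
    by (simp add: mult_left_mono)
  then show ?thesis unfolding W_def .
qed

section \<open>The Nikol'skij inequality\<close>

text \<open>This holds for every f because the integral of a non-integrable function is 0 by
  convention.\<close>

lemma norm_integral_le_nn:
  fixes f :: "'a \<Rightarrow> complex"
  shows "ennreal (norm (\<integral>x. f x \<partial>M)) \<le> (\<integral>\<^sup>+x. ennreal (norm (f x)) \<partial>M)"
proof (cases "integrable M f")
  case True
  then show ?thesis by (rule integral_norm_bound_ennreal)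
qed (simp add: not_integrable_integral_eq)

text \<open>Division by a^(1-p). The number a is finite by its type, so the lemma applies to a
  supremum only after boundedness is known.\<close>

lemma powr_self_improve:
  fixes a X p :: real
  assumes "0 \<le> a" "0 < p" "0 \<le> X" "a \<le> a powr (1 - p) * X"
  shows "a \<le> X powr (1 / p)"
proof (cases "a = 0")
  case False
  then have a: "a > 0" using assms by simp
  have "a powr p = a * a powr (p - 1)" using a by (simp add: powr_mult_base)
  also have "\<dots> \<le> (a powr (1 - p) * X) * a powr (p - 1)" by (intro mult_right_mono assms) simp
  also have "\<dots> = (a powr (1 - p) * a powr (p - 1)) * X" by (simp add: mult_ac)
  also have "a powr (1 - p) * a powr (p - 1) = 1" using a by (simp flip: powr_add)
  finally have "(a powr p) powr (1 / p) \<le> X powr (1 / p)" using assms by (intro powr_mono2) auto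
  then show ?thesis using a assms by (simp add: powr_powr)
qed simp

lemma powr_split:
  fixes x p :: real
  assumes "0 \<le> x" "0 < p" "p \<le> 1"
  shows "x = x powr (1 - p) * x powr p"
proof (cases "x = 0")
  case False
  then show ?thesis using assms by (simp flip: powr_add)
qed simp

text \<open>With \<open>M = 0\<close> this is the Nikol'skij inequality for bounded
  functions, and \<open>\<epsilon> \<rightarrow> 0\<close> with large \<open>M\<close> yields the boundedness which that case presupposes.\<close>

lemma nikolskij_weighted:
  fixes G K :: "real^'d::finite \<Rightarrow> complex"
  assumes p: "0 < p" "p \<le> 1" and c: "0 \<le> c" "\<And>x. (1 + norm x) ^ (2 * CARD('d) + M) * norm (K x) \<le> c"
    and cont: "continuous_on UNIV G" and B: "0 \<le> B"
    and rep: "\<And>y. G y = (\<integral>z. G (y + z) * (of_real ((2 ^ Suc j) ^ CARD('d)) * K (2 ^ Suc j *\<^sub>R z)) \<partial>lborel)"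
    and cube: "\<And>k. (\<integral>\<^sup>+x. ennreal (norm (G x) powr p) * indicator (dyadic_cube (int j) k) x \<partial>lborel) \<le> ennreal B"
    and e: "0 \<le> \<epsilon>" "\<epsilon> \<le> 1"
    and gr: "\<And>x. norm (G x) \<le> D * (1 + \<epsilon> * norm x) ^ M"
  shows "norm (G y) \<le> (2 ^ CARD('d) * c * weight_const TYPE('d) * (2 ^ j) ^ CARD('d) * B) powr (1 / p) * (1 + \<epsilon> * norm y) ^ M"
proof -
  let ?n = "2 * CARD('d)"
  define C where "C = 2 ^ CARD('d) * c * weight_const TYPE('d)"
  have [measurable]: "G \<in> borel_measurable borel" using cont by (rule borel_measurable_continuous_onI)
  let ?w = "\<lambda>x. (1 + \<epsilon> * norm x) ^ M"
  have w: "?w x \<ge> 1" for x :: "real^'d" using e by (intro one_le_power) simp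
  have w0: "?w x > 0" for x :: "real^'d" using w[of x] by linarith
  \<comment> \<open>The damped supremum takes the place of sup |G|; it is finite by the growth bound
    with the same weight.\<close>
  define a where "a = (SUP x. norm (G x) / ?w x)"
  have bdd: "bdd_above (range (\<lambda>x. norm (G x) / ?w x))"
    using gr w0 by (intro bdd_aboveI[of _ D]) (auto simp: pos_divide_le_eq)
  have aG: "norm (G x) \<le> a * ?w x" for x
    using cSUP_upper[OF UNIV_I bdd, of x] w0[of x] by (simp add: a_def pos_divide_le_eq)
  have a0: "a \<ge> 0"
    by (rule order.trans[OF _ cSUP_upper[OF UNIV_I bdd, of 0, folded a_def]]) (simp add: divide_nonneg_pos w0)
  let ?N = "(2 ^ Suc j) ^ CARD('d) :: real"
  define X where "X = C * (2 ^ j) ^ CARD('d) * B"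
  have C0: "C \<ge> 0" using c weight_const_nonneg[where 'd='d] by (simp add: C_def)
  have X0: "X \<ge> 0" using C0 B by (simp add: X_def)
  have step: "norm (G y) \<le> a powr (1 - p) * X * ?w y" for y
  proof -
    have pt: "norm (G (y + z) * (of_real ?N * K (2 ^ Suc j *\<^sub>R z)))
      \<le> (a powr (1 - p) * ?w y * ?N * c) * (norm (G (y + z)) powr p * (1 / (1 + 2 ^ j * norm z) ^ ?n))" for z
    proof -
      let ?t = "2 ^ Suc j * norm z"
      have t: "?t \<ge> norm z" "?t \<ge> 2 ^ j * norm z" "?t \<ge> 0"
        using mult_right_mono[OF one_le_power[of "2::real" "Suc j"], of "norm z"] by (auto intro!: mult_right_mono)
      \<comment> \<open>The power 1 - p of |G| is estimated by the damped supremum, the power p is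
        left for the local L_p bounds.\<close>
      have "norm (G (y + z)) = norm (G (y + z)) powr (1 - p) * norm (G (y + z)) powr p"
        using p by (intro powr_split) auto
      also have "\<dots> \<le> (a * ?w (y + z)) powr (1 - p) * norm (G (y + z)) powr p"
        using p by (intro mult_right_mono powr_mono2 aG) auto
      also have "\<dots> \<le> (a powr (1 - p) * ?w (y + z)) * norm (G (y + z)) powr p"
      proof (intro mult_right_mono)
        \<comment> \<open>The weight is at least 1, so its power 1 - p is at most the weight itself,
          and the exponent stays the integer M.\<close>
        have "?w (y + z) powr (1 - p) \<le> ?w (y + z) powr 1" using p w by (intro powr_mono) auto
        then have "?w (y + z) powr (1 - p) \<le> ?w (y + z)" using w0[of "y + z"] by (simp del: power_eq_0_iff)
        then show "(a * ?w (y + z)) powr (1 - p) \<le> a powr (1 - p) * ?w (y + z)"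
          using a0 w0[of "y + z"] by (simp add: powr_mult mult_left_mono)
      qed simp
      also have "\<dots> \<le> (a powr (1 - p) * (?w y * (1 + ?t) ^ M)) * norm (G (y + z)) powr p"
      proof (intro mult_right_mono mult_left_mono)
        have "\<epsilon> * norm (y + z) \<le> \<epsilon> * norm y + \<epsilon> * norm z"
          using mult_left_mono[OF norm_triangle_ineq e(1)] by (simp add: distrib_left)
        moreover have "\<epsilon> * norm z \<le> ?t" using mult_right_mono[OF e(2), of "norm z"] t(1) by simp
        moreover have "0 \<le> \<epsilon> * norm y * ?t" using e t by (intro mult_nonneg_nonneg) auto
        ultimately have "1 + \<epsilon> * norm (y + z) \<le> (1 + \<epsilon> * norm y) * (1 + ?t)" by (simp add: algebra_simps)
        then have "?w (y + z) \<le> ((1 + \<epsilon> * norm y) * (1 + ?t)) ^ M" using e by (intro power_mono) auto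
        then show "?w (y + z) \<le> ?w y * (1 + ?t) ^ M" by (simp add: power_mult_distrib)
      qed auto
      finally have G: "norm (G (y + z)) \<le> (a powr (1 - p) * (?w y * (1 + ?t) ^ M)) * norm (G (y + z)) powr p" .
      have pos: "(1 + ?t) ^ ?n > 0" "(1 + ?t) ^ M > 0" "(1 + 2 ^ j * norm z) ^ ?n > 0" using t by (auto simp: add_pos_nonneg)
      have "(1 + ?t) ^ ?n * (1 + ?t) ^ M * norm (K (2 ^ Suc j *\<^sub>R z)) \<le> c"
        using c(2)[of "2 ^ Suc j *\<^sub>R z"] by (simp add: power_add)
      then have "(1 + ?t) ^ M * norm (K (2 ^ Suc j *\<^sub>R z)) \<le> c * (1 / (1 + ?t) ^ ?n)"
        using pos by (simp add: field_simps)
      \<comment> \<open>The kernel has scale 2^(-j-1); passing to 2^(-j) matches the weight to the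
        cubes on which G is controlled.\<close>
      also have "\<dots> \<le> c * (1 / (1 + 2 ^ j * norm z) ^ ?n)"
        using c(1) t(2) pos by (intro mult_left_mono divide_left_mono power_mono) auto
      finally have Kb: "(1 + ?t) ^ M * norm (K (2 ^ Suc j *\<^sub>R z)) \<le> c * (1 / (1 + 2 ^ j * norm z) ^ ?n)" .
      have "norm (G (y + z) * (of_real ?N * K (2 ^ Suc j *\<^sub>R z))) = norm (G (y + z)) * (?N * norm (K (2 ^ Suc j *\<^sub>R z)))"
        by (simp add: norm_mult norm_power)
      also have "\<dots> \<le> ((a powr (1 - p) * (?w y * (1 + ?t) ^ M)) * norm (G (y + z)) powr p) * (?N * norm (K (2 ^ Suc j *\<^sub>R z)))"
        by (intro mult_right_mono G) simp
      also have "\<dots> = (a powr (1 - p) * ?w y * ?N * norm (G (y + z)) powr p) * ((1 + ?t) ^ M * norm (K (2 ^ Suc j *\<^sub>R z)))"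
        by (simp only: mult_ac)
      also have "\<dots> \<le> (a powr (1 - p) * ?w y * ?N * norm (G (y + z)) powr p) * (c * (1 / (1 + 2 ^ j * norm z) ^ ?n))"
        using w0[of y] by (intro mult_left_mono Kb mult_nonneg_nonneg) auto
      finally show ?thesis by (simp only: mult_ac)
    qed
    let ?Z = "a powr (1 - p) * ?w y * ?N * c"
    have Z0: "?Z \<ge> 0" using w0[of y] c(1) by (intro mult_nonneg_nonneg) auto
    let ?f = "\<lambda>x. ennreal (norm (G x) powr p) * ennreal (1 / (1 + 2 powr real_of_int (int j) * norm (x - y)) ^ ?n)"
    have "ennreal (norm (G y)) \<le> (\<integral>\<^sup>+z. ennreal (norm (G (y + z) * (of_real ?N * K (2 ^ Suc j *\<^sub>R z)))) \<partial>lborel)"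
      by (subst rep) (rule norm_integral_le_nn)
    also have "\<dots> \<le> (\<integral>\<^sup>+z. ennreal ?Z * ?f (y + 1 *\<^sub>R z) \<partial>lborel)"
    proof (rule nn_integral_mono)
      fix z
      have "ennreal (norm (G (y + z) * (of_real ?N * K (2 ^ Suc j *\<^sub>R z))))
        \<le> ennreal (?Z * (norm (G (y + z)) powr p * (1 / (1 + 2 ^ j * norm z) ^ ?n)))"
        by (intro ennreal_leI pt)
      also have "\<dots> = ennreal ?Z * ?f (y + 1 *\<^sub>R z)"
        by (subst ennreal_mult[OF Z0], simp, subst ennreal_mult) (simp_all add: powr_realpow)
      finally show "ennreal (norm (G (y + z) * (of_real ?N * K (2 ^ Suc j *\<^sub>R z)))) \<le> ennreal ?Z * ?f (y + 1 *\<^sub>R z)" .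
    qed
    also have "\<dots> = ennreal ?Z * (\<integral>\<^sup>+z. ?f (y + 1 *\<^sub>R z) \<partial>lborel)" by (rule nn_integral_cmult) measurable
    also have "(\<integral>\<^sup>+z. ?f (y + 1 *\<^sub>R z) \<partial>lborel) = (\<integral>\<^sup>+x. ?f x \<partial>lborel)"
      using nn_integral_lborel_affine[of ?f 1 y] by simp
    also have "ennreal ?Z * \<dots> \<le> ennreal ?Z * (ennreal (weight_const TYPE('d)) * ennreal B)"
      by (intro mult_left_mono dyadic_weight_bound cube) simp_all
    also have "\<dots> = ennreal (?Z * (weight_const TYPE('d) * B))" using Z0 weight_const_nonneg[where 'd='d] B by (simp add: ennreal_mult)
    finally have "norm (G y) \<le> ?Z * (weight_const TYPE('d) * B)" using Z0 weight_const_nonneg[where 'd='d] B by (subst (asm) ennreal_le_iff) auto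
    also have "?Z * (weight_const TYPE('d) * B) = a powr (1 - p) * X * ?w y"
      by (simp add: X_def C_def power_mult_distrib mult_ac)
    finally show ?thesis .
  qed
  have "a \<le> a powr (1 - p) * X" unfolding a_def
    by (rule cSUP_least, simp, unfold a_def[symmetric]) (use step w0 in \<open>simp add: pos_divide_le_eq\<close>)
  then have "a \<le> X powr (1 / p)" by (rule powr_self_improve[OF a0 p(1) X0])
  then have "a * ?w y \<le> X powr (1 / p) * ?w y" using w0[of y] by (intro mult_right_mono) auto
  then show ?thesis using aG[of y] unfolding X_def C_def by linarith
qed

text \<open>Two passes. The damped estimate with \<epsilon> -> 0 shows that G is bounded, with a
  constant \<open>c'\<close> that depends on the growth order M. Once G is known to be bounded, the
  undamped case M = 0 replaces \<open>c'\<close> by \<open>c\<close>, which involves the kernel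
  alone.\<close>

lemma nikolskij:
  fixes G K :: "real^'d::finite \<Rightarrow> complex"
  assumes p: "0 < p" "p \<le> 1" and c: "0 \<le> c" "\<And>x. (1 + norm x) ^ (2 * CARD('d)) * norm (K x) \<le> c" and K: "K \<in> schwartz"
    and cont: "continuous_on UNIV G" and B: "0 \<le> B"
    and rep: "\<And>y. G y = (\<integral>z. G (y + z) * (of_real ((2 ^ Suc j) ^ CARD('d)) * K (2 ^ Suc j *\<^sub>R z)) \<partial>lborel)"
    and cube: "\<And>k. (\<integral>\<^sup>+x. ennreal (norm (G x) powr p) * indicator (dyadic_cube (int j) k) x \<partial>lborel) \<le> ennreal B"
    and gr: "\<And>x. norm (G x) \<le> D * (1 + norm x) ^ M"
  shows "norm (G y) \<le> (2 ^ CARD('d) * c * weight_const TYPE('d) * (2 ^ j) ^ CARD('d) * B) powr (1 / p)"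
proof -
  obtain c' where c': "0 \<le> c'" "\<And>x. (1 + norm x) ^ (2 * CARD('d) + M) * norm (K x) \<le> c'"
    using schwartz_decay[OF K] by metis
  let ?Y = "(2 ^ CARD('d) * c' * weight_const TYPE('d) * (2 ^ j) ^ CARD('d) * B) powr (1 / p)"
  have D: "D \<ge> 0" using order.trans[OF norm_ge_zero gr[of 0]] by simp
  have bnd: "norm (G x) \<le> ?Y * (1 + \<epsilon> * norm x) ^ M" if e: "0 < \<epsilon>" "\<epsilon> \<le> 1" for \<epsilon> x
  proof (rule nikolskij_weighted[OF p c' cont B rep cube])
    \<comment> \<open>Passing from 1 + |x| to 1 + \<epsilon> |x| costs \<epsilon>^(-M), but this
      factor enters only the a priori bound, which leaves no trace in the conclusion of
      \<open>nikolskij_weighted\<close>.\<close>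
    show "norm (G x) \<le> (D / \<epsilon> ^ M) * (1 + \<epsilon> * norm x) ^ M" for x
    proof -
      have "\<epsilon> * (1 + norm x) \<le> 1 + \<epsilon> * norm x" using e by (simp add: distrib_left)
      then have "(\<epsilon> * (1 + norm x)) ^ M \<le> (1 + \<epsilon> * norm x) ^ M" using e by (intro power_mono) auto
      then have "\<epsilon> ^ M * (1 + norm x) ^ M \<le> (1 + \<epsilon> * norm x) ^ M"
        by (simp only: power_mult_distrib)
      then have "D * (\<epsilon> ^ M * (1 + norm x) ^ M) \<le> D * (1 + \<epsilon> * norm x) ^ M" using D by (rule mult_left_mono)
      then have "D * (1 + norm x) ^ M \<le> (D / \<epsilon> ^ M) * (1 + \<epsilon> * norm x) ^ M"
        using e by (simp add: pos_le_divide_eq mult_ac)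
      then show ?thesis using gr order.trans by blast
    qed
  qed (use e in auto)
  have bounded: "norm (G x) \<le> ?Y" for x
  proof (rule LIMSEQ_le_const)
    have "(\<lambda>n. ?Y * (1 + inverse (real (Suc n)) * norm x) ^ M) \<longlonglongrightarrow> ?Y * (1 + 0 * norm x) ^ M"
      by (intro tendsto_intros LIMSEQ_inverse_real_of_nat)
    then show "(\<lambda>n. ?Y * (1 + inverse (real (Suc n)) * norm x) ^ M) \<longlonglongrightarrow> ?Y" by simp
    show "\<exists>N. \<forall>n\<ge>N. norm (G x) \<le> ?Y * (1 + inverse (real (Suc n)) * norm x) ^ M"
      by (intro exI allI impI bnd) (auto simp: inverse_le_1_iff)
  qed
  show ?thesis
    using nikolskij_weighted[where M=0 and \<epsilon>=0 and D="?Y" and y=y, OF p c(1) _ cont B rep cube] c(2) bounded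
    by simp
qed

section \<open>Local estimates of a single block\<close>

lemma continuous_locally_integrable:
  fixes g :: "real^'d::finite \<Rightarrow> complex"
  assumes "continuous_on UNIV g"
  shows "locally_integrable g"
  unfolding locally_integrable_def
proof (intro allI impI)
  fix K :: "(real^'d) set" assume K: "compact K"
  have "(\<lambda>x. indicat_real K x *\<^sub>R g x) \<in> borel_measurable lborel"
    using borel_measurable_continuous_onI[OF assms] borel_closed[OF compact_imp_closed[OF K]]
    by (intro borel_measurable_scaleR borel_measurable_indicator) auto
  moreover have "integrable lborel (\<lambda>x. indicat_real K x *\<^sub>R g x)"
    by (rule borel_integrable_compact[OF K continuous_on_subset[OF assms]]) simp
  ultimately show "set_integrable lebesgue K g"
    unfolding set_integrable_def by (simp add: integrable_completion)
qed

text \<open>Both functions are replaced by Borel versions, whose difference annihilates all test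
  functions. The generator supplies the test function of nonzero integral.\<close>

lemma represents_unique_AE:
  fixes \<phi> g g' :: "real^'d::finite \<Rightarrow> complex"
  assumes \<phi>: "resolution_generator \<phi>" and g: "represents g T" and g': "represents g' T"
  shows "AE x in lborel. g x = g' x"
proof -
  note l = g[unfolded represents_def, THEN conjunct1] g'[unfolded represents_def, THEN conjunct1]
  note m = locally_integrable_measurable[OF l(1)] locally_integrable_measurable[OF l(2)]
  obtain h where h: "h \<in> borel_measurable borel" "AE x in lborel. g x = h x"
    by (rule borel_measurable_lebesgue_ex_borel[OF m(1)])
  obtain h' where h': "h' \<in> borel_measurable borel" "AE x in lborel. g' x = h' x"
    by (rule borel_measurable_lebesgue_ex_borel[OF m(2)])
  note s = locally_integrable_cong_AE[OF h l(1)] locally_integrable_cong_AE[OF h' l(2)]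
  note t = generator_test_function[OF \<phi>]
  obtain \<rho> :: "real^'d \<Rightarrow> complex" where \<rho>: "\<rho> \<in> test_functions" "(\<integral>z. \<rho> z \<partial>lborel) \<noteq> 0"
    using ex_test_function_integral_nonzero[OF t] generator_one[OF \<phi>, of 0] by auto
  have int: "integrable lborel (\<lambda>x. k x * \<psi> x)"
    if k: "\<And>K. compact K \<Longrightarrow> set_integrable lborel K k" and \<psi>: "\<psi> \<in> test_functions" for k \<psi> :: "real^'d \<Rightarrow> complex"
  proof -
    obtain R where R: "\<And>x. norm x > R \<Longrightarrow> \<psi> x = 0" using test_function_support[OF \<psi>] by metis
    obtain B where B: "\<And>x. norm (\<psi> x) \<le> B" using schwartz_bounded[OF test_function_schwartz[OF \<psi>]] by metis
    have "integrable lborel (\<lambda>x. \<psi> x * (indicat_real (cball 0 R) x *\<^sub>R k x))"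
      using k[of "cball 0 R"] test_function_measurable[OF \<psi>]
      by (intro integrable_bounded_mult[where B=B] B) (auto simp: set_integrable_def)
    moreover have "\<psi> x * (indicat_real (cball 0 R) x *\<^sub>R k x) = k x * \<psi> x" for x
      using R[of x] by (cases "norm x \<le> R") auto
    ultimately show ?thesis by simp
  qed
  have "AE x in lborel. h x - h' x = 0"
  proof (rule AE_zero_of_test_functions[OF _ _ _ \<rho>])
    show "(\<lambda>x. h x - h' x) \<in> borel_measurable borel" using h(1) h'(1) by measurable
    show "set_integrable lborel K (\<lambda>x. h x - h' x)" if "compact K" for K
      using s that by (intro set_integral_diff)
    fix \<psi> :: "real^'d \<Rightarrow> complex" assume \<psi>: "\<psi> \<in> test_functions"
    note pm = test_function_measurable[OF \<psi>]
    have "(\<integral>x. h x * \<psi> x \<partial>lborel) = T \<psi>" "(\<integral>x. h' x * \<psi> x \<partial>lborel) = T \<psi>"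
      using g g' \<psi> integral_test_lebesgue_eq[OF h m(1) pm] integral_test_lebesgue_eq[OF h' m(2) pm]
      by (auto simp: represents_def)
    then show "(\<integral>x. (h x - h' x) * \<psi> x \<partial>lborel) = 0"
      using int[OF s(1) \<psi>] int[OF s(2) \<psi>] by (simp add: left_diff_distrib)
  qed
  with h(2) h'(2) show ?thesis by eventually_elim simp
qed

lemma block_fun_represents:
  fixes \<phi> :: "real^'d::finite \<Rightarrow> complex"
  assumes "resolution_generator \<phi>" "tempered T"
  shows "represents (block_fun \<phi> j T) (frequency_block \<phi> j T)"
  unfolding represents_def
proof (intro conjI ballI)
  note c = block_fun_continuous[OF assms, of j]
  show "locally_integrable (block_fun \<phi> j T)" by (rule continuous_locally_integrable[OF c])
  fix \<psi> :: "real^'d \<Rightarrow> complex" assume \<psi>: "\<psi> \<in> test_functions"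
  have "(\<lambda>x. block_fun \<phi> j T x * \<psi> x) \<in> borel_measurable lborel"
    using borel_measurable_continuous_onI[OF c] test_function_measurable[OF \<psi>] by measurable
  then show "frequency_block \<phi> j T \<psi> = (LINT x|lebesgue. block_fun \<phi> j T x * \<psi> x)"
    by (simp add: integral_completion block_fun_integral[OF assms \<psi>])
qed

lemma morrey_norm_cong_AE:
  assumes "AE x in lborel. f x = g x"
  shows "morrey_norm u p f = morrey_norm u p g"
proof -
  have "(\<integral>\<^sup>+ y\<in>Q. ennreal (norm (f y) powr p) \<partial>lebesgue) = (\<integral>\<^sup>+ y\<in>Q. ennreal (norm (g y) powr p) \<partial>lebesgue)" for Q
    unfolding nn_integral_completion by (intro nn_integral_cong_AE) (use assms in eventually_elim, simp)
  then show ?thesis by (simp add: morrey_norm_def)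
qed

text \<open>The representative chosen by \<open>SOME\<close> agrees almost everywhere with the
  continuous block function, and the Morrey norm ignores null sets.\<close>

lemma distr_morrey_norm_block:
  fixes \<phi> :: "real^'d::finite \<Rightarrow> complex"
  assumes "resolution_generator \<phi>" "tempered T"
  shows "distr_morrey_norm u p (frequency_block \<phi> j T) = morrey_norm u p (block_fun \<phi> j T)"
proof -
  note r = block_fun_represents[OF assms, of j]
  have reg: "regular (frequency_block \<phi> j T)" using r by (auto simp: regular_def)
  have "represents (representative (frequency_block \<phi> j T)) (frequency_block \<phi> j T)"
    unfolding representative_def by (rule someI[of "\<lambda>g. represents g (frequency_block \<phi> j T)", OF r])
  from morrey_norm_cong_AE[OF represents_unique_AE[OF assms(1) this r]]
  show ?thesis using reg by (simp add: distr_morrey_norm_def)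
qed

lemma epowr_ennreal: "0 \<le> x \<Longrightarrow> epowr (ennreal x) a = ennreal (x powr a)"
  by (simp add: epowr_def)

text \<open>The supremum is evaluated at one cube and solved for the integral; the exponent 1 - p/u
  is (1/p - 1/u) p.\<close>

lemma morrey_norm_cube:
  fixes G :: "real^'d::finite \<Rightarrow> complex"
  assumes p: "0 < p" and N: "0 \<le> N" and le: "morrey_norm u p G \<le> ennreal N"
    and m: "m = 2 powr (- real_of_int j * real CARD('d))"
  shows "(\<integral>\<^sup>+x. ennreal (norm (G x) powr p) * indicator (dyadic_cube j k) x \<partial>lborel) \<le> ennreal (m powr (1 - p / u) * N powr p)"
proof -
  let ?Q = "dyadic_cube j k"
  let ?I = "\<integral>\<^sup>+x. ennreal (norm (G x) powr p) * indicator ?Q x \<partial>lborel"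
  have m0: "m > 0" by (simp add: m)
  have "?Q \<in> dyadic_cubes" by (auto simp: dyadic_cubes_def)
  then have "ennreal (measure lebesgue ?Q powr (1 / u - 1 / p)) * epowr (\<integral>\<^sup>+ y\<in>?Q. ennreal (norm (G y) powr p) \<partial>lebesgue) (1 / p) \<le> ennreal N"
    using le unfolding morrey_norm_def by (meson SUP_upper order.trans)
  then have *: "ennreal (m powr (1 / u - 1 / p)) * epowr ?I (1 / p) \<le> ennreal N"
    by (simp add: nn_integral_completion measure_dyadic_cube m)
  have fin: "?I \<noteq> \<infinity>"
  proof
    assume "?I = \<infinity>"
    then have "epowr ?I (1 / p) = \<infinity>" by (simp add: epowr_def)
    then show False using * m0 by (simp add: ennreal_mult_top top_unique)
  qed
  then obtain i where i: "?I = ennreal i" "i \<ge> 0" by (cases ?I) auto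
  have "m powr (1 / u - 1 / p) * i powr (1 / p) \<le> N"
    using * N unfolding i(1) epowr_ennreal[OF i(2)] by (simp flip: ennreal_mult)
  then have "(m powr (1 / p - 1 / u)) * (m powr (1 / u - 1 / p) * i powr (1 / p)) \<le> m powr (1 / p - 1 / u) * N"
    by (rule mult_left_mono) simp
  moreover have "m powr (1 / p - 1 / u) * m powr (1 / u - 1 / p) = 1" using m0 by (simp flip: powr_add)
  ultimately have "i powr (1 / p) \<le> m powr (1 / p - 1 / u) * N" by (simp flip: mult.assoc)
  then have "(i powr (1 / p)) powr p \<le> (m powr (1 / p - 1 / u) * N) powr p" using p by (intro powr_mono2) auto
  then have "i \<le> m powr ((1 / p - 1 / u) * p) * N powr p"
    using p i(2) N by (simp add: powr_powr powr_mult)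
  also have "(1 / p - 1 / u) * p = 1 - p / u" using p by (simp add: field_simps)
  finally show ?thesis unfolding i(1) by (rule ennreal_leI)
qed

text \<open>The two terms cover x \<le> l and x > l. With l the level of the p-th mean, this lowers
  an exponent from p to r as Hoelder's inequality would, with constant 2 instead of 1.\<close>

lemma powr_young:
  fixes x l r p :: real
  assumes "0 < l" "0 \<le> x" "0 < r" "r \<le> p"
  shows "x powr r \<le> l powr r + l powr (r - p) * x powr p"
proof (cases "x \<le> l")
  case True
  then have "x powr r \<le> l powr r" using assms by (intro powr_mono2) auto
  then show ?thesis by (simp add: add_increasing2)
next
  case False
  then have "x > 0" using assms by simp
  then have "x powr r = x powr (r - p) * x powr p" by (simp flip: powr_add)
  also have "\<dots> \<le> l powr (r - p) * x powr p"
    using False assms by (intro mult_right_mono powr_mono2') auto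
  finally show ?thesis by (simp add: add_increasing)
qed

lemma nn_integral_powr_young:
  fixes G :: "'a::euclidean_space \<Rightarrow> complex"
  assumes [measurable]: "G \<in> borel_measurable borel" "Q \<in> sets borel"
    and m: "0 \<le> m" "emeasure lborel Q = ennreal m" and l: "0 < l" and r: "0 < r" "r \<le> p"
    and le: "(\<integral>\<^sup>+x. ennreal (norm (G x) powr p) * indicator Q x \<partial>lborel) \<le> ennreal (m * l powr p)"
  shows "(\<integral>\<^sup>+x. ennreal (norm (G x) powr r) * indicator Q x \<partial>lborel) \<le> ennreal (2 * (m * l powr r))"
proof -
  have "(\<integral>\<^sup>+x. ennreal (norm (G x) powr r) * indicator Q x \<partial>lborel)
    \<le> (\<integral>\<^sup>+x. ennreal (l powr r) * indicator Q x + ennreal (l powr (r - p)) * (ennreal (norm (G x) powr p) * indicator Q x) \<partial>lborel)"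
  proof (rule nn_integral_mono)
    fix x
    have "ennreal (norm (G x) powr r) \<le> ennreal (l powr r + l powr (r - p) * norm (G x) powr p)"
      by (intro ennreal_leI powr_young l r) simp
    then show "ennreal (norm (G x) powr r) * indicator Q x \<le> ennreal (l powr r) * indicator Q x + ennreal (l powr (r - p)) * (ennreal (norm (G x) powr p) * indicator Q x)"
      by (auto simp: indicator_def ennreal_mult)
  qed
  also have "\<dots> = ennreal (l powr r) * ennreal m + ennreal (l powr (r - p)) * (\<integral>\<^sup>+x. ennreal (norm (G x) powr p) * indicator Q x \<partial>lborel)"
    by (subst nn_integral_add) (auto simp: nn_integral_cmult m(2))
  also have "\<dots> \<le> ennreal (l powr r) * ennreal m + ennreal (l powr (r - p)) * ennreal (m * l powr p)"
    by (intro add_left_mono mult_left_mono le) simp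
  also have "\<dots> = ennreal (l powr r * m + l powr (r - p) * (m * l powr p))"
    using m(1) by (simp add: ennreal_mult)
  also have "l powr r * m + l powr (r - p) * (m * l powr p) = 2 * (m * l powr r)"
  proof -
    have "l powr (r - p) * l powr p = l powr r" using l by (simp flip: powr_add)
    then have "l powr (r - p) * (m * l powr p) = m * l powr r" by (simp add: mult_ac)
    then show ?thesis by simp
  qed
  finally show ?thesis .
qed

text \<open>The constant is fixed before T, j and N. The cubes have side 2^(-j), the scale of the
  block, so their volume cancels the dilation factor of the kernel. Nikol'skij's inequality is used
  with exponent min 1 p; passing to it by \<open>nn_integral_powr_young\<close> is the source of the
  2 next to \<open>C\<close>.\<close>

lemma block_fun_bounded:
  fixes \<phi> :: "real^'d::finite \<Rightarrow> complex"
  assumes \<phi>: "resolution_generator \<phi>" and p: "0 < p" "p \<le> u"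
  shows "\<exists>C\<ge>1. \<forall>T (j::nat) N. tempered T \<longrightarrow> 0 < N \<longrightarrow> morrey_norm u p (block_fun \<phi> j T) \<le> ennreal N \<longrightarrow>
    (\<forall>y. norm (block_fun \<phi> j T y) \<le> C * (2 powr (real j * (real CARD('d) / u)) * N))"
proof -
  let ?p = "min 1 p"
  have p': "0 < ?p" "?p \<le> 1" using p by auto
  have K: "conv_kernel \<phi> \<in> schwartz" by (rule conv_kernel_schwartz[OF generator_test_function[OF \<phi>]])
  obtain c where c: "0 \<le> c" "\<And>x. (1 + norm x) ^ (2 * CARD('d)) * norm (conv_kernel \<phi> x) \<le> c"
    using schwartz_decay[OF K] by metis
  define C where "C = 2 ^ CARD('d) * c * weight_const TYPE('d)"
  have C: "C \<ge> 0" using c weight_const_nonneg[where 'd='d] by (simp add: C_def)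
  have main: "norm (block_fun \<phi> j T y) \<le> max 1 ((C * 2) powr (1 / ?p)) * (2 powr (real j * (real CARD('d) / u)) * N)"
    if T: "tempered T" and N: "0 < N" and le: "morrey_norm u p (block_fun \<phi> j T) \<le> ennreal N" for T j N y
  proof -
    let ?G = "block_fun \<phi> j T"
    define m where "m = 2 powr (- real_of_int (int j) * real CARD('d))"
    define l where "l = 2 powr (real j * (real CARD('d) / u)) * N"
    have m0: "m > 0" and l0: "l > 0" using N by (auto simp: m_def l_def)
    have mj: "m * (2 ^ j) ^ CARD('d) = 1"
      by (simp add: m_def powr_realpow[symmetric] powr_powr flip: powr_add)
    have cont: "continuous_on UNIV ?G" by (rule block_fun_continuous[OF \<phi> T])
    have [measurable]: "?G \<in> borel_measurable borel" by (rule borel_measurable_continuous_onI[OF cont])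
    \<comment> \<open>Since m = 2^(-j d), the Morrey bound on a cube says that the p-th mean is at
      most l^p, with l the level in the claim.\<close>
    have ml: "m powr (1 - p / u) * N powr p = m * l powr p"
    proof -
      have "l powr p = 2 powr (real j * (real CARD('d) / u) * p) * N powr p"
        using N by (simp add: l_def powr_mult powr_powr)
      moreover have "m powr (1 - p / u) = m * 2 powr (real j * (real CARD('d) / u) * p)"
        unfolding m_def powr_powr powr_add[symmetric] by (rule arg_cong[where f="\<lambda>t. 2 powr t"]) (simp add: field_simps)
      ultimately show ?thesis by simp
    qed
    have cube_p: "(\<integral>\<^sup>+x. ennreal (norm (?G x) powr p) * indicator (dyadic_cube (int j) k) x \<partial>lborel) \<le> ennreal (m * l powr p)" for k
      using morrey_norm_cube[OF p(1) _ le m_def, of k] N unfolding ml by simp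
    have cube: "(\<integral>\<^sup>+x. ennreal (norm (?G x) powr ?p) * indicator (dyadic_cube (int j) k) x \<partial>lborel) \<le> ennreal (2 * (m * l powr ?p))" for k
      by (intro nn_integral_powr_young[OF _ _ _ _ l0 _ _ cube_p])
         (use m0 p' in \<open>auto simp: emeasure_dyadic_cube m_def\<close>)
    obtain D M where gr: "\<And>y. norm (?G y) \<le> D * (1 + norm y) ^ M" using block_fun_growth[OF \<phi> T] by metis
    have "0 \<le> 2 * (m * l powr ?p)" using m0 by simp
    from nikolskij[OF p' c K cont this block_fun_reproducing[OF \<phi> T] cube gr, of y]
    have "norm (?G y) \<le> (C * (2 ^ j) ^ CARD('d) * (2 * (m * l powr ?p))) powr (1 / ?p)"
      by (simp only: C_def)
    also have "C * (2 ^ j) ^ CARD('d) * (2 * (m * l powr ?p)) = (C * 2) * (m * (2 ^ j) ^ CARD('d)) * l powr ?p"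
      by (simp only: mult_ac)
    also have "\<dots> = (C * 2) * l powr ?p" unfolding mj by simp
    also have "\<dots> powr (1 / ?p) = (C * 2) powr (1 / ?p) * l"
      using C l0 p' by (simp add: powr_mult powr_powr)
    also have "\<dots> \<le> max 1 ((C * 2) powr (1 / ?p)) * l" using l0 by (intro mult_right_mono) auto
    finally show ?thesis unfolding l_def .
  qed
  show ?thesis
    by (intro exI[of _ "max 1 ((C * 2) powr (1 / ?p))"] conjI allI impI main) auto
qed

text \<open>With \<rho> = max r p, the power |G|^\<rho> is at most l^\<rho> and at most l^(\<rho>-p)
  |G|^p; integrating gives the two arguments of the minimum, as p / \<rho> = min 1 (p / r). If p >
  r, the exponent is lowered from p to r afterwards, and the 2 before l pays for that. The number
  \<nu> bounds the ratio N / l.\<close>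

lemma local_Lr_bound:
  fixes G :: "'a::euclidean_space \<Rightarrow> complex"
  assumes [measurable]: "G \<in> borel_measurable borel" "Q \<in> sets borel"
    and m: "0 < m" "emeasure lborel Q = ennreal m" and p: "0 < p" and r: "1 \<le> r"
    and l: "0 < l" "\<And>x. norm (G x) \<le> l" and \<nu>: "0 < \<nu>" and N: "0 \<le> N" "N \<le> l * \<nu>"
    and le: "(\<integral>\<^sup>+x. ennreal (norm (G x) powr p) * indicator Q x \<partial>lborel) \<le> ennreal (m powr (1 - p / u) * N powr p)"
  shows "(\<integral>\<^sup>+x. ennreal (norm (G x) powr r) * indicator Q x \<partial>lborel)
    \<le> ennreal (m * (2 * l * min 1 ((m powr (- 1 / u) * \<nu>) powr min 1 (p / r))) powr r)"
proof -
  define \<mu> where "\<mu> = m powr (- 1 / u) * \<nu>"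
  define \<rho> where "\<rho> = max r p"
  define \<theta> where "\<theta> = min 1 (\<mu> powr (p / \<rho>))"
  have \<mu>: "\<mu> > 0" using m \<nu> by (simp add: \<mu>_def)
  have \<theta>: "\<theta> > 0" using \<mu> by (simp add: \<theta>_def)
  have \<rho>: "\<rho> \<ge> 1" "\<rho> \<ge> p" "\<rho> > 0" using r by (auto simp: \<rho>_def)
  have b1: "(\<integral>\<^sup>+x. ennreal (norm (G x) powr \<rho>) * indicator Q x \<partial>lborel) \<le> ennreal (m * l powr \<rho>)"
  proof -
    have "(\<integral>\<^sup>+x. ennreal (norm (G x) powr \<rho>) * indicator Q x \<partial>lborel) \<le> (\<integral>\<^sup>+x. ennreal (l powr \<rho>) * indicator Q x \<partial>lborel)"
      using l \<rho> by (intro nn_integral_mono mult_right_mono ennreal_leI powr_mono2) auto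
    also have "\<dots> = ennreal (m * l powr \<rho>)" using m by (subst nn_integral_cmult_indicator) (simp_all add: ennreal_mult mult.commute)
    finally show ?thesis .
  qed
  have b2: "(\<integral>\<^sup>+x. ennreal (norm (G x) powr \<rho>) * indicator Q x \<partial>lborel) \<le> ennreal (m * (l * \<mu> powr (p / \<rho>)) powr \<rho>)"
  proof -
    have "(\<integral>\<^sup>+x. ennreal (norm (G x) powr \<rho>) * indicator Q x \<partial>lborel) \<le> (\<integral>\<^sup>+x. ennreal (l powr (\<rho> - p)) * (ennreal (norm (G x) powr p) * indicator Q x) \<partial>lborel)"
    proof (rule nn_integral_mono)
      fix x
      have "norm (G x) powr \<rho> \<le> l powr (\<rho> - p) * norm (G x) powr p"
      proof (cases "G x = 0")
        case False
        then have "norm (G x) powr \<rho> = norm (G x) powr (\<rho> - p) * norm (G x) powr p" by (simp flip: powr_add)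
        also have "\<dots> \<le> l powr (\<rho> - p) * norm (G x) powr p" using l \<rho> by (intro mult_right_mono powr_mono2) auto
        finally show ?thesis .
      qed simp
      then have "ennreal (norm (G x) powr \<rho>) \<le> ennreal (l powr (\<rho> - p) * norm (G x) powr p)" by (rule ennreal_leI)
      then show "ennreal (norm (G x) powr \<rho>) * indicator Q x \<le> ennreal (l powr (\<rho> - p)) * (ennreal (norm (G x) powr p) * indicator Q x)"
        by (auto simp: indicator_def ennreal_mult)
    qed
    also have "\<dots> = ennreal (l powr (\<rho> - p)) * (\<integral>\<^sup>+x. ennreal (norm (G x) powr p) * indicator Q x \<partial>lborel)"
      by (rule nn_integral_cmult) measurable
    also have "\<dots> \<le> ennreal (l powr (\<rho> - p)) * ennreal (m powr (1 - p / u) * N powr p)"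
      by (intro mult_left_mono le) simp
    also have "\<dots> \<le> ennreal (l powr (\<rho> - p)) * ennreal (m powr (1 - p / u) * (l * \<nu>) powr p)"
      using N p by (intro mult_left_mono ennreal_leI powr_mono2) auto
    also have "\<dots> = ennreal (l powr (\<rho> - p) * (m powr (1 - p / u) * (l * \<nu>) powr p))" by (simp add: ennreal_mult)
    also have "l powr (\<rho> - p) * (m powr (1 - p / u) * (l * \<nu>) powr p) = m * (l * \<mu> powr (p / \<rho>)) powr \<rho>"
    proof -
      have "(l * \<mu> powr (p / \<rho>)) powr \<rho> = l powr \<rho> * \<mu> powr p" using l \<mu> \<rho> by (simp add: powr_mult powr_powr)
      also have "\<mu> powr p = m powr (- p / u) * \<nu> powr p" using m \<nu> by (simp add: \<mu>_def powr_mult powr_powr)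
      finally have 1: "m * (l * \<mu> powr (p / \<rho>)) powr \<rho> = l powr \<rho> * (m powr 1 * m powr (- p / u)) * \<nu> powr p" using m by (simp add: mult_ac)
      have "m powr 1 * m powr (- p / u) = m powr (1 - p / u)" unfolding powr_add[symmetric] by simp
      moreover have "l powr \<rho> = l powr (\<rho> - p) * l powr p" using l by (simp flip: powr_add)
      ultimately show ?thesis unfolding 1 using l \<nu> by (simp add: powr_mult mult_ac)
    qed
    finally show ?thesis .
  qed
  have b: "(\<integral>\<^sup>+x. ennreal (norm (G x) powr \<rho>) * indicator Q x \<partial>lborel) \<le> ennreal (m * (l * \<theta>) powr \<rho>)"
    using b1 b2 by (auto simp: \<theta>_def min_def)
  have l\<theta>: "l * \<theta> > 0" using l \<theta> by simp
  have two: "m * (l * \<theta>) powr r \<le> m * (2 * l * \<theta>) powr r" "2 * (m * (l * \<theta>) powr r) \<le> m * (2 * l * \<theta>) powr r"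
  proof -
    have "(2::real) powr 1 \<le> 2 powr r" using r by (intro powr_mono) auto
    then have "2 * (m * (l * \<theta>) powr r) \<le> 2 powr r * (m * (l * \<theta>) powr r)" using m by (intro mult_right_mono) auto
    also have "\<dots> = m * (2 * l * \<theta>) powr r" using l\<theta> by (simp add: powr_mult[symmetric] mult_ac)
    finally show "2 * (m * (l * \<theta>) powr r) \<le> m * (2 * l * \<theta>) powr r" .
    then show "m * (l * \<theta>) powr r \<le> m * (2 * l * \<theta>) powr r" using m by (smt (verit) mult_nonneg_nonneg powr_ge_zero)
  qed
  have main: "(\<integral>\<^sup>+x. ennreal (norm (G x) powr r) * indicator Q x \<partial>lborel) \<le> ennreal (m * (2 * l * \<theta>) powr r)"
  proof (cases "p \<le> r")
    case True
    then have "\<rho> = r" by (simp add: \<rho>_def)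
    from b[unfolded this] show ?thesis by (rule order.trans[OF _ ennreal_leI[OF two(1)]])
  next
    case False
    then have "\<rho> = p" by (simp add: \<rho>_def)
    then have "(\<integral>\<^sup>+x. ennreal (norm (G x) powr r) * indicator Q x \<partial>lborel) \<le> ennreal (2 * (m * (l * \<theta>) powr r))"
      using b False r m by (intro nn_integral_powr_young[where p=p] l\<theta>) auto
    then show ?thesis by (rule order.trans[OF _ ennreal_leI[OF two(2)]])
  qed
  have "p / \<rho> = min 1 (p / r)" using p r by (auto simp: \<rho>_def max_def min_def field_simps)
  then show ?thesis using main unfolding \<theta>_def \<mu>_def by simp
qed

section \<open>Summation over the blocks\<close>

text \<open>Jensen's inequality with weights \<open>L i\<close>; choosing \<open>L i\<close> as a bound for the norm of the \<open>i\<close>-th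
  function turns it into Minkowski's inequality.\<close>

lemma sum_powr_le_weighted:
  fixes a L :: "'i \<Rightarrow> real"
  assumes I: "finite I" and a: "\<And>i. i \<in> I \<Longrightarrow> 0 \<le> a i" and L: "\<And>i. i \<in> I \<Longrightarrow> 0 < L i" and r: "1 \<le> r"
  shows "(\<Sum>i\<in>I. a i) powr r \<le> (\<Sum>i\<in>I. L i) powr (r - 1) * (\<Sum>i\<in>I. L i powr (1 - r) * a i powr r)"
proof -
  \<comment> \<open>Indices with a i = 0 are dropped because convexity of the power is used on the
    open half-line.\<close>
  define S where "S = {i \<in> I. a i > 0}"
  have S: "finite S" "S \<subseteq> I" using I by (auto simp: S_def)
  have sum: "(\<Sum>i\<in>I. a i) = (\<Sum>i\<in>S. a i)"
    using I a by (intro sum.mono_neutral_right) (auto simp: S_def less_le)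
  show ?thesis
  proof (cases "S = {}")
    case True
    then show ?thesis unfolding sum by (auto intro!: mult_nonneg_nonneg sum_nonneg)
  next
    case False
    define T where "T = (\<Sum>i\<in>S. L i)"
    have T: "T > 0" unfolding T_def using S L False by (intro sum_pos) auto
    have "(\<lambda>x. x powr r) (\<Sum>i\<in>S. (L i / T) *\<^sub>R (a i * T / L i)) \<le> (\<Sum>i\<in>S. (L i / T) * (a i * T / L i) powr r)"
    proof (rule convex_on_sum[OF S(1) False powr_convex[OF r]])
      show "(\<Sum>i\<in>S. L i / T) = 1" using T by (simp add: sum_divide_distrib[symmetric] T_def)
      fix i assume "i \<in> S"
      then have "a i > 0" "L i > 0" using L by (auto simp: S_def)
      then show "0 \<le> L i / T" "a i * T / L i \<in> {0<..}" using T by auto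
    qed
    also have "(\<Sum>i\<in>S. (L i / T) *\<^sub>R (a i * T / L i)) = (\<Sum>i\<in>S. a i)"
    proof (intro sum.cong refl)
      fix i assume "i \<in> S"
      then show "(L i / T) *\<^sub>R (a i * T / L i) = a i" using T L S(2) by (auto simp: less_imp_neq[symmetric])
    qed
    also have "(\<Sum>i\<in>S. (L i / T) * (a i * T / L i) powr r) = T powr (r - 1) * (\<Sum>i\<in>S. L i powr (1 - r) * a i powr r)"
      unfolding sum_distrib_left
    proof (intro sum.cong refl)
      fix i assume "i \<in> S"
      then have i: "a i > 0" "L i > 0" using L by (auto simp: S_def)
      have 1: "(a i * T / L i) powr r = a i powr r * T powr r * L i powr (- r)"
        using i T by (simp add: powr_mult powr_divide) (simp add: powr_minus divide_inverse)
      have 2: "L i powr (1 - r) = L i * L i powr (- r)" using i powr_mult_base[of "L i" "- r"] by simp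
      have 3: "T powr (r - 1) = T powr r / T" using T by (simp add: powr_diff)
      show "(L i / T) * (a i * T / L i) powr r = T powr (r - 1) * (L i powr (1 - r) * a i powr r)"
        unfolding 1 2 3 by simp
    qed
    also have "\<dots> \<le> (\<Sum>i\<in>I. L i) powr (r - 1) * (\<Sum>i\<in>I. L i powr (1 - r) * a i powr r)"
    proof (intro mult_mono powr_mono2 sum_mono2 I S)
      show "T \<le> (\<Sum>i\<in>I. L i)" unfolding T_def using L by (intro sum_mono2 I S) (auto intro: less_imp_le)
    qed (use r T in \<open>auto intro!: sum_nonneg\<close>)
    finally show ?thesis unfolding sum .
  qed
qed

text \<open>Minkowski's inequality on Q. With the weights L i, each summand of the Jensen estimate
  integrates to at most m L i, so the sum of the L i is recovered with total power r.\<close>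

lemma nn_integral_powr_sum:
  fixes G :: "'i \<Rightarrow> 'a \<Rightarrow> complex"
  assumes I: "finite I" and [measurable]: "\<And>i. i \<in> I \<Longrightarrow> G i \<in> borel_measurable M" "Q \<in> sets M"
    and L: "\<And>i. i \<in> I \<Longrightarrow> 0 < L i" and r: "1 \<le> r" and m: "0 \<le> m"
    and le: "\<And>i. i \<in> I \<Longrightarrow> (\<integral>\<^sup>+x. ennreal (norm (G i x) powr r) * indicator Q x \<partial>M) \<le> ennreal (m * L i powr r)"
  shows "(\<integral>\<^sup>+x. ennreal (norm (\<Sum>i\<in>I. G i x) powr r) * indicator Q x \<partial>M) \<le> ennreal (m * (\<Sum>i\<in>I. L i) powr r)"
proof (cases "I = {}")
  case False
  let ?L = "\<Sum>i\<in>I. L i"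
  have L0: "?L > 0" using I L False by (intro sum_pos) auto
  have "(\<integral>\<^sup>+x. ennreal (norm (\<Sum>i\<in>I. G i x) powr r) * indicator Q x \<partial>M)
    \<le> (\<integral>\<^sup>+x. ennreal (?L powr (r - 1)) * (\<Sum>i\<in>I. ennreal (L i powr (1 - r)) * (ennreal (norm (G i x) powr r) * indicator Q x)) \<partial>M)"
  proof (rule nn_integral_mono)
    fix x
    have "norm (\<Sum>i\<in>I. G i x) powr r \<le> (\<Sum>i\<in>I. norm (G i x)) powr r"
      using r by (intro powr_mono2 norm_sum) auto
    also have "\<dots> \<le> ?L powr (r - 1) * (\<Sum>i\<in>I. L i powr (1 - r) * norm (G i x) powr r)"
      by (rule sum_powr_le_weighted[OF I _ L r]) auto
    finally have "ennreal (norm (\<Sum>i\<in>I. G i x) powr r) \<le> ennreal (?L powr (r - 1) * (\<Sum>i\<in>I. L i powr (1 - r) * norm (G i x) powr r))"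
      by (rule ennreal_leI)
    also have "\<dots> = ennreal (?L powr (r - 1)) * (\<Sum>i\<in>I. ennreal (L i powr (1 - r)) * ennreal (norm (G i x) powr r))"
      by (simp add: ennreal_mult sum_nonneg flip: sum_ennreal)
    finally show "ennreal (norm (\<Sum>i\<in>I. G i x) powr r) * indicator Q x \<le> ennreal (?L powr (r - 1)) * (\<Sum>i\<in>I. ennreal (L i powr (1 - r)) * (ennreal (norm (G i x) powr r) * indicator Q x))"
      by (cases "x \<in> Q") auto
  qed
  also have "\<dots> = ennreal (?L powr (r - 1)) * (\<Sum>i\<in>I. ennreal (L i powr (1 - r)) * (\<integral>\<^sup>+x. ennreal (norm (G i x) powr r) * indicator Q x \<partial>M))"
    by (simp add: nn_integral_cmult nn_integral_sum)
  also have "\<dots> \<le> ennreal (?L powr (r - 1)) * (\<Sum>i\<in>I. ennreal (L i powr (1 - r)) * ennreal (m * L i powr r))"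
    by (intro mult_left_mono sum_mono le) auto
  also have "(\<Sum>i\<in>I. ennreal (L i powr (1 - r)) * ennreal (m * L i powr r)) = ennreal (m * ?L)"
  proof -
    have "(\<Sum>i\<in>I. ennreal (L i powr (1 - r)) * ennreal (m * L i powr r)) = (\<Sum>i\<in>I. ennreal (m * L i))"
    proof (intro sum.cong refl)
      fix i assume i: "i \<in> I"
      have "L i powr (1 - r) * L i powr r = L i" using L[OF i] by (simp flip: powr_add)
      then have eq: "L i powr (1 - r) * (m * L i powr r) = m * L i" by (simp add: mult_ac)
      have "ennreal (L i powr (1 - r)) * ennreal (m * L i powr r) = ennreal (L i powr (1 - r) * (m * L i powr r))"
        using m by (intro ennreal_mult[symmetric]) auto
      then show "ennreal (L i powr (1 - r)) * ennreal (m * L i powr r) = ennreal (m * L i)" unfolding eq .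
    qed
    also have "\<dots> = ennreal (m * ?L)" using m L by (simp add: sum_ennreal sum_distrib_left less_imp_le)
    finally show ?thesis .
  qed
  also have "ennreal (?L powr (r - 1)) * ennreal (m * ?L) = ennreal (m * ?L powr r)"
  proof -
    have "?L powr (r - 1) * ?L = ?L powr (r - 1) * ?L powr 1" using L0 by simp
    also have "\<dots> = ?L powr r" unfolding powr_add[symmetric] by simp
    finally have "?L powr (r - 1) * (m * ?L) = m * ?L powr r" by (simp add: mult_ac)
    then show ?thesis using m L0 by (simp flip: ennreal_mult)
  qed
  finally show ?thesis .
qed simp

text \<open>Fatou's lemma along the partial sums, for which the finite version is uniform in
  n.\<close>

lemma nn_integral_powr_series:
  fixes G :: "nat \<Rightarrow> 'a \<Rightarrow> complex"
  assumes [measurable]: "\<And>i. G i \<in> borel_measurable M" "Q \<in> sets M"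
    and L: "\<And>i. 0 < L i" "summable L" and r: "1 \<le> r" and m: "0 \<le> m"
    and le: "\<And>i. (\<integral>\<^sup>+x. ennreal (norm (G i x) powr r) * indicator Q x \<partial>M) \<le> ennreal (m * L i powr r)"
    and lim: "AE x in M. (\<lambda>n. \<Sum>i<n. G i x) \<longlonglongrightarrow> g x"
  shows "(\<integral>\<^sup>+x. ennreal (norm (g x) powr r) * indicator Q x \<partial>M) \<le> ennreal (m * suminf L powr r)"
proof -
  let ?u = "\<lambda>n x. ennreal (norm (\<Sum>i<n. G i x) powr r) * indicator Q x"
  have "(\<integral>\<^sup>+x. ennreal (norm (g x) powr r) * indicator Q x \<partial>M) = (\<integral>\<^sup>+x. liminf (\<lambda>n. ?u n x) \<partial>M)"
  proof (rule nn_integral_cong_AE, use lim in eventually_elim)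
    case (elim x)
    have "(\<lambda>n. norm (\<Sum>i<n. G i x) powr r) \<longlonglongrightarrow> norm (g x) powr r"
      using r by (intro tendsto_powr' tendsto_norm elim tendsto_const) auto
    then have "(\<lambda>n. ?u n x) \<longlonglongrightarrow> ennreal (norm (g x) powr r) * indicator Q x"
      by (cases "x \<in> Q") (auto intro: tendsto_ennrealI)
    then show ?case by (simp add: lim_imp_Liminf)
  qed
  also have "\<dots> \<le> liminf (\<lambda>n. \<integral>\<^sup>+x. ?u n x \<partial>M)" by (rule nn_integral_liminf) measurable
  also have "\<dots> \<le> liminf (\<lambda>n::nat. ennreal (m * suminf L powr r))"
  proof (intro Liminf_mono always_eventually allI)
    fix n :: nat
    have "(\<integral>\<^sup>+x. ?u n x \<partial>M) \<le> ennreal (m * (\<Sum>i<n. L i) powr r)"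
      by (rule nn_integral_powr_sum[OF _ _ _ _ r m le]) (use L in auto)
    also have "\<dots> \<le> ennreal (m * suminf L powr r)"
      using r m L by (intro ennreal_leI mult_left_mono powr_mono2 sum_le_suminf sum_nonneg) (auto intro: less_imp_le)
    finally show "(\<integral>\<^sup>+x. ?u n x \<partial>M) \<le> ennreal (m * suminf L powr r)" .
  qed
  also have "\<dots> = ennreal (m * suminf L powr r)" by (simp add: Liminf_const)
  finally show ?thesis .
qed

text \<open>The factor \<open>min 1 (2 powr ((J - j) * a))\<close> measures how much of the \<open>j\<close>-th block a cube of side
  \<open>2 powr (- J)\<close> sees: the blocks \<open>j < J\<close> produce the logarithm, the others a geometric series.\<close>

lemma weighted_sum_bound:
  fixes a \<kappa> :: real and d :: nat
  assumes a: "0 < a" and d: "1 \<le> d" and \<kappa>: "0 \<le> \<kappa>" "\<kappa> \<le> 1"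
  shows "\<exists>C>0. \<forall>(J::int) (b :: nat \<Rightarrow> real) \<beta>. (\<forall>j. 0 \<le> b j \<and> b j \<le> \<beta>) \<longrightarrow>
     (\<forall>n\<ge>1. (\<Sum>j<n. b j) \<le> 2 * real n powr \<kappa> * \<beta>) \<longrightarrow>
     summable (\<lambda>j. b j * min 1 (2 powr ((real_of_int J - real j) * a))) \<and>
     (\<Sum>j. b j * min 1 (2 powr ((real_of_int J - real j) * a)))
       \<le> C * ((1 + 2 powr (- real_of_int J * real d)) powr (- (a / real d)) *
           ln (exp 1 + 1 / 2 powr (- real_of_int J * real d)) powr \<kappa>) * \<beta>"
proof -
  define t where "t = 2 powr (- a)"
  have t: "0 < t" "t < 1" using a by (auto simp: t_def powr_less_one)
  define D where "D = 2 powr (a / real d)"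
  have D: "D > 0" by (simp add: D_def)
  \<comment> \<open>D pays for replacing 1 + m by 2 or by 2 m. In 4 D one factor 2 comes from the
    hypothesis on partial sums and one bounds 2^\<kappa>; 1 / (1 - t) sums the geometric
    tail.\<close>
  define C where "C = 4 * D + D / (1 - t)"
  have main: "summable (\<lambda>j. b j * min 1 (2 powr ((real_of_int J - real j) * a))) \<and>
     (\<Sum>j. b j * min 1 (2 powr ((real_of_int J - real j) * a)))
       \<le> C * ((1 + 2 powr (- real_of_int J * real d)) powr (- (a / real d)) *
           ln (exp 1 + 1 / 2 powr (- real_of_int J * real d)) powr \<kappa>) * \<beta>"
    if b: "\<And>j. 0 \<le> b j" "\<And>j. b j \<le> \<beta>" and H: "\<And>n. n \<ge> 1 \<Longrightarrow> (\<Sum>j<n. b j) \<le> 2 * real n powr \<kappa> * \<beta>"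
    for J :: int and b :: "nat \<Rightarrow> real" and \<beta>
  proof -
    define m where "m = 2 powr (- real_of_int J * real d)"
    define f where "f j = b j * min 1 (2 powr ((real_of_int J - real j) * a))" for j
    \<comment> \<open>For J \<le> 0, a cube of side at least 1, this is 0: there are no blocks below
      J and only the geometric series remains.\<close>
    define n where "n = nat J"
    define E where "E = 2 powr ((real_of_int J - real n) * a)"
    define w where "w = (1 + m) powr (- (a / real d)) * ln (exp 1 + 1 / m) powr \<kappa>"
    have \<beta>: "\<beta> \<ge> 0" using b[of 0] by linarith
    have m: "m > 0" by (simp add: m_def)
    have f0: "f j \<ge> 0" for j using b by (simp add: f_def)
    have tail: "f (i + n) \<le> \<beta> * E * t ^ i" for i
    proof -
      have "f (i + n) \<le> \<beta> * 2 powr ((real_of_int J - real (i + n)) * a)"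
        unfolding f_def using b \<beta> by (intro mult_mono) auto
      also have "2 powr ((real_of_int J - real (i + n)) * a) = E * t ^ i"
        unfolding E_def powr_realpow[OF t(1), symmetric] unfolding t_def powr_powr powr_add[symmetric]
        by (rule arg_cong[where f="\<lambda>s. 2 powr s"]) (simp add: algebra_simps)
      finally show ?thesis by (simp add: mult_ac)
    qed
    have geo: "(\<lambda>i. \<beta> * E * t ^ i) sums (\<beta> * E * (1 / (1 - t)))"
      using t by (intro sums_mult geometric_sums) auto
    have st: "summable (\<lambda>i. f (i + n))"
      by (rule summable_comparison_test'[OF sums_summable[OF geo], of 0]) (use tail f0 in auto)
    then have sf: "summable f" by (rule summable_iff_shift[THEN iffD1])
    have "suminf f = (\<Sum>i. f (i + n)) + (\<Sum>i<n. f i)" by (rule suminf_split_initial_segment[OF sf])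
    also have "(\<Sum>i. f (i + n)) \<le> \<beta> * E * (1 / (1 - t))"
      using suminf_le[OF tail st sums_summable[OF geo]] sums_unique[OF geo] by simp
    also have "(\<Sum>i<n. f i) \<le> (\<Sum>i<n. b i)"
      unfolding f_def using b by (intro sum_mono mult_left_le) auto
    finally have S: "suminf f \<le> \<beta> * E * (1 / (1 - t)) + (\<Sum>i<n. b i)" by simp
    have L1: "ln (exp 1 + 1 / m) \<ge> 1"
    proof -
      have "ln (exp (1::real)) \<le> ln (exp 1 + 1 / m)" using m by (intro ln_mono) (auto simp: add_pos_pos)
      then show ?thesis by simp
    qed
    then have Lk: "ln (exp 1 + 1 / m) powr \<kappa> \<ge> 1" using \<kappa> by (simp add: ge_one_powr_ge_zero)
    have w0: "w \<ge> 0" by (simp add: w_def)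
    have Dinv: "D * 2 powr (- (a / real d)) = 1" unfolding D_def by (simp flip: powr_add)
    have key: "E \<le> D * w \<and> (\<Sum>i<n. b i) \<le> 4 * (D * w) * \<beta>"
    proof (cases "J \<ge> 1")
      case True
      then have n: "real n = real_of_int J" "n \<ge> 1" by (auto simp: n_def)
      have "m \<le> 2 powr 0" unfolding m_def using True by (intro powr_mono) (auto simp: mult_le_0_iff)
      then have "2 powr (- (a / real d)) \<le> (1 + m) powr (- (a / real d))" using m a by (intro powr_mono2') auto
      then have "D * 2 powr (- (a / real d)) \<le> D * (1 + m) powr (- (a / real d))" using D by (intro mult_left_mono) auto
      then have Dw: "1 \<le> D * (1 + m) powr (- (a / real d))" unfolding Dinv .
      then have Dw': "ln (exp 1 + 1 / m) powr \<kappa> \<le> D * w"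
        using mult_right_mono[OF Dw, of "ln (exp 1 + 1 / m) powr \<kappa>"] by (simp add: w_def mult_ac)
      have E: "E \<le> D * w" using Lk Dw' n by (simp add: E_def)
      \<comment> \<open>ln (1 / m) = J d ln 2 and ln 2 \<ge> 1/2, so the number of blocks below J is
        at most twice the logarithm.\<close>
      have "real n \<le> 2 * ln (exp 1 + 1 / m)"
      proof -
        have "1 / m = 2 powr (real n * real d)" by (simp add: m_def n powr_minus divide_simps)
        then have "ln (1 / m) = real n * real d * ln 2" by (simp add: ln_powr)
        moreover have "real n * 1 * (1/2) \<le> real n * real d * ln 2"
          using d ln2_ge_two_thirds by (intro mult_mono) auto
        moreover have "ln (1 / m) \<le> ln (exp 1 + 1 / m)" using m by (intro ln_mono) (auto simp: add_pos_pos)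
        ultimately show ?thesis by linarith
      qed
      then have "real n powr \<kappa> \<le> (2 * ln (exp 1 + 1 / m)) powr \<kappa>" using \<kappa> by (intro powr_mono2) auto
      also have "\<dots> = 2 powr \<kappa> * ln (exp 1 + 1 / m) powr \<kappa>" by (rule powr_mult)
      also have "\<dots> \<le> 2 powr 1 * (D * w)" using \<kappa> Dw' by (intro mult_mono powr_mono) auto
      finally have "2 * real n powr \<kappa> * \<beta> \<le> 2 * (2 * (D * w)) * \<beta>" using \<beta> by (intro mult_right_mono mult_left_mono) auto
      from order.trans[OF H[OF n(2)] this] have "(\<Sum>i<n. b i) \<le> 2 * (2 * (D * w)) * \<beta>" .
      also have "\<dots> = 4 * (D * w) * \<beta>" by simp
      finally show ?thesis using E by blast
    next
      case False
      then have n: "n = 0" by (simp add: n_def)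
      \<comment> \<open>Large cubes: 1 + m \<le> 2 m and E = m^(-a/d), so the decay in the size of
        the cube comes from the geometric part.\<close>
      have "m \<ge> 2 powr 0" unfolding m_def using False by (intro powr_mono) (auto simp: mult_nonpos_nonneg)
      then have "(2 * m) powr (- (a / real d)) \<le> (1 + m) powr (- (a / real d))" using m a by (intro powr_mono2') auto
      moreover have "(2 * m) powr (- (a / real d)) = 2 powr (- (a / real d)) * E"
        using m d by (simp add: powr_mult m_def E_def n powr_powr)
      ultimately have "D * (2 powr (- (a / real d)) * E) \<le> D * (1 + m) powr (- (a / real d))" using D by (intro mult_left_mono) auto
      then have "E \<le> D * (1 + m) powr (- (a / real d))" using Dinv by (simp flip: mult.assoc)
      also have "\<dots> \<le> D * (1 + m) powr (- (a / real d)) * ln (exp 1 + 1 / m) powr \<kappa>"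
        using mult_left_mono[OF Lk, of "D * (1 + m) powr (- (a / real d))"] D by simp
      finally show ?thesis using n D w0 \<beta> by (simp add: w_def mult_ac)
    qed
    have "\<beta> * E * (1 / (1 - t)) \<le> \<beta> * (D * w) * (1 / (1 - t))"
      using key \<beta> t by (intro mult_right_mono mult_left_mono) auto
    then have "suminf f \<le> \<beta> * (D * w) * (1 / (1 - t)) + 4 * (D * w) * \<beta>" using S key by linarith
    also have "\<dots> = C * w * \<beta>" by (simp add: C_def algebra_simps)
    finally show ?thesis using sf unfolding f_def[abs_def] w_def m_def by simp
  qed
  have "C > 0" unfolding C_def using D t by (intro add_pos_pos divide_pos_pos) auto
  then show ?thesis
    by (intro exI[of _ C] conjI[of "C > 0"] allI impI, assumption) (rule main; simp)
qed

section \<open>Partial sums of q-summable sequences\<close>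

lemma inv_conj_exponent_bounds: "0 \<le> inv_conj_exponent q" "inv_conj_exponent q \<le> 1"
  by (auto simp: inv_conj_exponent_def)

lemma lq_partial_sum:
  fixes b :: "nat \<Rightarrow> real"
  assumes b: "\<And>j. 0 \<le> b j" and \<beta>: "0 < \<beta>" and q: "0 < q"
    and inf: "q = \<infinity> \<Longrightarrow> b j \<le> \<beta>"
    and fin: "\<And>n. q \<noteq> \<infinity> \<Longrightarrow> (\<Sum>j<n. b j powr enn2real q) \<le> \<beta> powr enn2real q"
  shows "b j \<le> \<beta>"
proof (cases "q = \<infinity>")
  case False
  have q': "enn2real q > 0" using q False by (simp add: enn2real_positive_iff less_top)
  have "b j powr enn2real q \<le> (\<Sum>j<Suc j. b j powr enn2real q)"
    by (intro member_le_sum) auto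
  also have "\<dots> \<le> \<beta> powr enn2real q" by (rule fin[OF False])
  finally have "(b j powr enn2real q) powr (1 / enn2real q) \<le> (\<beta> powr enn2real q) powr (1 / enn2real q)"
    by (rule powr_mono2[rotated 2]) (use q' in auto)
  moreover have "(b j powr enn2real q) powr (1 / enn2real q) = b j" "(\<beta> powr enn2real q) powr (1 / enn2real q) = \<beta>"
    using q' b[of j] \<beta> by (simp_all add: powr_powr)
  ultimately show ?thesis by simp
qed (rule inf)

text \<open>For q \<le> 1, b j is at most \<beta>^(1-q) (b j)^q. For 1 < q < \<infinity> this is
  Hoelder's inequality with constant 2, by splitting at the level \<beta> n^(-1/q), where both parts
  contribute n^(1-1/q) \<beta>. For q = \<infinity> each term is at most \<beta>.\<close>

lemma lq_sum_le:
  fixes b :: "nat \<Rightarrow> real"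
  assumes b: "\<And>j. 0 \<le> b j" and \<beta>: "0 < \<beta>" and q: "0 < q"
    and inf: "\<And>j. q = \<infinity> \<Longrightarrow> b j \<le> \<beta>"
    and fin: "\<And>n. q \<noteq> \<infinity> \<Longrightarrow> (\<Sum>j<n. b j powr enn2real q) \<le> \<beta> powr enn2real q"
    and n: "1 \<le> n"
  shows "(\<Sum>j<n. b j) \<le> 2 * real n powr inv_conj_exponent q * \<beta>"
proof (cases "q = \<infinity>")
  case True
  have "(\<Sum>j<n. b j) \<le> (\<Sum>j<n. \<beta>)" by (intro sum_mono inf True)
  also have "\<dots> \<le> 2 * real n * \<beta>" using \<beta> by simp
  finally show ?thesis using True n by (simp add: inv_conj_exponent_def)
next
  case False
  define s where "s = enn2real q"
  have s: "s > 0" using q False by (simp add: s_def enn2real_positive_iff less_top)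
  have inv: "enn2real (1 / q) = 1 / s"
    using False q by (cases q) (auto simp: s_def divide_ennreal ennreal_1[symmetric] simp del: ennreal_1)
  have bb: "b j \<le> \<beta>" for j by (rule lq_partial_sum[OF b \<beta> q inf fin])
  have fin': "(\<Sum>j<n. b j powr s) \<le> \<beta> powr s" using fin[OF False] by (simp add: s_def)
  show ?thesis
  proof (cases "s \<le> 1")
    case True
    have "(\<Sum>j<n. b j) \<le> (\<Sum>j<n. \<beta> powr (1 - s) * b j powr s)"
    proof (rule sum_mono)
      fix j
      show "b j \<le> \<beta> powr (1 - s) * b j powr s"
      proof (cases "b j = 0")
        case False
        then have "b j > 0" using b[of j] by simp
        then have "b j = b j powr (1 - s) * b j powr s" by (simp flip: powr_add)
        also have "\<dots> \<le> \<beta> powr (1 - s) * b j powr s" using True bb[of j] b[of j] by (intro mult_right_mono powr_mono2) auto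
        finally show ?thesis .
      qed simp
    qed
    also have "\<dots> \<le> \<beta> powr (1 - s) * \<beta> powr s" unfolding sum_distrib_left[symmetric] by (intro mult_left_mono fin') simp
    also have "\<dots> = \<beta>" using \<beta> by (simp flip: powr_add)
    also have "\<dots> \<le> 2 * \<beta>" using \<beta> by simp
    moreover have "1 - 1 / s \<le> 0" using True s by (simp add: field_simps)
    ultimately show ?thesis using n by (simp add: inv_conj_exponent_def inv max_def)
  next
    case False
    define l where "l = \<beta> * real n powr (- 1 / s)"
    have l: "l > 0" using \<beta> n by (simp add: l_def)
    have "(\<Sum>j<n. b j) \<le> (\<Sum>j<n. l + l powr (1 - s) * b j powr s)"
    proof (rule sum_mono)
      fix j
      show "b j \<le> l + l powr (1 - s) * b j powr s"
      proof (cases "b j \<le> l")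
        case False
        then have "b j > 0" using l by simp
        then have "b j = b j powr (1 - s) * b j powr s" by (simp flip: powr_add)
        also have "\<dots> \<le> l powr (1 - s) * b j powr s"
          using False l \<open>\<not> s \<le> 1\<close> by (intro mult_right_mono powr_mono2') auto
        finally show ?thesis using l by simp
      qed (simp add: add_increasing2)
    qed
    also have "\<dots> = real n * l + l powr (1 - s) * (\<Sum>j<n. b j powr s)" by (simp add: sum.distrib sum_distrib_left)
    also have "\<dots> \<le> real n * l + l powr (1 - s) * \<beta> powr s" by (intro add_left_mono mult_left_mono fin') simp
    also have "real n * l = real n powr (1 - 1 / s) * \<beta>"
    proof -
      have "real n * l = (real n powr 1 * real n powr (- 1 / s)) * \<beta>" using n by (simp add: l_def mult_ac)
      also have "real n powr 1 * real n powr (- 1 / s) = real n powr (1 - 1 / s)" unfolding powr_add[symmetric] by simp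
      finally show ?thesis .
    qed
    also have "l powr (1 - s) * \<beta> powr s = real n powr (1 - 1 / s) * \<beta>"
    proof -
      have "l powr (1 - s) = \<beta> powr (1 - s) * real n powr ((- 1 / s) * (1 - s))"
        using \<beta> n by (simp add: l_def powr_mult powr_powr)
      also have "(- 1 / s) * (1 - s) = 1 - 1 / s" using s by (simp add: field_simps)
      finally have "l powr (1 - s) * \<beta> powr s = real n powr (1 - 1 / s) * (\<beta> powr (1 - s) * \<beta> powr s)" by (simp add: mult_ac)
      also have "\<beta> powr (1 - s) * \<beta> powr s = \<beta>" using \<beta> by (simp flip: powr_add)
      finally show ?thesis .
    qed
    finally have "(\<Sum>j<n. b j) \<le> 2 * real n powr (1 - 1 / s) * \<beta>" by (simp add: mult_ac)
    moreover have "max (1 - 1 / s) 0 = 1 - 1 / s" using False by (simp add: max_def field_simps)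
    ultimately show ?thesis unfolding inv_conj_exponent_def inv by simp
  qed
qed

section \<open>The embedding\<close>

text \<open>An infinite Morrey norm of one block would make the whole norm infinite, so the norms
  are real numbers. Partial sums keep the later q-summability estimates finite and
  elementary.\<close>

lemma besov_morrey_blocks:
  fixes \<phi> :: "real^'d::finite \<Rightarrow> complex"
  assumes \<phi>: "resolution_generator \<phi>" and f: "f \<in> besov_morrey \<phi> s u p q" and q: "0 < q"
  obtains N :: "nat \<Rightarrow> real" where "\<And>j. 0 \<le> N j" "\<And>j. morrey_norm u p (block_fun \<phi> j f) = ennreal (N j)"
    "\<And>j. q = \<infinity> \<Longrightarrow> 2 powr (real j * s) * N j \<le> enn2real (besov_morrey_norm \<phi> s u p q f)"
    "\<And>n. q \<noteq> \<infinity> \<Longrightarrow> (\<Sum>j<n. (2 powr (real j * s) * N j) powr enn2real q)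
        \<le> enn2real (besov_morrey_norm \<phi> s u p q f) powr enn2real q"
proof -
  have T: "tempered f" and fin: "besov_morrey_norm \<phi> s u p q f < \<infinity>"
    using f by (auto simp: besov_morrey_def)
  define M where "M j = distr_morrey_norm u p (frequency_block \<phi> j f)" for j
  define \<beta> where "\<beta> = enn2real (besov_morrey_norm \<phi> s u p q f)"
  have \<beta>: "besov_morrey_norm \<phi> s u p q f = ennreal \<beta>" using fin by (simp add: \<beta>_def)
  have MB: "morrey_norm u p (block_fun \<phi> j f) = M j" for j
    unfolding M_def by (rule distr_morrey_norm_block[OF \<phi> T, symmetric])
  show ?thesis
  proof (cases "q = \<infinity>")
    case True
    have le: "ennreal (2 powr (real j * s)) * M j \<le> ennreal \<beta>" for j
      unfolding \<beta>[symmetric] besov_morrey_norm_def M_def using True by (auto intro: SUP_upper)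
    have Mfin: "M j \<noteq> \<infinity>" for j
    proof
      assume "M j = \<infinity>"
      then show False using le[of j] by (simp add: ennreal_mult_top top_unique)
    qed
    have M: "M j = ennreal (enn2real (M j))" for j using Mfin[of j] by (simp add: less_top)
    show ?thesis
    proof (rule that[of "\<lambda>j. enn2real (M j)"])
      show "2 powr (real j * s) * enn2real (M j) \<le> enn2real (besov_morrey_norm \<phi> s u p q f)" for j
      proof -
        have "ennreal (2 powr (real j * s) * enn2real (M j)) \<le> ennreal \<beta>"
          using le[of j] by (subst (asm) M) (simp add: ennreal_mult)
        then show ?thesis by (subst (asm) ennreal_le_iff) (auto simp: \<beta>_def)
      qed
    qed (use MB M True in auto)
  next
    case False
    define a where "a = enn2real q"
    have a: "a > 0" using q False by (simp add: a_def enn2real_positive_iff less_top)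
    let ?t = "\<lambda>j. ennreal (2 powr (real j * s * a)) * epowr (M j) a"
    have n: "besov_morrey_norm \<phi> s u p q f = epowr (\<Sum>j. ?t j) (1 / a)"
      using False by (simp add: besov_morrey_norm_def M_def a_def)
    have S: "(\<Sum>j. ?t j) \<noteq> \<infinity>" using fin unfolding n by (auto simp: epowr_def)
    then obtain S where S': "(\<Sum>j. ?t j) = ennreal S" "S \<ge> 0" by (cases "\<Sum>j. ?t j") auto
    have "ennreal \<beta> = ennreal (S powr (1 / a))" unfolding \<beta>[symmetric] n S'(1) epowr_ennreal[OF S'(2)] ..
    then have "\<beta> = S powr (1 / a)" by (simp add: \<beta>_def)
    then have \<beta>S: "\<beta> powr a = S" using a S'(2) by (simp add: powr_powr)
    have tfin: "?t j \<noteq> \<infinity>" for j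
    proof -
      have "sum ?t {j} \<le> (\<Sum>j. ?t j)" by (rule sum_le_suminf) auto
      then show ?thesis using S'(1) by (auto simp: top_unique)
    qed
    have Mfin: "M j \<noteq> \<infinity>" for j
    proof
      assume "M j = \<infinity>"
      then have "?t j = \<infinity>" by (simp add: epowr_def ennreal_mult_top)
      then show False using tfin by blast
    qed
    have M: "M j = ennreal (enn2real (M j))" for j using Mfin[of j] by (simp add: less_top)
    have t: "?t j = ennreal ((2 powr (real j * s) * enn2real (M j)) powr a)" for j
      by (subst M, subst epowr_ennreal) (simp_all add: powr_mult powr_powr ennreal_mult)
    show ?thesis
    proof (rule that[of "\<lambda>j. enn2real (M j)"])
      fix n
      have "sum ?t {..<n} \<le> (\<Sum>j. ?t j)" by (rule sum_le_suminf) auto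
      then have "ennreal (\<Sum>j<n. (2 powr (real j * s) * enn2real (M j)) powr a) \<le> ennreal S"
        unfolding t S'(1)[unfolded t] by (simp add: sum_ennreal)
      then have "(\<Sum>j<n. (2 powr (real j * s) * enn2real (M j)) powr a) \<le> S" using S'(2) by (simp add: ennreal_le_iff)
      then show "(\<Sum>j<n. (2 powr (real j * s) * enn2real (M j)) powr enn2real q)
        \<le> enn2real (besov_morrey_norm \<phi> s u p q f) powr enn2real q"
        by (simp add: \<beta>S[symmetric] \<beta>_def a_def)
    qed (use MB M False in auto)
  qed
qed

text \<open>Summable L_1 norms, uniform over unit cubes, make the sum of the |G j| integrable
  against a fixed decaying weight (\<open>dyadic_weight_bound\<close> at scale 1), hence finite
  almost everywhere. That sum dominates the partial sums tested with \<psi>, whose limit T \<psi> is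
  already known.\<close>

lemma block_series_represents:
  fixes \<phi> :: "real^'d::finite \<Rightarrow> complex"
  assumes \<phi>: "resolution_generator \<phi>" and T: "tempered T"
    and L: "\<And>j. 0 \<le> L j" "summable L"
    and le: "\<And>j k. (\<integral>\<^sup>+x. ennreal (norm (block_fun \<phi> j T x)) * indicator (dyadic_cube 0 k) x \<partial>lborel) \<le> ennreal (L j)"
  shows "\<exists>g. represents g T \<and> (AE x in lborel. (\<lambda>n. \<Sum>j<n. block_fun \<phi> j T x) \<longlonglongrightarrow> g x)"
proof -
  let ?n = "2 * CARD('d)"
  define G where "G j = block_fun \<phi> j T" for j
  have [measurable]: "G j \<in> borel_measurable borel" for j
    unfolding G_def by (rule borel_measurable_continuous_onI[OF block_fun_continuous[OF \<phi> T]])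
  define h where "h x = (\<Sum>j. ennreal (norm (G j x)))" for x
  have [measurable]: "h \<in> borel_measurable borel" unfolding h_def[abs_def] by measurable
  have cube: "(\<integral>\<^sup>+x. h x * indicator (dyadic_cube 0 k) x \<partial>lborel) \<le> ennreal (suminf L)" for k
  proof -
    have "(\<integral>\<^sup>+x. h x * indicator (dyadic_cube 0 k) x \<partial>lborel) = (\<integral>\<^sup>+x. (\<Sum>j. ennreal (norm (G j x)) * indicator (dyadic_cube 0 k) x) \<partial>lborel)"
      by (simp add: h_def)
    also have "\<dots> = (\<Sum>j. \<integral>\<^sup>+x. ennreal (norm (G j x)) * indicator (dyadic_cube 0 k) x \<partial>lborel)"
      by (rule nn_integral_suminf) measurable
    also have "\<dots> \<le> (\<Sum>j. ennreal (L j))" by (intro suminf_le) (auto intro: le simp: G_def)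
    also have "\<dots> = ennreal (suminf L)" using L by (intro suminf_ennreal2) auto
    finally show ?thesis .
  qed
  have "(\<integral>\<^sup>+x. h x * ennreal (1 / (1 + norm x) ^ ?n) \<partial>lborel) \<le> ennreal (weight_const TYPE('d)) * ennreal (suminf L)"
    using dyadic_weight_bound[of h 0 "ennreal (suminf L)" 0, OF _ cube] by simp
  also have "\<dots> < \<infinity>" by (simp add: ennreal_mult_less_top)
  finally have fin: "(\<integral>\<^sup>+x. h x * ennreal (1 / (1 + norm x) ^ ?n) \<partial>lborel) < \<infinity>" .
  have hfin: "AE x in lborel. h x \<noteq> \<infinity>"
  proof -
    have "AE x in lborel. h x * ennreal (1 / (1 + norm x) ^ ?n) \<noteq> \<infinity>"
      using fin by (intro nn_integral_PInf_AE) auto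
    then show ?thesis
    proof eventually_elim
      case (elim x)
      have "1 + norm x \<noteq> 0" using norm_ge_zero[of x] by linarith
      then show ?case using elim by (auto simp: ennreal_top_mult)
    qed
  qed
  define g where "g x = (\<Sum>j. G j x)" for x
  have [measurable]: "g \<in> borel_measurable borel" unfolding g_def[abs_def] by measurable
  \<comment> \<open>The real-valued dominating function; where h is infinite, a null set, it takes
    the default value 0.\<close>
  define D where "D x = enn2real (h x)" for x
  have [measurable]: "D \<in> borel_measurable borel" unfolding D_def[abs_def] by measurable
  have sm: "summable (\<lambda>j. norm (G j x))" if "h x \<noteq> \<infinity>" for x
    using that unfolding h_def by (intro summable_suminf_not_top) auto
  have D: "D x = (\<Sum>j. norm (G j x))" if "h x \<noteq> \<infinity>" for x
  proof -
    have "h x = ennreal (\<Sum>j. norm (G j x))"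
      unfolding h_def by (rule suminf_ennreal2[OF _ sm[OF that]]) simp
    moreover have "(\<Sum>j. norm (G j x)) \<ge> 0" by (rule suminf_nonneg[OF sm[OF that]]) simp
    ultimately show ?thesis unfolding D_def by (simp only: enn2real_ennreal)
  qed
  have lim: "(\<lambda>n. \<Sum>j<n. G j x) \<longlonglongrightarrow> g x" if "h x \<noteq> \<infinity>" for x
    unfolding g_def by (intro summable_LIMSEQ summable_norm_cancel[OF sm[OF that]])
  have gD: "norm (g x) \<le> D x" if "h x \<noteq> \<infinity>" for x
    unfolding D[OF that] g_def by (rule summable_norm[OF sm[OF that]])
  have SD: "norm (\<Sum>j<n. G j x) \<le> D x" if "h x \<noteq> \<infinity>" for x n
  proof -
    have "norm (\<Sum>j<n. G j x) \<le> (\<Sum>j<n. norm (G j x))" by (rule norm_sum)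
    also have "\<dots> \<le> D x" unfolding D[OF that] by (intro sum_le_suminf sm that) auto
    finally show ?thesis .
  qed
  have GD: "norm (G j x) \<le> D x" if "h x \<noteq> \<infinity>" for x j
    unfolding D[OF that] using sum_le_suminf[OF sm[OF that], of "{j}"] by simp
  have Dint: "integrable lborel (\<lambda>x. D x * norm (w x))"
    if [measurable]: "w \<in> borel_measurable borel" and B: "\<And>x. norm (w x) \<le> B" and R: "\<And>x. norm x > R \<Longrightarrow> w x = 0"
    for w :: "real^'d \<Rightarrow> complex" and B R
    unfolding integrable_iff_bounded
  proof
    define c where "c = \<bar>B\<bar> * (1 + \<bar>R\<bar>) ^ ?n"
    have "(\<integral>\<^sup>+x. ennreal (norm (D x * norm (w x))) \<partial>lborel) \<le> (\<integral>\<^sup>+x. ennreal c * (h x * ennreal (1 / (1 + norm x) ^ ?n)) \<partial>lborel)"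
    proof (rule nn_integral_mono)
      fix x :: "real^'d"
      have p: "0 < (1 + norm x) ^ ?n" by (simp add: add_pos_nonneg)
      have "norm (w x) \<le> c * (1 / (1 + norm x) ^ ?n)"
      proof (cases "norm x > R")
        case True
        then show ?thesis using R p by (simp add: c_def)
      next
        case False
        have "norm (w x) * (1 + norm x) ^ ?n \<le> \<bar>B\<bar> * (1 + \<bar>R\<bar>) ^ ?n"
          using B[of x] False by (intro mult_mono power_mono) auto
        then show ?thesis using p by (simp add: c_def pos_le_divide_eq)
      qed
      then have "ennreal (norm (w x)) \<le> ennreal (c * (1 / (1 + norm x) ^ ?n))" by (rule ennreal_leI)
      also have "\<dots> = ennreal c * ennreal (1 / (1 + norm x) ^ ?n)" by (intro ennreal_mult) (auto simp: c_def)
      finally have wc: "ennreal (norm (w x)) \<le> ennreal c * ennreal (1 / (1 + norm x) ^ ?n)" .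
      have "ennreal (norm (D x * norm (w x))) = ennreal (D x) * ennreal (norm (w x))"
        by (simp add: D_def abs_mult ennreal_mult)
      also have "\<dots> \<le> h x * (ennreal c * ennreal (1 / (1 + norm x) ^ ?n))"
        by (intro mult_mono wc) (auto simp: D_def ennreal_enn2real_if)
      finally show "ennreal (norm (D x * norm (w x))) \<le> ennreal c * (h x * ennreal (1 / (1 + norm x) ^ ?n))"
        by (simp add: mult_ac)
    qed
    also have "\<dots> = ennreal c * (\<integral>\<^sup>+x. h x * ennreal (1 / (1 + norm x) ^ ?n) \<partial>lborel)"
      by (rule nn_integral_cmult) measurable
    also have "\<dots> < \<infinity>" using fin by (simp add: ennreal_mult_less_top)
    finally show "(\<integral>\<^sup>+x. ennreal (norm (D x * norm (w x))) \<partial>lborel) < \<infinity>" .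
  qed measurable
  have "represents g T" unfolding represents_def
  proof (intro conjI ballI)
    show "locally_integrable g" unfolding locally_integrable_def
    proof (intro allI impI)
      fix K :: "(real^'d) set" assume K: "compact K"
      have [measurable]: "K \<in> sets borel" by (rule borel_closed[OF compact_imp_closed[OF K]])
      obtain R where R: "\<And>x. x \<in> K \<Longrightarrow> norm x \<le> R" using compact_imp_bounded[OF K] by (auto simp: bounded_iff)
      let ?w = "\<lambda>x. complex_of_real (indicat_real K x)"
      have "integrable lborel (\<lambda>x. D x * norm (?w x))"
        by (rule Dint[of _ 1 R]) (use R in \<open>force simp: indicator_def\<close>)+
      then have "integrable lborel (\<lambda>x. indicat_real K x *\<^sub>R g x)"
      proof (rule Bochner_Integration.integrable_bound)
        show "AE x in lborel. norm (indicat_real K x *\<^sub>R g x) \<le> norm (D x * norm (?w x))"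
          using hfin by eventually_elim (auto simp: indicator_def intro!: order.trans[OF gD abs_ge_self])
      qed measurable
      moreover have "(\<lambda>x. indicat_real K x *\<^sub>R g x) \<in> borel_measurable lborel" by measurable
      ultimately show "set_integrable lebesgue K g"
        unfolding set_integrable_def by (simp add: integrable_completion)
    qed
  next
    fix \<psi> :: "real^'d \<Rightarrow> complex" assume \<psi>: "\<psi> \<in> test_functions"
    note [measurable] = test_function_measurable[OF \<psi>]
    obtain R where R: "\<And>x. norm x > R \<Longrightarrow> \<psi> x = 0" using test_function_support[OF \<psi>] by metis
    obtain B where B: "\<And>x. norm (\<psi> x) \<le> B" using schwartz_bounded[OF test_function_schwartz[OF \<psi>]] by metis
    have Di: "integrable lborel (\<lambda>x. D x * norm (\<psi> x))" by (rule Dint[OF _ B R]) measurable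
    have Gi: "integrable lborel (\<lambda>x. G j x * \<psi> x)" for j
    proof (rule Bochner_Integration.integrable_bound[OF Di])
      show "AE x in lborel. norm (G j x * \<psi> x) \<le> norm (D x * norm (\<psi> x))"
        using hfin
      proof eventually_elim
        case (elim x)
        then show ?case using GD[of x j] by (auto simp: norm_mult abs_mult D_def intro!: mult_right_mono)
      qed
    qed measurable
    have "(\<lambda>n. \<integral>x. (\<Sum>j<n. G j x) * \<psi> x \<partial>lborel) \<longlonglongrightarrow> (\<integral>x. g x * \<psi> x \<partial>lborel)"
    proof (rule integral_dominated_convergence[OF _ _ Di])
      show "AE x in lborel. (\<lambda>n. (\<Sum>j<n. G j x) * \<psi> x) \<longlonglongrightarrow> g x * \<psi> x"
        using hfin by eventually_elim (intro tendsto_mult lim tendsto_const)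
      show "AE x in lborel. norm ((\<Sum>j<n. G j x) * \<psi> x) \<le> D x * norm (\<psi> x)" for n
        using hfin by eventually_elim (auto simp: norm_mult intro!: mult_right_mono SD)
    qed measurable
    moreover have "(\<integral>x. (\<Sum>j<n. G j x) * \<psi> x \<partial>lborel) = (\<Sum>j<n. \<integral>x. G j x * \<psi> x \<partial>lborel)" for n
      using Gi by (simp add: sum_distrib_right)
    ultimately have "(\<lambda>n. \<Sum>j<n. \<integral>x. G j x * \<psi> x \<partial>lborel) \<longlonglongrightarrow> (\<integral>x. g x * \<psi> x \<partial>lborel)" by simp
    \<comment> \<open>\<open>block_sum_tendsto\<close> includes the index n in the sum, hence the
      shift by one.\<close>
    then have "(\<lambda>n. \<Sum>j\<le>n. \<integral>x. G j x * \<psi> x \<partial>lborel) \<longlonglongrightarrow> (\<integral>x. g x * \<psi> x \<partial>lborel)"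
      unfolding lessThan_Suc_atMost[symmetric] by (rule LIMSEQ_Suc)
    then have "T \<psi> = (\<integral>x. g x * \<psi> x \<partial>lborel)"
      using block_sum_tendsto[OF \<phi> T \<psi>] unfolding G_def by (rule LIMSEQ_unique[rotated])
    moreover have "(\<lambda>x. g x * \<psi> x) \<in> borel_measurable lborel" by measurable
    ultimately show "T \<psi> = (LINT x|lebesgue. g x * \<psi> x)" by (simp add: integral_completion)
  qed
  moreover have "AE x in lborel. (\<lambda>n. \<Sum>j<n. block_fun \<phi> j T x) \<longlonglongrightarrow> g x"
    using hfin by eventually_elim (use lim in \<open>simp add: G_def\<close>)
  ultimately show ?thesis by blast
qed

text \<open>With \<nu> = 2^(-j d/u) the quantity m^(-1/u) \<nu> is 2^((J-j) d/u), so the minimum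
  compares the side of the cube with the scale of the block. C \<ge> 1 guarantees N \<le> l
  \<nu>.\<close>

lemma block_Lr_bound:
  fixes \<phi> :: "real^'d::finite \<Rightarrow> complex"
  assumes \<phi>: "resolution_generator \<phi>" and p: "0 < p" "p \<le> u" and T: "tempered T" and C: "1 \<le> C"
    and bnd: "\<And>(j::nat) N y. 0 < N \<Longrightarrow> morrey_norm u p (block_fun \<phi> j T) \<le> ennreal N \<Longrightarrow>
       norm (block_fun \<phi> j T y) \<le> C * (2 powr (real j * (real CARD('d) / u)) * N)"
    and N: "0 < N" "morrey_norm u p (block_fun \<phi> j T) \<le> ennreal N" and r: "1 \<le> r"
    and m: "m = 2 powr (- real_of_int J * real CARD('d))"
  shows "(\<integral>\<^sup>+x. ennreal (norm (block_fun \<phi> j T x) powr r) * indicator (dyadic_cube J k) x \<partial>lborel)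
    \<le> ennreal (m * (2 * (C * (2 powr (real j * (real CARD('d) / u)) * N)) *
         min 1 (2 powr ((real_of_int J - real j) * (real CARD('d) / u * min 1 (p / r))))) powr r)"
proof -
  let ?s = "real CARD('d) / u"
  let ?l = "C * (2 powr (real j * ?s) * N)"
  define \<nu> where "\<nu> = 2 powr (- (real j * ?s))"
  have u: "u > 0" using p by simp
  have "2 powr (real j * ?s) * \<nu> = 1" unfolding \<nu>_def by (simp flip: powr_add)
  then have "?l * \<nu> = C * N" by (simp add: mult_ac)
  then have Nl: "N \<le> ?l * \<nu>" using C N(1) by simp
  have "(\<integral>\<^sup>+x. ennreal (norm (block_fun \<phi> j T x) powr r) * indicator (dyadic_cube J k) x \<partial>lborel)
    \<le> ennreal (m * (2 * ?l * min 1 ((m powr (- 1 / u) * \<nu>) powr min 1 (p / r))) powr r)"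
  proof (rule local_Lr_bound)
    show "block_fun \<phi> j T \<in> borel_measurable borel"
      by (rule borel_measurable_continuous_onI[OF block_fun_continuous[OF \<phi> T]])
    show "norm (block_fun \<phi> j T x) \<le> ?l" for x by (rule bnd[OF N])
    show "(\<integral>\<^sup>+x. ennreal (norm (block_fun \<phi> j T x) powr p) * indicator (dyadic_cube J k) x \<partial>lborel) \<le> ennreal (m powr (1 - p / u) * N powr p)"
      using N by (intro morrey_norm_cube p m) auto
  qed (use p r C N Nl in \<open>auto simp: m emeasure_dyadic_cube \<nu>_def\<close>)
  also have "(m powr (- 1 / u) * \<nu>) powr min 1 (p / r) = 2 powr ((real_of_int J - real j) * (?s * min 1 (p / r)))"
    unfolding m \<nu>_def powr_powr powr_add[symmetric]
    by (rule arg_cong[where f="\<lambda>t. 2 powr t"]) (simp add: diff_divide_distrib algebra_simps)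
  finally show ?thesis .
qed

theorem theorem4p10:
  fixes \<phi> :: "real^'d::finite \<Rightarrow> complex"
    and u p r :: real and q :: ennreal
  assumes "resolution_generator \<phi>"
    and "0 < p" and "p \<le> u" and "0 < q" and "1 \<le> r"
  shows "\<exists>c>0. \<forall>f \<in> besov_morrey \<phi> (real CARD('d) / u) u p q.
           regular f \<and>
           (\<forall>g. represents g f \<longrightarrow> (\<forall>Q\<in>dyadic_cubes.
              epowr (ennreal (1 / measure lebesgue Q) *
                     (\<integral>\<^sup>+ x\<in>Q. ennreal (norm (g x) powr r) \<partial>lebesgue)) (1 / r)
              \<le> ennreal (c * (1 + measure lebesgue Q) powr (- (min 1 (p / r) / u)) *
                         ln (exp 1 + 1 / measure lebesgue Q) powr (inv_conj_exponent q)) *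
                 besov_morrey_norm \<phi> (real CARD('d) / u) u p q f))"
proof -
  note \<phi> = assms(1)
  let ?s = "real CARD('d) / u" and ?\<kappa> = "inv_conj_exponent q"
  let ?\<theta> = "\<lambda>r (J::int) (j::nat). min 1 (2 powr ((real_of_int J - real j) * (?s * min 1 (p / r))))"
  have u: "u > 0" using assms by simp
  have d: "1 \<le> CARD('d)" by (simp add: Suc_leI)
  obtain C where C: "C \<ge> 1" and C': "\<And>T (j::nat) N y. tempered T \<Longrightarrow> 0 < N \<Longrightarrow> morrey_norm u p (block_fun \<phi> j T) \<le> ennreal N \<Longrightarrow>
    norm (block_fun \<phi> j T y) \<le> C * (2 powr (real j * ?s) * N)"
    using block_fun_bounded[OF assms(1-3)] by (elim exE conjE) blast
  \<comment> \<open>Stated for every exponent since two are used: 1 to obtain the function, r for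
    the estimate.\<close>
  have W: "\<exists>C>0. \<forall>(J::int) (b :: nat \<Rightarrow> real) \<beta>. (\<forall>j. 0 \<le> b j \<and> b j \<le> \<beta>) \<longrightarrow>
     (\<forall>n\<ge>1. (\<Sum>j<n. b j) \<le> 2 * real n powr ?\<kappa> * \<beta>) \<longrightarrow>
     summable (\<lambda>j. b j * ?\<theta> r J j) \<and>
     (\<Sum>j. b j * ?\<theta> r J j)
       \<le> C * ((1 + 2 powr (- real_of_int J * real CARD('d))) powr (- (?s * min 1 (p / r) / real CARD('d))) *
           ln (exp 1 + 1 / 2 powr (- real_of_int J * real CARD('d))) powr ?\<kappa>) * \<beta>" if "1 \<le> r" for r
    using that assms u d by (intro weighted_sum_bound inv_conj_exponent_bounds) auto
  obtain E where E: "E > 0" and E': "\<forall>(J::int) (b :: nat \<Rightarrow> real) \<beta>. (\<forall>j. 0 \<le> b j \<and> b j \<le> \<beta>) \<longrightarrow>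
     (\<forall>n\<ge>1. (\<Sum>j<n. b j) \<le> 2 * real n powr ?\<kappa> * \<beta>) \<longrightarrow>
     summable (\<lambda>j. b j * ?\<theta> r J j) \<and>
     (\<Sum>j. b j * ?\<theta> r J j)
       \<le> E * ((1 + 2 powr (- real_of_int J * real CARD('d))) powr (- (?s * min 1 (p / r) / real CARD('d))) *
           ln (exp 1 + 1 / 2 powr (- real_of_int J * real CARD('d))) powr ?\<kappa>) * \<beta>"
    using W[OF assms(5)] by (elim exE conjE)
  have main: "regular f \<and>
           (\<forall>g. represents g f \<longrightarrow> (\<forall>Q\<in>dyadic_cubes.
              epowr (ennreal (1 / measure lebesgue Q) *
                     (\<integral>\<^sup>+ x\<in>Q. ennreal (norm (g x) powr r) \<partial>lebesgue)) (1 / r)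
              \<le> ennreal (2 * C * E * (1 + measure lebesgue Q) powr (- (min 1 (p / r) / u)) *
                         ln (exp 1 + 1 / measure lebesgue Q) powr ?\<kappa>) *
                 besov_morrey_norm \<phi> ?s u p q f))" if f: "f \<in> besov_morrey \<phi> ?s u p q" for f
  proof -
    have T: "tempered f" and fin: "besov_morrey_norm \<phi> ?s u p q f < \<infinity>"
      using f by (auto simp: besov_morrey_def)
    define \<beta> where "\<beta> = enn2real (besov_morrey_norm \<phi> ?s u p q f)"
    have \<beta>: "besov_morrey_norm \<phi> ?s u p q f = ennreal \<beta>" "\<beta> \<ge> 0" using fin by (auto simp: \<beta>_def)
    show ?thesis
    proof (rule besov_morrey_blocks[OF \<phi> f assms(4), folded \<beta>_def])
      fix N :: "nat \<Rightarrow> real"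
      assume N: "\<And>j. 0 \<le> N j" "\<And>j. morrey_norm u p (block_fun \<phi> j f) = ennreal (N j)"
      "\<And>j. q = \<infinity> \<Longrightarrow> 2 powr (real j * ?s) * N j \<le> \<beta>"
      "\<And>n. q \<noteq> \<infinity> \<Longrightarrow> (\<Sum>j<n. (2 powr (real j * ?s) * N j) powr enn2real q) \<le> \<beta> powr enn2real q"
      define b where "b j = 2 powr (real j * ?s) * N j" for j
      have b: "b j \<ge> 0" for j using N(1) by (simp add: b_def)
      \<comment> \<open>The slack \<delta> makes \<beta> + \<delta> positive even when the norm of f
        vanishes.\<close>
      have b1: "b j \<le> \<beta> + \<delta>" and b2: "1 \<le> n \<Longrightarrow> (\<Sum>j<n. b j) \<le> 2 * real n powr ?\<kappa> * (\<beta> + \<delta>)" if \<delta>: "\<delta> > 0" for \<delta> j n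
      proof -
        have inf: "q = \<infinity> \<Longrightarrow> b j \<le> \<beta> + \<delta>" for j using N(3)[of j] \<delta> by (simp add: b_def)
        have fin: "q \<noteq> \<infinity> \<Longrightarrow> (\<Sum>j<n. b j powr enn2real q) \<le> (\<beta> + \<delta>) powr enn2real q" for n
          unfolding b_def by (rule order.trans[OF N(4)]) (use \<delta> \<beta> in \<open>auto intro!: powr_mono2\<close>)
        have pos: "\<beta> + \<delta> > 0" using \<beta> \<delta> by simp
        show "b j \<le> \<beta> + \<delta>" by (rule lq_partial_sum[OF b pos assms(4) inf fin])
        show "1 \<le> n \<Longrightarrow> (\<Sum>j<n. b j) \<le> 2 * real n powr ?\<kappa> * (\<beta> + \<delta>)" by (rule lq_sum_le[OF b pos assms(4) inf fin])
      qed
      \<comment> \<open>2 C is the constant of \<open>block_Lr_bound\<close>. The extra \<delta>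
        2^(-j) makes every weight strictly positive, as Minkowski's inequality requires, and adds up
        to 2 \<delta>.\<close>
      define L where "L r' J \<delta> j = 2 * C * ((b j + \<delta> * (1/2) ^ j) * ?\<theta> r' J j)" for r' J \<delta> j
      have Lpos: "L r' J \<delta> j > 0" if "\<delta> > 0" for r' J \<delta> j
      proof -
        have "b j + \<delta> * (1/2) ^ j > 0" using b[of j] that by (simp add: add_nonneg_pos)
        then show ?thesis unfolding L_def using C by (intro mult_pos_pos) auto
      qed
      have est: "(\<integral>\<^sup>+x. ennreal (norm (block_fun \<phi> j f x) powr r') * indicator (dyadic_cube J k) x \<partial>lborel)
          \<le> ennreal (2 powr (- real_of_int J * real CARD('d)) * L r' J \<delta> j powr r')"
        if "1 \<le> r'" "\<delta> > 0" for r' J \<delta> j k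
      proof -
        \<comment> \<open>The increment is \<delta> 2^(-j) divided by 2^(j d/u), so the level of the
          block becomes b j + \<delta> 2^(-j).\<close>
        let ?N = "N j + \<delta> * (1/2) ^ j * 2 powr (- (real j * ?s))"
        have N': "?N > 0" using N(1)[of j] that by (simp add: add_nonneg_pos)
        have le: "morrey_norm u p (block_fun \<phi> j f) \<le> ennreal ?N" unfolding N(2) using that by (intro ennreal_leI) simp
        have "2 powr (real j * ?s) * ?N = b j + \<delta> * (1/2) ^ j * (2 powr (real j * ?s) * 2 powr (- (real j * ?s)))"
          by (simp add: b_def algebra_simps)
        also have "2 powr (real j * ?s) * 2 powr (- (real j * ?s)) = 1" by (simp flip: powr_add)
        finally have eq: "2 powr (real j * ?s) * ?N = b j + \<delta> * (1/2) ^ j" by simp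
        show ?thesis
          using block_Lr_bound[OF \<phi> assms(2,3) T C C'[OF T] N' le that(1) refl, of J k]
          unfolding eq L_def by (simp only: mult.assoc)
      qed
      have sumL: "summable (L r' J \<delta>)" if r': "1 \<le> r'" and \<delta>: "\<delta> > 0" for r' J \<delta>
      proof -
        have "summable (\<lambda>j. b j * ?\<theta> r' J j)"
          using W[OF r'] b b1[OF \<delta>] b2[OF \<delta>] by blast
        moreover have "summable (\<lambda>j. \<delta> * (1/2) ^ j * ?\<theta> r' J j)"
        proof (rule summable_comparison_test')
          show "summable (\<lambda>j. \<delta> * (1/2) ^ j)" by (intro summable_mult summable_geometric) simp
          show "norm (\<delta> * (1/2) ^ j * ?\<theta> r' J j) \<le> \<delta> * (1/2) ^ j" for j
            using \<delta> by (simp add: abs_mult mult_left_le)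
        qed
        ultimately have "summable (\<lambda>j. 2 * C * (b j * ?\<theta> r' J j + \<delta> * (1/2) ^ j * ?\<theta> r' J j))"
          by (intro summable_mult summable_add)
        then show ?thesis unfolding L_def[abs_def] by (simp only: distrib_right)
      qed
      \<comment> \<open>Unit cubes, exponent 1 and \<delta> = 1 give the L_1 bounds that make f a
        function.\<close>
      obtain g0 where g0: "represents g0 f" "AE x in lborel. (\<lambda>n. \<Sum>j<n. block_fun \<phi> j f x) \<longlonglongrightarrow> g0 x"
      proof -
        have "(\<integral>\<^sup>+x. ennreal (norm (block_fun \<phi> j f x)) * indicator (dyadic_cube 0 k) x \<partial>lborel) \<le> ennreal (L 1 0 1 j)" for j k
          using est[of 1 1 j 0 k] Lpos[of 1 1 0 j] by simp
        then have "\<exists>g. represents g f \<and> (AE x in lborel. (\<lambda>n. \<Sum>j<n. block_fun \<phi> j f x) \<longlonglongrightarrow> g x)"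
          by (intro block_series_represents[OF \<phi> T, of "L 1 0 1"] sumL less_imp_le[OF Lpos]) auto
        then show ?thesis using that by blast
      qed
      show ?thesis
      proof (intro conjI allI impI ballI)
        show "regular f" using g0(1) by (auto simp: regular_def)
        fix g Q assume g: "represents g f" and "Q \<in> (dyadic_cubes :: (real^'d) set set)"
        then obtain J k where Q: "Q = dyadic_cube J k" by (auto simp: dyadic_cubes_def)
        define m where "m = measure lebesgue Q"
        have m: "m = 2 powr (- real_of_int J * real CARD('d))" "m > 0" by (simp_all add: m_def Q measure_dyadic_cube)
        have lim: "AE x in lborel. (\<lambda>n. \<Sum>j<n. block_fun \<phi> j f x) \<longlonglongrightarrow> g x"
          using g0(2) represents_unique_AE[OF \<phi> g g0(1)] by eventually_elim simp
        let ?I = "\<integral>\<^sup>+ x\<in>Q. ennreal (norm (g x) powr r) \<partial>lebesgue"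
        define w where "w = (1 + m) powr (- (min 1 (p / r) / u)) * ln (exp 1 + 1 / m) powr ?\<kappa>"
        have w: "w \<ge> 0" by (simp add: w_def)
        \<comment> \<open>The error is linear in \<delta>: 2 C E w stems from enlarging \<beta>, and
          4 C from the added series of sum 2 \<delta>.\<close>
        have bound: "epowr (ennreal (1 / m) * ?I) (1 / r) \<le> ennreal (2 * C * E * w * \<beta> + \<delta> * (2 * C * E * w + 4 * C))"
          if \<delta>: "\<delta> > 0" for \<delta>
        proof -
          let ?L = "L r J \<delta>"
          have L0: "suminf ?L \<ge> 0" by (intro suminf_nonneg sumL assms(5) \<delta> less_imp_le[OF Lpos])
          have "?I \<le> ennreal (m * suminf ?L powr r)"
            unfolding nn_integral_completion Q
          proof (rule nn_integral_powr_series[OF _ _ _ _ assms(5) _ _ lim])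
            show "block_fun \<phi> j f \<in> borel_measurable lborel" for j
              using borel_measurable_continuous_onI[OF block_fun_continuous[OF \<phi> T]] by simp
            show "(\<integral>\<^sup>+x. ennreal (norm (block_fun \<phi> j f x) powr r) * indicator (dyadic_cube J k) x \<partial>lborel) \<le> ennreal (m * ?L j powr r)" for j
              unfolding m(1) by (rule est[OF assms(5) \<delta>])
          qed (use sumL[OF assms(5) \<delta>] Lpos[OF \<delta>] m(2) in auto)
          then have "ennreal (1 / m) * ?I \<le> ennreal (1 / m) * ennreal (m * suminf ?L powr r)" by (rule mult_left_mono) simp
          also have "\<dots> = ennreal (suminf ?L powr r)" using m(2) by (simp flip: ennreal_mult)
          finally have le: "ennreal (1 / m) * ?I \<le> ennreal (suminf ?L powr r)" .
          then obtain i where i: "ennreal (1 / m) * ?I = ennreal i" "i \<ge> 0"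
            by (cases "ennreal (1 / m) * ?I") (auto simp: top_unique)
          have "i \<le> suminf ?L powr r" using le unfolding i(1) by (simp add: ennreal_le_iff)
          then have "i powr (1 / r) \<le> (suminf ?L powr r) powr (1 / r)" using i(2) assms(5) by (intro powr_mono2[of "1 / r"]) auto
          also have "\<dots> = suminf ?L" using L0 assms(5) by (simp add: powr_powr)
          finally have "epowr (ennreal (1 / m) * ?I) (1 / r) \<le> ennreal (suminf ?L)"
            unfolding i(1) epowr_ennreal[OF i(2)] by (rule ennreal_leI)
          also have "\<dots> \<le> ennreal (2 * C * E * w * \<beta> + \<delta> * (2 * C * E * w + 4 * C))"
          proof (rule ennreal_leI)
            have "(\<forall>j. 0 \<le> b j \<and> b j \<le> \<beta> + \<delta>)" "\<forall>n\<ge>1. (\<Sum>j<n. b j) \<le> 2 * real n powr ?\<kappa> * (\<beta> + \<delta>)"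
              using b b1[OF \<delta>] b2[OF \<delta>] by auto
            from E'[THEN spec[of _ J], THEN spec[of _ b], THEN spec[of _ "\<beta> + \<delta>"], THEN mp, THEN mp, OF this]
            have S: "summable (\<lambda>j. b j * ?\<theta> r J j)" "(\<Sum>j. b j * ?\<theta> r J j) \<le> E * w * (\<beta> + \<delta>)"
              unfolding w_def m(1) by (simp_all add: mult_ac)
            have g: "(\<lambda>j. \<delta> * (1/2) ^ j) sums (\<delta> * (1 / (1 - 1/2)))" by (intro sums_mult geometric_sums) simp
            have S': "summable (\<lambda>j. \<delta> * (1/2) ^ j)" by (rule sums_summable[OF g])
            have "suminf ?L \<le> (\<Sum>j. 2 * C * (b j * ?\<theta> r J j + \<delta> * (1/2) ^ j))"
            proof (rule suminf_le[OF _ sumL[OF assms(5) \<delta>]])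
              show "?L j \<le> 2 * C * (b j * ?\<theta> r J j + \<delta> * (1/2) ^ j)" for j
                unfolding L_def distrib_right using C \<delta> by (intro mult_left_mono add_left_mono mult_left_le) auto
              show "summable (\<lambda>j. 2 * C * (b j * ?\<theta> r J j + \<delta> * (1/2) ^ j))" by (intro summable_mult summable_add S S')
            qed
            also have "\<dots> = 2 * C * ((\<Sum>j. b j * ?\<theta> r J j) + (\<Sum>j. \<delta> * (1/2) ^ j))"
              using suminf_mult[OF summable_add[OF S(1) S'], of "2 * C"] suminf_add[OF S(1) S'] by simp
            also have "(\<Sum>j. \<delta> * (1/2) ^ j) = 2 * \<delta>" using sums_unique[OF g] by simp
            also have "2 * C * ((\<Sum>j. b j * ?\<theta> r J j) + 2 * \<delta>) \<le> 2 * C * (E * w * (\<beta> + \<delta>) + 2 * \<delta>)"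
              using S(2) C by (intro mult_left_mono add_right_mono) auto
            also have "\<dots> = 2 * C * E * w * \<beta> + \<delta> * (2 * C * E * w + 4 * C)" by (simp add: algebra_simps)
            finally show "suminf ?L \<le> 2 * C * E * w * \<beta> + \<delta> * (2 * C * E * w + 4 * C)" .
          qed
          finally show ?thesis .
        qed
        have "epowr (ennreal (1 / m) * ?I) (1 / r) \<le> ennreal (2 * C * E * w * \<beta>)"
        proof (rule ennreal_le_epsilon)
          fix e :: real assume e: "0 < e"
          \<comment> \<open>The coefficient of \<delta> in the error; \<delta> = e / z makes the
            error equal to e.\<close>
          define z where "z = 2 * C * E * w + 4 * C"
          have z: "z > 0" using C E w by (simp add: z_def add_nonneg_pos)
          have "epowr (ennreal (1 / m) * ?I) (1 / r) \<le> ennreal (2 * C * E * w * \<beta> + (e / z) * z)"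
            unfolding z_def by (rule bound) (use e z in \<open>simp add: z_def\<close>)
          also have "\<dots> = ennreal (2 * C * E * w * \<beta>) + ennreal e"
            using z e C E w \<beta>(2) by (simp add: ennreal_plus)
          finally show "epowr (ennreal (1 / m) * ?I) (1 / r) \<le> ennreal (2 * C * E * w * \<beta>) + ennreal e" .
        qed
        also have "\<dots> = ennreal (2 * C * E * w) * ennreal \<beta>" using C E w \<beta>(2) by (intro ennreal_mult) auto
        finally show "epowr (ennreal (1 / measure lebesgue Q) * ?I) (1 / r)
                \<le> ennreal (2 * C * E * (1 + measure lebesgue Q) powr (- (min 1 (p / r) / u)) *
                           ln (exp 1 + 1 / measure lebesgue Q) powr ?\<kappa>) * besov_morrey_norm \<phi> ?s u p q f"
          unfolding \<beta>(1) w_def m_def by (simp only: mult.assoc)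
      qed
    qed
  qed
  have "2 * C * E > 0" using C E by simp
  then show ?thesis using main by blast
qed

end
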